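(* Let $K$ be a number field of degree $d$ with $r_2$ pairs of complex conjugate embeddings and discriminant $\Delta_K$. Then there exists a monic irreducible polynomial $f(x) \in \mathbb{Z}[x]$ all of whose coefficients are nonzero such that $K \cong \mathbb{Q}[x]/\langle f(x) \rangle$ and $$\mathcal{M}(f) \leq \left\{ \left( \frac{4}{\pi} \right)^{r_2} \left( \frac{d(d^2-d+2)}{2} \right) |\Delta_K|^{1/2} \right\}^d.$$
   Context: For a monic polynomial $f(x) = \prod_{k=1}^d (x - \alpha_k) \in \mathbb{C}[x]$, its Mahler measure is $\mathcal{M}(f) = \prod_{k=1}^d \max\{1, |\alpha_k|\}$. *)

theory Defs
  imports
    "HOL-Algebra.Algebraic_Closure_Type"
    "HOL-Algebra.Generated_Fields"
    "Jordan_Normal_Form.Determinant"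
    "Berlekamp_Zassenhaus.Mahler_Measure"
begin

text \<open>
  In characteristic \<open>0\<close> the prime subfield is the copy of \<open>\<rat>\<close> inside \<open>K\<close>.
\<close>

definition prime_subfield :: "('a, 'b) ring_scheme \<Rightarrow> 'a set" where
  "prime_subfield K = generate_field K {}"

definition number_field :: "('a, 'b) ring_scheme \<Rightarrow> bool" where
  "number_field K \<longleftrightarrow>
     Ring.field K \<and>
     (\<forall>n::nat. n > 0 \<longrightarrow> [n] \<cdot>\<^bsub>K\<^esub> \<one>\<^bsub>K\<^esub> \<noteq> \<zero>\<^bsub>K\<^esub>) \<and>
     ring.finite_dimension K (prime_subfield K) (carrier K)"

definition field_degree :: "('a, 'b) ring_scheme \<Rightarrow> nat" where
  "field_degree K = ring.dim K (prime_subfield K) (carrier K)"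

text \<open>
  Embeddings are taken extensional, i.e. \<^const>\<open>undefined\<close> outside the carrier,
  so that distinct elements of the following set differ on \<open>K\<close>.
\<close>

definition complex_embeddings :: "('a, 'b) ring_scheme \<Rightarrow> ('a \<Rightarrow> complex) set" where
  "complex_embeddings K =
     Ring.ring_hom K (ring_of_type_algebra :: complex ring) \<inter> extensional (carrier K)"

definition num_complex_pairs :: "('a, 'b) ring_scheme \<Rightarrow> nat" where
  "num_complex_pairs K =
     card {{\<sigma>, restrict (\<lambda>x. cnj (\<sigma> x)) (carrier K)} |\<sigma>.
            \<sigma> \<in> complex_embeddings K \<and> \<not> \<sigma> ` carrier K \<subseteq> \<real>}"

definition ring_of_integers :: "('a, 'b) ring_scheme \<Rightarrow> 'a set" where
  "ring_of_integers K =
     {x \<in> carrier K. \<exists>p::int poly. Polynomial.lead_coeff p = 1 \<and>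
        (\<Oplus>\<^bsub>K\<^esub>i\<in>{..Polynomial.degree p}. [Polynomial.coeff p i] \<cdot>\<^bsub>K\<^esub> (x [^]\<^bsub>K\<^esub> i)) = \<zero>\<^bsub>K\<^esub>}"

definition integral_basis :: "('a, 'b) ring_scheme \<Rightarrow> (nat \<Rightarrow> 'a) \<Rightarrow> bool" where
  "integral_basis K \<omega> \<longleftrightarrow>
     (\<forall>i<field_degree K. \<omega> i \<in> ring_of_integers K) \<and>
     (\<forall>x\<in>ring_of_integers K. \<exists>!c::nat \<Rightarrow> int.
        c \<in> extensional {..<field_degree K} \<and>
        x = (\<Oplus>\<^bsub>K\<^esub>i\<in>{..<field_degree K}. [c i] \<cdot>\<^bsub>K\<^esub> \<omega> i))"

text \<open>
  The square of \<open>det (\<sigma>\<^sub>i \<omega>\<^sub>j)\<close> does not depend on the integral basis \<open>\<omega>\<close>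
  or on the enumeration \<open>\<sigma>\<close> of the embeddings, and it is a rational integer.
\<close>

definition discriminant :: "('a, 'b) ring_scheme \<Rightarrow> int" where
  "discriminant K =
     (THE D. \<exists>\<omega> \<sigma>. integral_basis K \<omega> \<and>
        bij_betw \<sigma> {..<field_degree K} (complex_embeddings K) \<and>
        complex_of_int D =
          (Determinant.det (Matrix.mat (field_degree K) (field_degree K) (\<lambda>(i, j). \<sigma> i (\<omega> j))))\<^sup>2)"

definition rat_poly_quotient :: "rat poly \<Rightarrow> rat poly set ring" where
  "rat_poly_quotient p =
     (ring_of_type_algebra :: rat poly ring) Quot (PIdl\<^bsub>ring_of_type_algebra\<^esub> p)"

end

theory Submission
  imports Defs "Jordan_Normal_Form.Char_Poly" "HOL-Library.Function_Algebras"
begin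

text \<open>
  Write \<open>S\<close> for the matrix of all embeddings \<open>\<sigma>\<^sub>i\<close> evaluated at an integral basis, so
  \<open>\<bar>det S\<bar>\<^sup>2 = \<bar>\<Delta>\<^sub>K\<bar>\<close>. Replacing each conjugate pair of rows by \<open>\<surd>2\<close> times its real and imaginary
  part gives a real matrix with the same absolute determinant. Minkowski's theorem on linear forms
  then yields a nonzero algebraic integer \<open>y\<close> with \<open>\<bar>\<sigma>\<^sub>i y\<bar> < 1\<close> for all embeddings but one, \<open>\<sigma>\<^sub>k\<close> (and
  its conjugate), and \<open>\<bar>\<sigma>\<^sub>k y\<bar> \<le> 2 \<surd>\<bar>\<Delta>\<^sub>K\<bar>\<close>. Since the norm of \<open>y\<close> is a nonzero integer,
  \<open>\<bar>\<sigma>\<^sub>k y\<bar> \<ge> 1\<close>, so \<open>\<sigma>\<^sub>k y\<close> differs from all other conjugates and \<open>y\<close> generates \<open>K\<close>. The \<open>i\<close>-th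
  coefficient of \<open>f(X - n)\<close>, for \<open>f\<close> the minimal polynomial of \<open>y\<close>, is a nonzero polynomial in \<open>n\<close> of
  degree \<open>d - i\<close>, so at most \<open>d(d+1)/2\<close> integers \<open>n\<close> make some coefficient vanish, and a shift by
  some \<open>\<bar>n\<bar> \<le> \<lceil>d(d+1)/4\<rceil>\<close> makes all coefficients nonzero. The sum of the two bounds is at most
  \<open>d(d\<^sup>2-d+2)/2 \<cdot> \<surd>\<bar>\<Delta>\<^sub>K\<bar>\<close> for \<open>d \<ge> 2\<close>; for \<open>d = 1\<close> take \<open>f = X - 1\<close>.
\<close>

section \<open>Minkowski's theorem on linear forms\<close>

text \<open>A box for real linear forms, rather than a body with one disc per complex pair, serves
  two purposes. At a complex place it can be long in the imaginary direction only: the form with the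
  real part stays below 1, so a value of modulus at least 1 is not real and differs from its own
  conjugate. And Minkowski's theorem for boxes reduces to a pigeonhole argument for integer matrices
  approximating the real one. The 2 in \<open>2 \<surd>\<bar>\<Delta>\<^sub>K\<bar>\<close> pays for
  bounds strictly below 1 in the other coordinates: t = 1 - 1/(2d) has t^(d-1) > 1/2, so the product
  of the bounds still exceeds the determinant. No generator of K is known until y is found, so the
  embeddings are counted without one: up to scaling they are the common eigenvectors of the
  multiplication operators on additive maps into the complex numbers. This argument occurs twice: on
  the abstract field, where a single eigenvector gives one embedding, and on the image in the
  complex numbers, where diagonalisability gives exactly d of them. Bases and integers are treated
  in that image and transported back.\<close>

lemma index_mult_mat_sum:
  assumes "A \<in> carrier_mat n m" "B \<in> carrier_mat m k" "i < n" "j < k"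
  shows "(A * B) $$ (i,j) = (\<Sum>l<m. A $$ (i,l) * B $$ (l,j))"
  using assms by (auto simp: scalar_prod_def atLeast0LessThan intro!: sum.cong)

text \<open>
  The function \<open>f\<close> labels the cosets of the column lattice of \<open>A\<close>. Unimodular column operations
  clear the first row except for one entry, which splits off a factor of the determinant.
\<close>

lemma int_lattice_index:
  fixes A :: "int mat"
  assumes "A \<in> carrier_mat n n" "det A \<noteq> 0"
  shows "\<exists>f :: (nat \<Rightarrow> int) \<Rightarrow> nat. (\<forall>u. f u < nat \<bar>det A\<bar>) \<and>
     (\<forall>u v. f u = f v \<longrightarrow> (\<exists>x. \<forall>i<n. u i - v i = (\<Sum>j<n. A $$ (i,j) * x j)))"
  using assms
proof (induction n arbitrary: A)
  case 0
  then have "det A = 1" by (simp add: det_def)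
  then show ?case by (intro exI[of _ "\<lambda>_. 0"]) auto
next
  case (Suc n A0)
  define N where "N = Suc n"
  define P where "P A \<longleftrightarrow> (\<exists>f :: (nat \<Rightarrow> int) \<Rightarrow> nat. (\<forall>u. f u < nat \<bar>det A\<bar>) \<and>
     (\<forall>u v. f u = f v \<longrightarrow> (\<exists>x. \<forall>i<N. u i - v i = (\<Sum>j<N. A $$ (i,j) * x j))))" for A :: "int mat"
  \<comment> \<open>End of the reduction: with first row (g, 0, ..., 0) a coset is described by a
    residue modulo \<open>g\<close> and a coset of the lower right block.\<close>
  have block: "P A" if A: "A \<in> carrier_mat N N" and dA: "det A \<noteq> 0"
    and z: "\<And>j. 0 < j \<Longrightarrow> j < N \<Longrightarrow> A $$ (0,j) = 0" for A
  proof -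
    define g where "g = A $$ (0,0)"
    define A' where "A' = mat_delete A 0 0"
    have A': "A' \<in> carrier_mat n n" using A mat_delete_carrier[of A N N 0 0] by (simp add: A'_def N_def)
    have idx: "A' $$ (i,j) = A $$ (Suc i, Suc j)" if "i < n" "j < n" for i j
      using mat_delete_index[of A n 0 0 i j] A that by (simp add: A'_def N_def insert_index_def)
    have "det A = (\<Sum>j<N. A $$ (0,j) * cofactor A 0 j)"
      by (rule laplace_expansion_row[OF A]) (simp add: N_def)
    also have "\<dots> = g * cofactor A 0 0"
      by (subst sum.remove[of _ 0]) (auto simp: N_def g_def z intro!: sum.neutral)
    finally have det: "det A = g * det A'" by (simp add: cofactor_def A'_def)
    with dA have g0: "g \<noteq> 0" and dA': "det A' \<noteq> 0" by auto
    from Suc.IH[OF A' dA'] obtain f where f1: "\<And>u. f u < nat \<bar>det A'\<bar>"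
      and f2: "\<And>u v. f u = f v \<Longrightarrow> \<exists>x. \<forall>i<n. u i - v i = (\<Sum>j<n. A' $$ (i,j) * x j)" by blast
    \<comment> \<open>Subtracting \<open>q u\<close> copies of the first column leaves the residue
      \<open>r u\<close> in coordinate 0 and \<open>t u\<close> in the others. The factor
      \<open>sgn g\<close> lets one formula serve both signs of \<open>g\<close>.\<close>
    define r where "r u = nat (u 0 mod \<bar>g\<bar>)" for u :: "nat \<Rightarrow> int"
    define q where "q u = sgn g * (u 0 div \<bar>g\<bar>)" for u :: "nat \<Rightarrow> int"
    define t where "t u = (\<lambda>i. u (Suc i) - q u * A $$ (Suc i, 0))" for u :: "nat \<Rightarrow> int"
    have qr: "u 0 = g * q u + int (r u)" for u
      using g0 by (simp add: q_def r_def mult.assoc[symmetric] abs_sgn[symmetric] mult.commute[of g] )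
    \<comment> \<open>Mixed-radix packing of the residue and the label of the tail; its range has
      size \<open>\<bar>g\<bar> * \<bar>det A'\<bar> = \<bar>det A\<bar>\<close>.\<close>
    define h where "h u = r u + nat \<bar>g\<bar> * f (t u)" for u
    have rl: "r u < nat \<bar>g\<bar>" for u using g0 by (simp add: r_def)
    have "h u < nat \<bar>det A\<bar>" for u
    proof -
      have "h u < nat \<bar>g\<bar> * (f (t u) + 1)" using rl[of u] by (simp add: h_def)
      also have "\<dots> \<le> nat \<bar>g\<bar> * nat \<bar>det A'\<bar>"
        using f1[of "t u"] by (intro mult_left_mono) auto
      also have "\<dots> = nat \<bar>det A\<bar>" by (simp add: det abs_mult nat_mult_distrib)
      finally show ?thesis .
    qed
    moreover have "\<exists>x. \<forall>i<N. u i - v i = (\<Sum>j<N. A $$ (i,j) * x j)" if "h u = h v" for u v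
    proof -
      have "r u = r v"
        using arg_cong[OF that, of "\<lambda>z. z mod nat \<bar>g\<bar>"] rl[of u] rl[of v] by (simp add: h_def)
      moreover have "f (t u) = f (t v)"
        using that \<open>r u = r v\<close> g0 by (simp add: h_def)
      then obtain x where x: "\<And>i. i < n \<Longrightarrow> t u i - t v i = (\<Sum>j<n. A' $$ (i,j) * x j)"
        using f2 by blast
      define y where "y j = (case j of 0 \<Rightarrow> q u - q v | Suc k \<Rightarrow> x k)" for j
      have "u i - v i = (\<Sum>j<N. A $$ (i,j) * y j)" if "i < N" for i
      proof (cases i)
        case 0
        have "(\<Sum>j<N. A $$ (i,j) * y j) = g * (q u - q v)"
          unfolding N_def sum.lessThan_Suc_shift using 0 z
          by (auto simp: N_def y_def g_def intro!: sum.neutral)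
        then show ?thesis using qr[of u] qr[of v] \<open>r u = r v\<close> 0 by (simp add: algebra_simps)
      next
        case (Suc k)
        then have "k < n" using that by (simp add: N_def)
        have "(\<Sum>j<N. A $$ (i,j) * y j) = A $$ (i,0) * (q u - q v) + (\<Sum>j<n. A' $$ (k,j) * x j)"
          unfolding N_def sum.lessThan_Suc_shift using Suc \<open>k < n\<close> by (simp add: y_def idx)
        also have "\<dots> = u i - v i" using x[OF \<open>k < n\<close>] Suc by (simp add: t_def algebra_simps)
        finally show ?thesis ..
      qed
      then show ?thesis by blast
    qed
    ultimately show ?thesis unfolding P_def by blast
  qed
  \<comment> \<open>The columns of \<open>A * E\<close> lie in the column lattice of
    \<open>A\<close>, so vectors congruent modulo \<open>A * E\<close> are congruent modulo
    \<open>A\<close>. Equal determinants keep the number of labels.\<close>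
  have mulE: "P A" if A: "A \<in> carrier_mat N N" and E: "E \<in> carrier_mat N N" and
    d: "\<bar>det (A * E)\<bar> = \<bar>det A\<bar>" and P: "P (A * E)" for A E
  proof -
    from P obtain f where f: "\<And>u. f u < nat \<bar>det A\<bar>"
      "\<And>u v. f u = f v \<Longrightarrow> \<exists>x. \<forall>i<N. u i - v i = (\<Sum>j<N. (A * E) $$ (i,j) * x j)"
      unfolding P_def d by blast
    have "\<exists>x. \<forall>i<N. u i - v i = (\<Sum>j<N. A $$ (i,j) * x j)" if uv: "f u = f v" for u v
    proof -
      from f(2)[OF uv] obtain x where x: "\<And>i. i < N \<Longrightarrow> u i - v i = (\<Sum>j<N. (A * E) $$ (i,j) * x j)"
        by blast
      have "u i - v i = (\<Sum>k<N. A $$ (i,k) * (\<Sum>j<N. E $$ (k,j) * x j))" if i: "i < N" for i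
      proof -
        have "u i - v i = (\<Sum>j<N. (\<Sum>k<N. A $$ (i,k) * E $$ (k,j)) * x j)"
          using A E i x[OF i] by (auto simp: scalar_prod_def atLeast0LessThan intro!: sum.cong)
        also have "\<dots> = (\<Sum>k<N. \<Sum>j<N. A $$ (i,k) * E $$ (k,j) * x j)"
          unfolding sum_distrib_right by (rule sum.swap)
        finally show ?thesis by (simp add: sum_distrib_left mult.assoc)
      qed
      then show ?thesis by (intro exI[of _ "\<lambda>k. \<Sum>j<N. E $$ (k,j) * x j"]) blast
    qed
    then show ?thesis unfolding P_def using f(1) by blast
  qed
  have "P A" if "A \<in> carrier_mat N N" "det A \<noteq> 0" for A
    using that
  \<comment> \<open>Euclid's algorithm on the first row: each column addition lowers the sum of
    absolute values, until a single nonzero entry is left.\<close>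
  proof (induction "\<Sum>j<N. nat \<bar>A $$ (0,j)\<bar>" arbitrary: A rule: less_induct)
    case (less A)
    note A = less.prems(1)
    have N0: "0 < N" by (simp add: N_def)
    show ?case
    proof (cases "\<exists>j<N. \<exists>k<N. j \<noteq> k \<and> A $$ (0,j) \<noteq> 0 \<and> A $$ (0,k) \<noteq> 0")
      case True
      then obtain j' k' where jk': "j' < N" "k' < N" "j' \<noteq> k'" "A $$ (0,j') \<noteq> 0" "A $$ (0,k') \<noteq> 0"
        by blast
      obtain j k where jk: "j < N" "k < N" "j \<noteq> k" "A $$ (0,j) \<noteq> 0" "A $$ (0,k) \<noteq> 0"
        and le: "\<bar>A $$ (0,k)\<bar> \<le> \<bar>A $$ (0,j)\<bar>"
      proof (cases "\<bar>A $$ (0,k')\<bar> \<le> \<bar>A $$ (0,j')\<bar>")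
        case True
        then show ?thesis using that[of j' k'] jk' by simp
      next
        case False
        then show ?thesis using that[of k' j'] jk' by simp
      qed
      \<comment> \<open>With this sign the larger entry loses the absolute value of the smaller
        one.\<close>
      define a where "a = - (sgn (A $$ (0,j)) * sgn (A $$ (0,k)))"
      define B where "B = addcol a j k A"
      have B: "B \<in> carrier_mat N N" unfolding B_def addcol_mat[OF A jk(2)] using A by (rule mult_carrier_mat) simp
      have BE: "B = A * addrow_mat N a k j" unfolding B_def by (rule addcol_mat[OF A jk(2)])
      have dB: "det B = det A"
        unfolding B_def by (rule det_addcol[OF jk(2) _ A]) (use jk in auto)
      have small: "\<bar>a * A $$ (0,k) + A $$ (0,j)\<bar> < \<bar>A $$ (0,j)\<bar>"
      proof -
        have "a * A $$ (0,k) + A $$ (0,j) = sgn (A $$ (0,j)) * (\<bar>A $$ (0,j)\<bar> - \<bar>A $$ (0,k)\<bar>)"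
          by (simp add: a_def right_diff_distrib abs_mult_sgn abs_sgn[of "A $$ (0,k)"] ac_simps)
        then show ?thesis using jk(4,5) le by (simp add: abs_mult)
      qed
      have "(\<Sum>i<N. nat \<bar>B $$ (0,i)\<bar>) < (\<Sum>i<N. nat \<bar>A $$ (0,i)\<bar>)"
      proof (rule sum_strict_mono_ex1)
        have Bi: "B $$ (0,i) = (if i = j then a * A $$ (0,k) + A $$ (0,j) else A $$ (0,i))" if "i < N" for i
          using A that N0 by (auto simp: B_def)
        show "\<forall>i\<in>{..<N}. nat \<bar>B $$ (0,i)\<bar> \<le> nat \<bar>A $$ (0,i)\<bar>"
          using small by (auto simp: Bi)
        show "\<exists>i\<in>{..<N}. nat \<bar>B $$ (0,i)\<bar> < nat \<bar>A $$ (0,i)\<bar>"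
          using small jk by (intro bexI[of _ j]) (auto simp: Bi)
      qed simp
      then have "P B" using less.hyps[of B] B dB less.prems by simp
      then show ?thesis using mulE[OF A, of "addrow_mat N a k j"] dB by (simp add: BE)
    next
      case False
      show ?thesis
      proof (cases "\<exists>j<N. j \<noteq> 0 \<and> A $$ (0,j) \<noteq> 0")
        case True
        then obtain j where j: "j < N" "j \<noteq> 0" "A $$ (0,j) \<noteq> 0" by blast
        have oth: "A $$ (0,k) = 0" if "k < N" "k \<noteq> j" for k using False j that by blast
        have dB: "det (swapcols 0 j A) = - det A"
          by (rule det_swapcols[OF _ _ _ A]) (use j N0 in auto)
        have "P (swapcols 0 j A)"
          by (rule block) (use A dB less.prems j oth N0 in auto)
        moreover have "swapcols 0 j A = A * swaprows_mat N 0 j"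
          by (rule swapcols_mat[OF A N0 j(1)])
        ultimately show ?thesis using mulE[OF A, of "swaprows_mat N 0 j"] dB by simp
      next
        case False
        then show ?thesis using block[of A] less.prems by blast
      qed
    qed
  qed
  then show ?case using Suc.prems unfolding P_def N_def by blast
qed

text \<open>Pigeonhole: the box of integer points with 0 <= u_i < c_i has more points than the
  column lattice has cosets. Two points of one coset differ by the image of an integer vector, and
  their difference is smaller than c_i in each coordinate.\<close>

lemma minkowski_linear_forms_int:
  fixes A :: "int mat" and c :: "nat \<Rightarrow> nat"
  assumes A: "A \<in> carrier_mat n n" "det A \<noteq> 0"
    and c: "int (\<Prod>i<n. c i) > \<bar>det A\<bar>"
  shows "\<exists>x::nat \<Rightarrow> int. (\<exists>i<n. x i \<noteq> 0) \<and> (\<forall>i<n. \<bar>\<Sum>j<n. A $$ (i,j) * x j\<bar> < int (c i))"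
proof -
  from int_lattice_index[OF A] obtain f :: "(nat \<Rightarrow> int) \<Rightarrow> nat" where
    f1: "\<And>u. f u < nat \<bar>det A\<bar>" and
    f2: "\<And>u v. f u = f v \<Longrightarrow> \<exists>x. \<forall>i<n. u i - v i = (\<Sum>j<n. A $$ (i,j) * x j)" by blast
  define B where "B = PiE {..<n} (\<lambda>i. {0..<int (c i)})"
  have cB: "card B = (\<Prod>i<n. c i)" unfolding B_def by (simp add: card_PiE)
  have "f ` B \<subseteq> {..<nat \<bar>det A\<bar>}" using f1 by auto
  from card_mono[OF _ this] have "card (f ` B) \<le> nat \<bar>det A\<bar>" by simp
  also have "\<dots> < card B" using c unfolding cB by linarith
  finally have "\<not> inj_on f B" by (rule pigeonhole)
  then obtain u v where uv: "u \<in> B" "v \<in> B" "u \<noteq> v" "f u = f v" by (auto simp: inj_on_def)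
  from f2[OF uv(4)] obtain x where x: "\<And>i. i < n \<Longrightarrow> u i - v i = (\<Sum>j<n. A $$ (i,j) * x j)" by blast
  have "\<exists>i<n. u i \<noteq> v i" using uv(1-3) PiE_ext[of u "{..<n}" _ v] unfolding B_def by blast
  then have
    "\<exists>j<n. x j \<noteq> 0" using x by (metis (no_types, lifting) lessThan_iff mult_zero_right right_minus_eq sum.neutral)
  moreover have "\<bar>\<Sum>j<n. A $$ (i,j) * x j\<bar> < int (c i)" if "i < n" for i
  proof -
    have "0 \<le> u i" "u i < int (c i)" "0 \<le> v i" "v i < int (c i)" using uv(1,2) that by (auto simp: B_def PiE_def Pi_def)
    then show ?thesis unfolding x[OF that, symmetric] by linarith
  qed
  ultimately show ?thesis by blast
qed


lemma tendsto_floor_div: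
  fixes a :: real
  shows "(\<lambda>Q::nat. of_int \<lfloor>real Q * a\<rfloor> / real Q) \<longlonglongrightarrow> a"
proof (rule tendsto_sandwich[of "\<lambda>Q. a - 1 / real Q" _ _ "\<lambda>Q. a"])
  show "\<forall>\<^sub>F Q in sequentially. a - 1 / real Q \<le> of_int \<lfloor>real Q * a\<rfloor> / real Q"
    using eventually_gt_at_top[of 0]
    by eventually_elim (simp add: field_simps, linarith)
  show "\<forall>\<^sub>F Q in sequentially. of_int \<lfloor>real Q * a\<rfloor> / real Q \<le> a"
    using eventually_gt_at_top[of 0]
    by eventually_elim (simp add: field_simps)
  show "(\<lambda>Q. a - 1 / real Q) \<longlonglongrightarrow> a"
    using tendsto_diff[OF tendsto_const lim_1_over_n, of a] by simp
qed simp

lemma tendsto_det: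
  fixes B :: "nat \<Rightarrow> real mat"
  assumes "A \<in> carrier_mat n n" "\<And>Q. B Q \<in> carrier_mat n n"
    and "\<And>i j. i < n \<Longrightarrow> j < n \<Longrightarrow> (\<lambda>Q. B Q $$ (i,j)) \<longlonglongrightarrow> A $$ (i,j)"
  shows "(\<lambda>Q. det (B Q)) \<longlonglongrightarrow> det A"
  unfolding det_def'[OF assms(1)] det_def'[OF assms(2)]
proof (intro tendsto_sum tendsto_mult tendsto_const tendsto_prod)
  fix p i assume "p \<in> {p. p permutes {0..<n}}" "i \<in> {0..<n}"
  then have "p i < n" "i < n" using permutes_in_image[of p "{0..<n}" i] by (auto simp: atLeast0LessThan)
  then show "(\<lambda>Q. B Q $$ (i, p i)) \<longlonglongrightarrow> A $$ (i, p i)" by (intro assms(3))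
qed

text \<open>Approximation and compactness: the integer version applies to the entrywise floor of Q *
  A, with bounds scaled by Q. Its solutions stay in a finite set independent of Q, so if every
  candidate violates some inequality for \<open>A\<close>, a large Q gives a contradiction. The
  passage to the limit is what turns strict bounds into weak ones.\<close>

theorem minkowski_linear_forms:
  fixes A :: "real mat" and c :: "nat \<Rightarrow> real"
  assumes A: "A \<in> carrier_mat n n" "det A \<noteq> 0"
    and c: "\<And>i. i < n \<Longrightarrow> c i > 0" "(\<Prod>i<n. c i) > \<bar>det A\<bar>"
  shows "\<exists>x::nat \<Rightarrow> int. (\<exists>i<n. x i \<noteq> 0) \<and> (\<forall>i<n. \<bar>\<Sum>j<n. A $$ (i,j) * of_int (x j)\<bar> \<le> c i)"
proof (rule ccontr)
  assume contra: "\<not> ?thesis"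
  define N where "N Q = map_mat (\<lambda>a. \<lfloor>real Q * a\<rfloor>) A" for Q :: nat
  define B where "B Q = (1 / real Q) \<cdot>\<^sub>m map_mat of_int (N Q)" for Q :: nat
  have N: "N Q \<in> carrier_mat n n" for Q using A by (simp add: N_def)
  have B: "B Q \<in> carrier_mat n n" for Q using N by (simp add: B_def)
  have Bij: "B Q $$ (i,j) = of_int \<lfloor>real Q * A $$ (i,j)\<rfloor> / real Q" if "i < n" "j < n" for Q i j
    using A that by (simp add: B_def N_def)
  have dB: "det (B Q) = of_int (det (N Q)) / real Q ^ n" for Q
    unfolding B_def using N[of Q] by (simp add: det_smult of_int_hom.hom_det power_one_over field_simps)
  have lim: "(\<lambda>Q. det (B Q)) \<longlonglongrightarrow> det A"
    by (rule tendsto_det[OF A(1) B]) (simp add: Bij tendsto_floor_div)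
  have ev1: "\<forall>\<^sub>F Q in sequentially. det (B Q) \<noteq> 0"
    using tendsto_imp_eventually_ne[OF lim A(2)] .
  have ev2: "\<forall>\<^sub>F Q in sequentially. \<bar>det (B Q)\<bar> < (\<Prod>i<n. c i)"
    using order_tendstoD(2)[OF tendsto_rabs[OF lim] c(2)] .
  \<comment> \<open>The inverse matrix recovers \<open>x\<close> from its form values, which bounds
    solutions independently of Q.\<close>
  obtain C where C: "C \<in> carrier_mat n n" "C * A = 1\<^sub>m n"
    using det_non_zero_imp_unit[OF A, of "()"] by (auto simp: Units_def ring_mat_def)
  define L where "L x i = (\<Sum>j<n. A $$ (i,j) * of_int (x j))" for x :: "nat \<Rightarrow> int" and i
  define l1 where "l1 x = (\<Sum>j<n. \<bar>real_of_int (x j)\<bar>)" for x :: "nat \<Rightarrow> int"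
  define K where "K = (\<Sum>k<n. \<Sum>i<n. \<bar>C $$ (k,i)\<bar>)"
  have K0: "K \<ge> 0" unfolding K_def by (intro sum_nonneg) auto
  have inv: "real_of_int (x k) = (\<Sum>i<n. C $$ (k,i) * L x i)" if "k < n" for x k
  proof -
    have "(\<Sum>i<n. C $$ (k,i) * L x i) = (\<Sum>j<n. (\<Sum>i<n. C $$ (k,i) * A $$ (i,j)) * of_int (x j))"
      unfolding L_def sum_distrib_left sum_distrib_right by (subst sum.swap) (simp add: mult.assoc)
    also have "\<dots> = (\<Sum>j<n. (C * A) $$ (k,j) * of_int (x j))"
      by (intro sum.cong refl) (simp add: index_mult_mat_sum[OF C(1) A(1) that])
    also have "\<dots> = (\<Sum>j<n. if j = k then of_int (x j) else 0)"
      unfolding C(2) using that by (intro sum.cong) auto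
    also have "\<dots> = of_int (x k)" using that by simp
    finally show ?thesis ..
  qed
  have bound: "l1 x \<le> K * M" if M: "\<And>i. i < n \<Longrightarrow> \<bar>L x i\<bar> \<le> M" for x M
  proof -
    have "\<bar>real_of_int (x k)\<bar> \<le> (\<Sum>i<n. \<bar>C $$ (k,i)\<bar> * M)" if "k < n" for k
      unfolding inv[OF that]
      by (rule order_trans[OF sum_abs]) (auto simp: abs_mult intro!: sum_mono mult_left_mono M)
    then show ?thesis unfolding l1_def K_def sum_distrib_right by (intro sum_mono) auto
  qed
  define Cs where "Cs = (\<Sum>i<n. c i)"
  have cCs: "c i \<le> Cs" if "i < n" for i
    unfolding Cs_def using c(1) that by (intro member_le_sum) (auto intro: less_imp_le)
  \<comment> \<open>Rounding gives \<open>l1 x \<le> K * (Cs + l1 x / Q)\<close>, hence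
    \<open>l1 x \<le> 2 * K * Cs\<close> once \<open>Q \<ge> 2 * K\<close>. The candidates in
    \<open>F\<close> are extensional so that there are finitely many of them.\<close>
  define b where "b = \<lceil>2 * K * Cs\<rceil>"
  define F where "F = {x \<in> PiE {..<n} (\<lambda>_. {-b..b}). \<exists>i<n. x i \<noteq> 0}"
  have "finite F" unfolding F_def by (intro finite_subset[OF _ finite_PiE[of "{..<n}" "\<lambda>_. {-b..b}"]]) auto
  have ev3: "\<forall>\<^sub>F Q::nat in sequentially. \<exists>i<n. c i + l1 x / real Q < \<bar>L x i\<bar>" if "x \<in> F" for x
  proof -
    from contra that obtain i where i: "i < n" "c i < \<bar>L x i\<bar>" by (auto simp: F_def L_def not_le)
    have "(\<lambda>Q. c i + l1 x * (1 / real Q)) \<longlonglongrightarrow> c i + l1 x * 0" by (intro tendsto_intros lim_1_over_n)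
    then have "\<forall>\<^sub>F Q in sequentially. c i + l1 x * (1 / real Q) < \<bar>L x i\<bar>"
      using i(2) by (intro order_tendstoD(2)) auto
    then show ?thesis by eventually_elim (use i in auto)
  qed
  have ev3': "\<forall>\<^sub>F Q::nat in sequentially. \<forall>x\<in>F. \<exists>i<n. c i + l1 x / real Q < \<bar>L x i\<bar>"
    using ev3 \<open>finite F\<close> by (intro eventually_ball_finite) auto
  have ev4: "\<forall>\<^sub>F Q::nat in sequentially. real Q \<ge> 2 * K"
    using eventually_ge_at_top[of "nat \<lceil>2 * K\<rceil>"] by eventually_elim linarith
  have "\<forall>\<^sub>F Q::nat in sequentially. False"
    using ev1 ev2 ev3' ev4 eventually_gt_at_top[of 0]
  proof eventually_elim
    case (elim Q)
    define cq where "cq i = nat \<lceil>real Q * c i\<rceil>" for i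
    have Q: "real Q > 0" using elim by simp
    have cqr: "real (cq i) \<ge> real Q * c i" if "i < n" for i
      unfolding cq_def by (simp add: real_nat_ceiling_ge)
    have "\<bar>real_of_int (det (N Q))\<bar> < real Q ^ n * (\<Prod>i<n. c i)"
      using elim(2) Q by (simp add: dB abs_divide field_simps)
    also have "\<dots> = (\<Prod>i<n. real Q * c i)" by (simp add: prod.distrib)
    also have "\<dots> \<le> (\<Prod>i<n. real (cq i))"
      using cqr c(1) Q by (intro prod_mono) (auto intro: less_imp_le)
    also have "\<dots> = real_of_int (int (\<Prod>i<n. cq i))" by simp
    finally have "\<bar>det (N Q)\<bar> < int (\<Prod>i<n. cq i)"
      unfolding of_int_abs[symmetric] of_int_less_iff .
    moreover have "det (N Q) \<noteq> 0" using elim(1) by (auto simp: dB)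
    ultimately obtain x where x: "\<exists>i<n. x i \<noteq> 0"
      "\<And>i. i < n \<Longrightarrow> \<bar>\<Sum>j<n. N Q $$ (i,j) * x j\<bar> < int (cq i)"
      using minkowski_linear_forms_int[OF N, of Q cq] by blast
    have Lx: "\<bar>L x i\<bar> \<le> c i + l1 x / real Q" if "i < n" for i
    proof -
      define s where "s = (\<Sum>j<n. N Q $$ (i,j) * x j)"
      \<comment> \<open>For an integer, being below the ceiling of a real number means being below
        the number itself, so rounding the bounds up costs nothing.\<close>
      have "s < \<lceil>real Q * c i\<rceil>" "- s < \<lceil>real Q * c i\<rceil>"
        using x(2)[OF that] mult_pos_pos[OF Q c(1)[OF that]] unfolding s_def[symmetric] cq_def
        by (auto split: if_splits)
      then have "\<bar>real_of_int s\<bar> < real Q * c i" by linarith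
      then have s1: "\<bar>real_of_int s / real Q\<bar> < c i" using Q by (simp add: abs_divide field_simps)
      have "L x i - real_of_int s / real Q = (\<Sum>j<n. (A $$ (i,j) - B Q $$ (i,j)) * of_int (x j))"
        using A that Q by (simp add: L_def s_def Bij N_def sum_divide_distrib sum_subtractf left_diff_distrib)
      also have "\<bar>\<dots>\<bar> \<le> (\<Sum>j<n. \<bar>(A $$ (i,j) - B Q $$ (i,j)) * of_int (x j)\<bar>)" by (rule sum_abs)
      also have "\<dots> \<le> (\<Sum>j<n. 1 / real Q * \<bar>of_int (x j)\<bar>)"
      proof (rule sum_mono)
        fix j assume "j \<in> {..<n}"
        then have j: "j < n" by simp
        have "real_of_int \<lfloor>real Q * A $$ (i,j)\<rfloor> \<le> real Q * A $$ (i,j)"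
           "real Q * A $$ (i,j) \<le> real_of_int \<lfloor>real Q * A $$ (i,j)\<rfloor> + 1" by linarith+
        then have "\<bar>A $$ (i,j) - B Q $$ (i,j)\<bar> \<le> 1 / real Q"
          using Q unfolding Bij[OF that j] by (simp add: field_simps abs_le_iff)
        then show "\<bar>(A $$ (i,j) - B Q $$ (i,j)) * of_int (x j)\<bar> \<le> 1 / real Q * \<bar>of_int (x j)\<bar>"
          unfolding abs_mult by (intro mult_right_mono) auto
      qed
      also have "\<dots> = l1 x / real Q" by (simp add: l1_def sum_divide_distrib)
      finally show ?thesis using s1 by linarith
    qed
    have "l1 x \<le> K * (Cs + l1 x / real Q)"
      by (rule bound) (use Lx cCs in \<open>fastforce intro: order_trans\<close>)
    moreover have "l1 x \<ge> 0" unfolding l1_def by (intro sum_nonneg) auto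
    then have "K * (l1 x / real Q) \<le> l1 x / 2"
      using mult_right_mono[OF elim(4), of "l1 x"] Q by (simp add: field_simps)
    ultimately have Xb: "l1 x \<le> 2 * K * Cs" unfolding distrib_left by linarith
    have xb: "x j \<in> {-b..b}" if "j < n" for j
    proof -
      have "\<bar>real_of_int (x j)\<bar> \<le> l1 x" unfolding l1_def using that by (intro member_le_sum) auto
      then show ?thesis using Xb unfolding b_def by (auto, linarith+)
    qed
    have eq: "restrict x {..<n} j = x j" if "j < n" for j using that by simp
    have "restrict x {..<n} \<in> F" unfolding F_def using xb x(1) by auto
    then obtain i where "i < n" "c i + l1 (restrict x {..<n}) / real Q < \<bar>L (restrict x {..<n}) i\<bar>"
      using elim(3) by blast
    then show False using Lx[of i] by (simp add: l1_def L_def)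
  qed
  then show False by simp
qed

section \<open>Algebraic integers\<close>

lemma char_poly_root_if_eigenvector:
  fixes A :: "complex mat"
  assumes A: "A \<in> carrier_mat n n" and i0: "i0 < n" "v i0 \<noteq> 0"
    and eig: "\<And>i. i < n \<Longrightarrow> (\<Sum>j<n. A $$ (i,j) * v j) = x * v i"
  shows "poly (char_poly A) x = 0"
proof -
  define w where "w = vec n v"
  have "w $ i0 \<noteq> 0" using i0 by (simp add: w_def)
  then have w0: "w \<noteq> 0\<^sub>v n" using i0 by auto
  have "A *\<^sub>v w = x \<cdot>\<^sub>v w"
  proof (rule eq_vecI)
    fix i assume "i < dim_vec (x \<cdot>\<^sub>v w)"
    then have i: "i < n" by (simp add: w_def)
    then show "(A *\<^sub>v w) $ i = (x \<cdot>\<^sub>v w) $ i"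
      using A eig[OF i] by (simp add: w_def scalar_prod_def atLeast0LessThan)
  qed (use A in \<open>simp add: w_def\<close>)
  then have "eigenvalue A x"
    unfolding eigenvalue_def eigenvector_def using w0 A by (intro exI[of _ w]) (simp add: w_def)
  then show ?thesis using eigenvalue_root_char_poly[OF A] by simp
qed

definition int_span :: "complex set \<Rightarrow> complex set" where
  "int_span G = {\<Sum>g\<in>G. of_int (c g) * g | c. True}"

lemma int_span_add: "a \<in> int_span G \<Longrightarrow> b \<in> int_span G \<Longrightarrow> a + b \<in> int_span G"
proof -
  assume "a \<in> int_span G" "b \<in> int_span G"
  then obtain c d where "a = (\<Sum>g\<in>G. of_int (c g) * g)" "b = (\<Sum>g\<in>G. of_int (d g) * g)"
    by (auto simp: int_span_def)
  then have "a + b = (\<Sum>g\<in>G. of_int (c g + d g) * g)" by (simp add: sum.distrib distrib_right)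
  then show ?thesis unfolding int_span_def by (intro CollectI exI[of _ "\<lambda>g. c g + d g"]) simp
qed

lemma int_span_scale: "a \<in> int_span G \<Longrightarrow> of_int k * a \<in> int_span G"
proof -
  assume "a \<in> int_span G"
  then obtain c where "a = (\<Sum>g\<in>G. of_int (c g) * g)" by (auto simp: int_span_def)
  then have "of_int k * a = (\<Sum>g\<in>G. of_int (k * c g) * g)" by (simp add: sum_distrib_left mult.assoc)
  then show ?thesis unfolding int_span_def by (intro CollectI exI[of _ "\<lambda>g. k * c g"]) simp
qed

lemma int_span_zero: "0 \<in> int_span G"
  unfolding int_span_def by (intro CollectI exI[of _ "\<lambda>_. 0"]) simp

lemma int_span_sum: "(\<And>i. i \<in> I \<Longrightarrow> f i \<in> int_span G) \<Longrightarrow> sum f I \<in> int_span G"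
  by (induction I rule: infinite_finite_induct) (auto intro: int_span_zero int_span_add)

lemma int_span_base: "finite G \<Longrightarrow> g \<in> G \<Longrightarrow> g \<in> int_span G"
  unfolding int_span_def
  by (intro CollectI exI[of _ "\<lambda>h. if h = g then 1 else 0"]) (simp add: if_distrib if_distribR sum.delta cong: if_cong)

lemma int_span_stable:
  assumes "\<And>g. g \<in> G \<Longrightarrow> x * g \<in> int_span G" "a \<in> int_span G"
  shows "x * a \<in> int_span G"
proof -
  from assms(2) obtain c where "a = (\<Sum>g\<in>G. of_int (c g) * g)" by (auto simp: int_span_def)
  then have "x * a = (\<Sum>g\<in>G. of_int (c g) * (x * g))" by (simp add: sum_distrib_left algebra_simps)
  also have "\<dots> \<in> int_span G" by (intro int_span_sum int_span_scale assms(1))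
  finally show ?thesis .
qed

text \<open>Multiplication by \<open>x\<close> acts on the generators through an integer matrix. The
  generators form an eigenvector with eigenvalue \<open>x\<close>, so \<open>x\<close> is a root of
  a monic integer characteristic polynomial.\<close>

lemma algebraic_int_if_stable:
  assumes G: "finite G" "g0 \<in> G" "g0 \<noteq> 0" and st: "\<And>g. g \<in> G \<Longrightarrow> x * g \<in> int_span G"
  shows "algebraic_int x"
proof -
  define n where "n = card G"
  obtain g where g: "bij_betw g {..<n} G"
    using ex_bij_betw_nat_finite[OF G(1)] by (auto simp: n_def atLeast0LessThan)
  have "\<forall>h\<in>G. \<exists>c. x * h = (\<Sum>k\<in>G. of_int (c k) * k)" using st by (auto simp: int_span_def)
  then obtain c where c: "\<And>h. h \<in> G \<Longrightarrow> x * h = (\<Sum>k\<in>G. of_int (c h k) * k)" by metis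
  define M where "M = mat n n (\<lambda>(i,j). c (g i) (g j))"
  have M: "map_mat complex_of_int M \<in> carrier_mat n n" by (simp add: M_def)
  obtain i0 where i0: "i0 < n" "g i0 = g0" using g G(2) by (auto simp: bij_betw_def)
  have "poly (char_poly (map_mat complex_of_int M)) x = 0"
  proof (rule char_poly_root_if_eigenvector[OF M i0(1), of g])
    fix i assume i: "i < n"
    then have gi: "g i \<in> G" using g by (auto simp: bij_betw_def)
    have "(\<Sum>j<n. map_mat complex_of_int M $$ (i,j) * g j) = (\<Sum>j<n. of_int (c (g i) (g j)) * g j)"
      using i by (simp add: M_def)
    also have "\<dots> = (\<Sum>k\<in>G. of_int (c (g i) k) * k)"
      using sum.reindex_bij_betw[OF g, of "\<lambda>k. of_int (c (g i) k) * k"] .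
    finally show "(\<Sum>j<n. map_mat complex_of_int M $$ (i,j) * g j) = x * g i" using c[OF gi] by simp
  qed (use i0 G(3) in simp)
  moreover have M': "M \<in> carrier_mat n n" by (simp add: M_def)
  ultimately have "poly (of_int_poly (char_poly M)) x = 0" by (simp add: of_int_hom.char_poly_hom[OF M'])
  moreover have "lead_coeff (char_poly M) = 1" using degree_monic_char_poly[OF M'] by simp
  ultimately show ?thesis unfolding algebraic_int_altdef_ipoly by blast
qed

lemma monic_root_power:
  fixes x :: complex
  assumes "poly (of_int_poly p) x = 0" "lead_coeff (p :: int poly) = 1"
  shows "degree p > 0" "x ^ degree p = (\<Sum>k<degree p. of_int (- coeff p k) * x ^ k)"
proof -
  show "degree p > 0"
  proof (rule ccontr)
    assume "\<not> ?thesis"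
    then have "p = 1" using monic_degree_0[OF assms(2)] by simp
    then show False using assms(1) by simp
  qed
  have "0 = (\<Sum>k\<le>degree p. of_int (coeff p k) * x ^ k)"
    using assms(1) by (simp add: poly_altdef degree_map_poly coeff_map_poly)
  also have "\<dots> = x ^ degree p + (\<Sum>k<degree p. of_int (coeff p k) * x ^ k)"
    using assms(2) by (simp add: lessThan_Suc_atMost[symmetric])
  finally show "x ^ degree p = (\<Sum>k<degree p. of_int (- coeff p k) * x ^ k)"
    by (simp add: sum_negf eq_neg_iff_add_eq_0)
qed

lemma power_products_stable:
  fixes x y :: complex and p :: "int poly"
  assumes p: "poly (of_int_poly p) x = 0" "lead_coeff p = 1"
    and g: "g \<in> (\<lambda>(i,j). x ^ i * y ^ j) ` ({..<degree p} \<times> {..<m})" (is "_ \<in> ?G")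
  shows "x * g \<in> int_span ?G"
proof -
  have mem: "x ^ i * y ^ j \<in> int_span ?G" if "i < degree p" "j < m" for i j
    by (rule int_span_base) (use that in auto)
  from g obtain i j where ij: "i < degree p" "j < m" "g = x ^ i * y ^ j" by auto
  show ?thesis
  proof (cases "Suc i = degree p")
    case True
    have "x * g = x ^ degree p * y ^ j" by (simp add: ij True[symmetric])
    also have "\<dots> = (\<Sum>k<degree p. of_int (- coeff p k) * (x ^ k * y ^ j))"
      unfolding monic_root_power(2)[OF p] sum_distrib_right by (simp add: mult.assoc)
    also have "\<dots> \<in> int_span ?G" by (intro int_span_sum int_span_scale mem) (use ij in auto)
    finally show ?thesis .
  next
    case False
    then show ?thesis using mem[of "Suc i" j] ij by (simp add: mult.assoc)
  qed
qed

text \<open>The products x^i y^j with exponents below the degrees of two monic equations generate a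
  module stable under both numbers. Stability under x + y and x * y then gives closure of the
  algebraic integers.\<close>

lemma algebraic_int_common_module:
  assumes "algebraic_int (x::complex)" "algebraic_int y"
  obtains G where "finite G" "1 \<in> G" "\<And>g. g \<in> G \<Longrightarrow> x * g \<in> int_span G" "\<And>g. g \<in> G \<Longrightarrow> y * g \<in> int_span G"
proof -
  from assms obtain p q where p: "poly (of_int_poly p) x = 0" "lead_coeff p = 1"
    and q: "poly (of_int_poly q) y = 0" "lead_coeff q = 1"
    unfolding algebraic_int_altdef_ipoly by blast
  define G where "G = (\<lambda>(i,j). x ^ i * y ^ j) ` ({..<degree p} \<times> {..<degree q})"
  \<comment> \<open>The same set with the roles of \<open>x\<close> and \<open>y\<close> exchanged,
    so one stability lemma covers both.\<close>
  have G': "G = (\<lambda>(i,j). y ^ i * x ^ j) ` ({..<degree q} \<times> {..<degree p})"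
    unfolding G_def by (auto simp: mult.commute)
  have "1 \<in> G" unfolding G_def using monic_root_power(1)[OF p] monic_root_power(1)[OF q]
    by (intro image_eqI[of _ _ "(0,0)"]) auto
  moreover have "x * g \<in> int_span G" if "g \<in> G" for g
    using power_products_stable[OF p, of g y "degree q"] that by (simp add: G_def)
  moreover have "y * g \<in> int_span G" if "g \<in> G" for g
    using power_products_stable[OF q, of g x "degree p"] that by (simp add: G')
  ultimately show ?thesis using that[of G] by (simp add: G_def)
qed

lemma algebraic_int_add:
  assumes "algebraic_int (x::complex)" "algebraic_int y" shows "algebraic_int (x + y)"
proof -
  from algebraic_int_common_module[OF assms] obtain G where G: "finite G" "1 \<in> G"
    "\<And>g. g \<in> G \<Longrightarrow> x * g \<in> int_span G" "\<And>g. g \<in> G \<Longrightarrow> y * g \<in> int_span G" by metis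
  show ?thesis by (rule algebraic_int_if_stable[OF G(1,2)]) (auto simp: distrib_right intro: int_span_add G)
qed

lemma algebraic_int_mult:
  assumes "algebraic_int (x::complex)" "algebraic_int y" shows "algebraic_int (x * y)"
proof -
  from algebraic_int_common_module[OF assms] obtain G where G: "finite G" "1 \<in> G"
    "\<And>g. g \<in> G \<Longrightarrow> x * g \<in> int_span G" "\<And>g. g \<in> G \<Longrightarrow> y * g \<in> int_span G" by metis
  show ?thesis
    by (rule algebraic_int_if_stable[OF G(1,2)]) (auto simp: mult.assoc intro!: int_span_stable[OF G(3)] G(4))
qed

lemma algebraic_int_sum: "(\<And>i. i \<in> I \<Longrightarrow> algebraic_int (f i :: complex)) \<Longrightarrow> algebraic_int (sum f I)"
  by (induction I rule: infinite_finite_induct) (auto intro: algebraic_int_add)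

lemma algebraic_int_prod: "(\<And>i. i \<in> I \<Longrightarrow> algebraic_int (f i :: complex)) \<Longrightarrow> algebraic_int (prod f I)"
  by (induction I rule: infinite_finite_induct) (auto intro: algebraic_int_mult)

section \<open>Embeddings of a subfield of the complex numbers\<close>

text \<open>
  The polynomial \<open>r\<close> applied to the shift operator, evaluated at the head of the sequence. For the
  operator \<open>T \<phi> = \<phi> (x * _)\<close> and \<open>a k = \<phi> (x ^ k * y)\<close> this is \<open>r(T) \<phi>\<close> at \<open>y\<close>.
\<close>

definition seq_eval :: "complex poly \<Rightarrow> (nat \<Rightarrow> complex) \<Rightarrow> complex" where
  "seq_eval r a = (\<Sum>k\<le>degree r. coeff r k * a k)"

lemma seq_eval_altdef: "degree r < n \<Longrightarrow> seq_eval r a = (\<Sum>k<n. coeff r k * a k)"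
  unfolding seq_eval_def by (rule sum.mono_neutral_left) (auto simp: coeff_eq_0)

text \<open>A factor X - \<mu> of the polynomial becomes the operator "shift minus \<mu>" on the
  sequence. Inductions over roots use this to peel off one root at a time.\<close>

lemma seq_eval_mult_linear:
  "seq_eval ([:-\<mu>, 1:] * r) a = seq_eval r (\<lambda>k. a (Suc k) - \<mu> * a k)"
proof -
  define n where "n = degree r + 1"
  have eq: "[:-\<mu>, 1:] * r = pCons 0 r - smult \<mu> r" by simp
  have "degree ([:-\<mu>, 1:] * r) \<le> degree r + 1"
    using degree_mult_le[of "[:-\<mu>, 1:]" r] by simp
  then have "seq_eval ([:-\<mu>, 1:] * r) a = (\<Sum>k<Suc n. coeff ([:-\<mu>, 1:] * r) k * a k)"
    by (intro seq_eval_altdef) (simp add: n_def)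
  also have "\<dots> = (\<Sum>k<Suc n. coeff (pCons 0 r) k * a k) - \<mu> * (\<Sum>k<Suc n. coeff r k * a k)"
    unfolding eq by (simp add: algebra_simps sum_subtractf sum_distrib_left)
  also have "(\<Sum>k<Suc n. coeff (pCons 0 r) k * a k) = (\<Sum>k<n. coeff r k * a (Suc k))"
    by (simp add: sum.lessThan_Suc_shift del: sum.lessThan_Suc)
  also have "(\<Sum>k<Suc n. coeff r k * a k) = (\<Sum>k<n. coeff r k * a k)"
    by (simp add: n_def coeff_eq_0)
  finally have "seq_eval ([:-\<mu>, 1:] * r) a = (\<Sum>k<n. coeff r k * (a (Suc k) - \<mu> * a k))"
    by (simp add: algebra_simps sum_subtractf sum_distrib_left)
  also have "\<dots> = seq_eval r (\<lambda>k. a (Suc k) - \<mu> * a k)"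
    by (rule seq_eval_altdef[symmetric]) (simp add: n_def)
  finally show ?thesis .
qed

text \<open>Simple roots over the complex numbers are what make the multiplication operators
  diagonalisable. They come from minimality of the degree.\<close>

lemma minimal_rat_poly:
  fixes x :: complex
  assumes "poly (map_poly of_rat p0) x = 0" "p0 \<noteq> 0"
  obtains R :: "complex set" and p :: "rat poly" where "finite R" "map_poly of_rat p = (\<Prod>z\<in>R. [:-z, 1:])"
    "poly (map_poly of_rat p) x = 0"
proof -
  interpret of_rat_poly: map_poly_inj_idom_hom "of_rat :: rat \<Rightarrow> complex" ..
  define P where "P p \<longleftrightarrow> p \<noteq> 0 \<and> poly (map_poly complex_of_rat p) x = 0" for p :: "rat poly"
  define p1 where "p1 = arg_min degree P"
  have p1: "P p1" "\<And>q. P q \<Longrightarrow> degree p1 \<le> degree q"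
    using arg_min_nat_lemma[of P p0 degree] assms by (auto simp: p1_def P_def)
  define p where "p = smult (inverse (lead_coeff p1)) p1"
  have lc: "lead_coeff p1 \<noteq> 0" using p1 by (simp add: P_def)
  have p: "P p" "\<And>q. P q \<Longrightarrow> degree p \<le> degree q" "lead_coeff p = 1"
    using p1 lc by (auto simp: p_def P_def of_rat_hom.map_poly_hom_smult)
  define h where "h = map_poly complex_of_rat p"
  have h0: "h \<noteq> 0" using p by (simp add: h_def P_def)
  have "rsquarefree h"
    unfolding rsquarefree_roots
  proof (intro allI notI)
    fix z assume z: "poly h z = 0 \<and> poly (pderiv h) z = 0"
    define g where "g = gcd p (pderiv p)"
    \<comment> \<open>A double root makes g = gcd(p, p') nonconstant. Then \<open>x\<close> is a
      root of \<open>g\<close> or of p / g, and both have smaller degree than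
      \<open>p\<close>.\<close>
    obtain a b where ab: "g = a * p + b * pderiv p"
      using bezout_coefficients_fst_snd[of p "pderiv p"] by (metis g_def)
    have "pderiv h = map_poly complex_of_rat (pderiv p)" by (simp add: h_def of_rat_hom.map_poly_pderiv)
    with z have gz: "poly (map_poly complex_of_rat g) z = 0"
      unfolding ab by (simp add: of_rat_poly.hom_add of_rat_poly.hom_mult h_def)
    have g0: "g \<noteq> 0" using p(1) by (auto simp: g_def P_def)
    have dg: "degree g > 0"
    proof (rule ccontr)
      assume "\<not> ?thesis"
      then obtain c where "g = [:c:]" by (auto elim: degree_eq_zeroE)
      then show False using gz g0 by simp
    qed
    obtain k where k: "p = g * k" by (metis g_def gcd_dvd1 dvdE)
    have k0: "k \<noteq> 0" using k p(1) by (auto simp: P_def)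
    have "pderiv p \<noteq> 0" using dg k k0 g0 by (simp add: pderiv_eq_0_iff degree_mult_eq)
    then have "degree g \<le> degree (pderiv p)" by (simp add: g_def dvd_imp_degree_le)
    also have "\<dots> < degree p" using dg k k0 g0 by (simp add: degree_pderiv degree_mult_eq)
    finally have "\<not> P g" using p(2)[of g] by auto
    then have "poly (map_poly complex_of_rat k) x = 0"
      using p(1) g0 unfolding P_def k by (simp add: of_rat_poly.hom_mult)
    then have "P k" using k0 by (simp add: P_def)
    from p(2)[OF this] show False using dg k k0 g0 by (simp add: degree_mult_eq)
  qed
  then have "h = smult (lead_coeff h) (\<Prod>z | poly h z = 0. [:-z, 1:])"
    using complex_poly_decompose_rsquarefree[of h] by simp
  moreover have "lead_coeff h = 1" using p(3) by (simp add: h_def)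
  ultimately have "map_poly of_rat p = (\<Prod>z\<in>{z. poly h z = 0}. [:-z, 1:])" by (simp add: h_def)
  then show ?thesis using that[of "{z. poly h z = 0}" p] poly_roots_finite[OF h0] p(1) unfolding P_def by blast
qed

interpretation fvs: vector_space "\<lambda>(c::complex) (f::complex \<Rightarrow> complex) x. c * f x"
  by unfold_locales (auto simp: fun_eq_iff algebra_simps)

locale complex_number_field =
  fixes L :: "complex set" and e :: "nat \<Rightarrow> complex" and d :: nat
  assumes one_in: "1 \<in> L"
    and add_in: "x \<in> L \<Longrightarrow> y \<in> L \<Longrightarrow> x + y \<in> L"
    and mult_in: "x \<in> L \<Longrightarrow> y \<in> L \<Longrightarrow> x * y \<in> L"
    and minus_in: "x \<in> L \<Longrightarrow> - x \<in> L"
    and inverse_in: "x \<in> L \<Longrightarrow> inverse x \<in> L"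
    and e_in: "i < d \<Longrightarrow> e i \<in> L"
    and basis_span: "x \<in> L \<Longrightarrow> \<exists>q::nat \<Rightarrow> rat. x = (\<Sum>i<d. of_rat (q i) * e i)"
    and basis_indep: "(\<Sum>i<d. of_rat (q i) * e i) = 0 \<Longrightarrow> i < d \<Longrightarrow> q i = 0"
begin

lemma zero_in: "0 \<in> L"
  using add_in[OF one_in minus_in[OF one_in]] by simp

lemma sum_in: "(\<And>i. i \<in> I \<Longrightarrow> f i \<in> L) \<Longrightarrow> sum f I \<in> L"
  by (induction I rule: infinite_finite_induct) (auto intro: add_in zero_in)

lemma power_in: "x \<in> L \<Longrightarrow> x ^ n \<in> L"
  by (induction n) (auto intro: one_in mult_in)

lemma of_nat_in: "of_nat n \<in> L"
  by (induction n) (auto intro: zero_in one_in add_in)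

lemma of_int_in: "of_int n \<in> L"
  by (cases n) (auto simp del: of_nat_Suc intro: of_nat_in minus_in)

lemma of_rat_in: "of_rat q \<in> L"
proof (cases q)
  case (Fract a b)
  then have "of_rat q = of_int a * inverse (of_int b :: complex)" by (simp add: of_rat_rat field_simps)
  then show ?thesis by (simp add: mult_in inverse_in of_int_in)
qed

text \<open>
  Maps are extended by \<open>0\<close> outside \<open>L\<close>, so that equality of functions is equality on \<open>L\<close>. The
  operators \<open>\<phi> \<mapsto> \<phi> (x * _)\<close> commute and are diagonalisable, because minimal polynomials over the
  rationals have simple roots; a common eigenvector is a multiple of a homomorphism. Hence the
  homomorphisms form a basis of this space of dimension \<open>d\<close>.
\<close>

definition additive :: "(complex \<Rightarrow> complex) set" where
  "additive = {\<phi>. (\<forall>x\<in>L. \<forall>y\<in>L. \<phi> (x + y) = \<phi> x + \<phi> y) \<and> (\<forall>x. x \<notin> L \<longrightarrow> \<phi> x = 0)}"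

definition homs :: "(complex \<Rightarrow> complex) set" where
  "homs = {\<phi>\<in>additive. (\<forall>x\<in>L. \<forall>y\<in>L. \<phi> (x * y) = \<phi> x * \<phi> y) \<and> \<phi> 1 = 1}"

lemma additive_add: "\<phi> \<in> additive \<Longrightarrow> x \<in> L \<Longrightarrow> y \<in> L \<Longrightarrow> \<phi> (x + y) = \<phi> x + \<phi> y"
  by (simp add: additive_def)

lemma additive_outside: "\<phi> \<in> additive \<Longrightarrow> x \<notin> L \<Longrightarrow> \<phi> x = 0"
  by (simp add: additive_def)

lemma additive_zero: "\<phi> \<in> additive \<Longrightarrow> \<phi> 0 = 0"
  using additive_add[of \<phi> 0 0] zero_in by simp

lemma additive_minus: "\<phi> \<in> additive \<Longrightarrow> x \<in> L \<Longrightarrow> \<phi> (- x) = - \<phi> x"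
  using additive_add[of \<phi> x "- x"] minus_in additive_zero[of \<phi>] by (simp add: eq_neg_iff_add_eq_0 add.commute)

lemma additive_sum:
  "\<phi> \<in> additive \<Longrightarrow> (\<And>i. i \<in> I \<Longrightarrow> f i \<in> L) \<Longrightarrow> \<phi> (sum f I) = (\<Sum>i\<in>I. \<phi> (f i))"
proof (induction I rule: infinite_finite_induct)
  case (insert i I)
  then show ?case using additive_add[of \<phi> "f i" "sum f I"] sum_in[of I f] by simp
qed (auto simp: additive_zero)

lemma additive_scale_nat: "\<phi> \<in> additive \<Longrightarrow> x \<in> L \<Longrightarrow> \<phi> (of_nat n * x) = of_nat n * \<phi> x"
proof (induction n)
  case (Suc n)
  then show ?case using additive_add[of \<phi> x "of_nat n * x"] mult_in[OF of_nat_in[of n]]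
    by (simp add: distrib_right)
qed (auto simp: additive_zero)

lemma additive_scale_int: "\<phi> \<in> additive \<Longrightarrow> x \<in> L \<Longrightarrow> \<phi> (of_int n * x) = of_int n * \<phi> x"
proof (cases n)
  case (neg m)
  assume "\<phi> \<in> additive" "x \<in> L"
  then show ?thesis using additive_scale_nat[of \<phi> x "Suc m"] additive_minus[of \<phi> "of_nat (Suc m) * x"]
      mult_in[OF of_nat_in[of "Suc m"]] by (simp add: neg del: of_nat_Suc)
qed (auto simp: additive_scale_nat)

lemma additive_scale_rat: "\<phi> \<in> additive \<Longrightarrow> x \<in> L \<Longrightarrow> \<phi> (of_rat q * x) = of_rat q * \<phi> x"
proof (cases q)
  case (Fract a b)
  assume *: "\<phi> \<in> additive" "x \<in> L"
  have b: "(of_int b :: complex) \<noteq> 0" using Fract by simp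
  have q: "(of_rat q :: complex) = of_int a / of_int b" using Fract by (simp add: of_rat_rat)
  have "of_int b * \<phi> (of_rat q * x) = \<phi> (of_int b * (of_rat q * x))"
    using * by (simp add: additive_scale_int mult_in of_rat_in)
  also have "of_int b * (of_rat q * x) = of_int a * x" using b by (simp add: q)
  also have "\<phi> \<dots> = of_int a * \<phi> x" using * by (simp add: additive_scale_int)
  finally show ?thesis using b by (simp add: q field_simps)
qed

lemma additive_basis:
  "\<phi> \<in> additive \<Longrightarrow> \<phi> (\<Sum>i<d. of_rat (q i) * e i) = (\<Sum>i<d. of_rat (q i) * \<phi> (e i))"
  by (subst additive_sum) (auto simp: additive_scale_rat e_in mult_in of_rat_in intro!: sum.cong)

text \<open>The basis \<open>e\<close> is an eigenvector, with eigenvalue \<open>x\<close>, of the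
  rational matrix of multiplication by \<open>x\<close>.\<close>

lemma algebraic:
  assumes "x \<in> L" obtains p :: "rat poly" where "p \<noteq> 0" "poly (map_poly of_rat p) x = 0"
proof -
  have "\<forall>i\<in>{..<d}. \<exists>q::nat \<Rightarrow> rat. x * e i = (\<Sum>j<d. of_rat (q j) * e j)"
    using basis_span mult_in[OF assms e_in] by auto
  then obtain q :: "nat \<Rightarrow> nat \<Rightarrow> rat" where q: "\<And>i. i < d \<Longrightarrow> x * e i = (\<Sum>j<d. of_rat (q i j) * e j)"
    by (metis lessThan_iff)
  define M where "M = mat d d (\<lambda>(i,j). q i j)"
  have M: "M \<in> carrier_mat d d" by (simp add: M_def)
  have "\<exists>i<d. e i \<noteq> 0"
    using basis_span[OF one_in] by (metis (no_types, lifting) lessThan_iff mult_zero_right sum.neutral zero_neq_one)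
  then obtain i where i: "i < d" "e i \<noteq> 0" by blast
  have "poly (char_poly (map_mat of_rat M)) x = 0"
    by (rule char_poly_root_if_eigenvector[of _ d i e]) (use i q in \<open>auto simp: M_def\<close>)
  then have "poly (map_poly of_rat (char_poly M)) x = 0" by (simp add: of_rat_hom.char_poly_hom[OF M])
  moreover have "char_poly M \<noteq> 0" using degree_monic_char_poly[OF M] by auto
  ultimately show ?thesis using that by blast
qed

lemma subspace_additive: "fvs.subspace additive"
  unfolding fvs.subspace_def by (auto simp: additive_def algebra_simps)

text \<open>An operator annihilated by a polynomial with distinct roots splits an invariant subspace
  into eigenspaces. Induction on the roots: T - m sends \<open>\<phi>\<close> to a vector that is
  already decomposed.\<close>

lemma eigen_decomposition:
  assumes "finite R" and x: "x \<in> L"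
    and W: "fvs.subspace W" "W \<subseteq> additive"
    and WT: "\<And>\<phi>. \<phi> \<in> W \<Longrightarrow> (\<lambda>y. if y \<in> L then \<phi> (x * y) else 0) \<in> W"
    and "\<phi> \<in> W" "\<And>y. y \<in> L \<Longrightarrow> seq_eval (\<Prod>z\<in>R. [:-z, 1:]) (\<lambda>k. \<phi> (x ^ k * y)) = 0"
  shows "\<exists>F. (\<forall>z\<in>R. F z \<in> W \<and> (\<forall>y\<in>L. F z (x * y) = z * F z y)) \<and> \<phi> = (\<Sum>z\<in>R. F z)"
  using assms(1,6,7)
proof (induction R arbitrary: \<phi> rule: finite_induct)
  case empty
  have "\<phi> y = 0" for y
    using empty(2)[of y] empty(1) W(2) by (cases "y \<in> L") (auto simp: seq_eval_def additive_def)
  then show ?case by (auto simp: fun_eq_iff)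
next
  case (insert m R)
  define T where "T \<phi> = (\<lambda>y. if y \<in> L then \<phi> (x * y) else 0)" for \<phi> :: "complex \<Rightarrow> complex"
  define \<psi> where "\<psi> = T \<phi> - (\<lambda>y. m * \<phi> y)"
  have TW: "T \<phi> \<in> W" if "\<phi> \<in> W" for \<phi> unfolding T_def by (rule WT[OF that])
  have sc: "(\<lambda>y. c * \<phi> y) \<in> W" if "\<phi> \<in> W" for c \<phi> using fvs.subspace_scale[OF W(1) that] .
  have \<psi>: "\<psi> \<in> W" unfolding \<psi>_def by (intro fvs.subspace_diff[OF W(1)] TW sc insert.prems)
  have "seq_eval (\<Prod>z\<in>R. [:-z, 1:]) (\<lambda>k. \<psi> (x ^ k * y)) = 0" if y: "y \<in> L" for y
  proof -
    have "(\<lambda>k. \<psi> (x ^ k * y)) = (\<lambda>k. \<phi> (x ^ Suc k * y) - m * \<phi> (x ^ k * y))"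
      using x y by (simp add: \<psi>_def T_def fun_eq_iff mult_in power_in mult.assoc)
    moreover have "(\<Prod>z\<in>insert m R. [:-z, 1:]) = [:-m, 1:] * (\<Prod>z\<in>R. [:-z, 1:])"
      using insert.hyps by (rule prod.insert)
    ultimately show ?thesis using insert.prems(2)[OF y] by (simp only: seq_eval_mult_linear)
  qed
  from insert.IH[OF \<psi> this] obtain F where F: "\<And>z. z \<in> R \<Longrightarrow> F z \<in> W"
    "\<And>z y. z \<in> R \<Longrightarrow> y \<in> L \<Longrightarrow> F z (x * y) = z * F z y" "\<psi> = (\<Sum>z\<in>R. F z)" by blast
  \<comment> \<open>On the eigenspace of z the operator T - m is multiplication by z - m. Dividing
    by it gives a preimage of \<open>\<psi>\<close>, and what \<open>\<phi>\<close> has beyond that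
    preimage is an eigenvector for m.\<close>
  define G where "G z = (\<lambda>y. inverse (z - m) * F z y)" for z
  define \<phi>' where "\<phi>' = \<phi> - (\<Sum>z\<in>R. G z)"
  have sumapp: "sum f A y = (\<Sum>z\<in>A. f z y)" for f :: "complex \<Rightarrow> complex \<Rightarrow> complex" and A y
    by (induction A rule: infinite_finite_induct) auto
  have GW: "G z \<in> W" if "z \<in> R" for z unfolding G_def by (intro sc F that)
  have \<phi>'W: "\<phi>' \<in> W" unfolding \<phi>'_def
    by (intro fvs.subspace_diff[OF W(1)] fvs.subspace_sum[OF W(1)] insert.prems GW)
  have \<phi>'e: "\<phi>' (x * y) = m * \<phi>' y" if y: "y \<in> L" for y
  proof -
    have "\<phi> (x * y) = m * \<phi> y + (\<Sum>z\<in>R. F z y)"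
      using fun_cong[OF F(3), of y] y by (simp add: \<psi>_def T_def sumapp algebra_simps)
    moreover have "(\<Sum>z\<in>R. G z (x * y)) = (\<Sum>z\<in>R. F z y + m * G z y)"
    proof (rule sum.cong[OF refl])
      fix z assume z: "z \<in> R"
      then have "z \<noteq> m" using insert.hyps by auto
      then show "G z (x * y) = F z y + m * G z y"
        using F(2)[OF z y] by (simp add: G_def field_simps)
    qed
    ultimately show ?thesis by (simp add: \<phi>'_def sumapp sum.distrib sum_distrib_left algebra_simps)
  qed
  define H where "H z = (if z = m then \<phi>' else G z)" for z
  have "sum H R = sum G R" using insert.hyps by (intro sum.cong) (auto simp: H_def)
  then have "\<phi> = sum H (insert m R)" using insert.hyps by (simp add: H_def \<phi>'_def)
  moreover have "H z \<in> W \<and> (\<forall>y\<in>L. H z (x * y) = z * H z y)" if "z \<in> insert m R" for z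
    using that \<phi>'W \<phi>'e GW F(2) by (auto simp: H_def G_def)
  ultimately show ?case by blast
qed

definition eigs :: "complex list \<Rightarrow> (complex \<Rightarrow> complex) set" where
  "eigs xs = {\<psi>\<in>additive. \<forall>x\<in>set xs. \<exists>m. \<forall>y\<in>L. \<psi> (x * y) = m * \<psi> y}"

text \<open>Simultaneous diagonalisation: multiplication by a further \<open>x\<close> commutes with
  the earlier operators and hence preserves each of their joint eigenspaces, where it can be
  diagonalised in turn.\<close>

lemma additive_span_eigs: "set xs \<subseteq> L \<Longrightarrow> additive \<subseteq> fvs.span (eigs xs)"
proof (induction xs)
  case Nil
  then show ?case by (auto simp: eigs_def intro: fvs.span_base)
next
  case (Cons x xs)
  have "eigs xs \<subseteq> fvs.span (eigs (x # xs))"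
  proof
    fix \<psi> assume \<psi>: "\<psi> \<in> eigs xs"
    then have "\<forall>x\<in>set xs. \<exists>m. \<forall>y\<in>L. \<psi> (x * y) = m * \<psi> y" by (simp add: eigs_def)
    then obtain m where m: "\<And>x y. x \<in> set xs \<Longrightarrow> y \<in> L \<Longrightarrow> \<psi> (x * y) = m x * \<psi> y" by metis
    \<comment> \<open>The eigenvalues are frozen to those of \<open>\<psi>\<close>:
      \<open>eigs xs\<close> itself is not closed under addition, while this joint eigenspace is a
      subspace.\<close>
    define W where "W = {\<psi>\<in>additive. \<forall>x\<in>set xs. \<forall>y\<in>L. \<psi> (x * y) = m x * \<psi> y}"
    have x: "x \<in> L" and xs: "set xs \<subseteq> L" using Cons.prems by auto
    obtain p0 where "p0 \<noteq> 0" "poly (map_poly of_rat p0) x = 0" using algebraic[OF x] .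
    then obtain R :: "complex set" and p where R: "finite R" "map_poly of_rat p = (\<Prod>z\<in>R. [:-z, 1:])"
      "poly (map_poly of_rat p) x = 0"
      using minimal_rat_poly[of p0 x] by blast
    have subW: "fvs.subspace W"
      proof (rule fvs.subspaceI)
        show "0 \<in> W" using fvs.subspace_0[OF subspace_additive] by (simp add: W_def)
        show "f + g \<in> W" if "f \<in> W" "g \<in> W" for f g
          using that fvs.subspace_add[OF subspace_additive, of f g] unfolding W_def by (simp add: distrib_left)
        show "(\<lambda>y. c * f y) \<in> W" if "f \<in> W" for c f
          using that fvs.subspace_scale[OF subspace_additive, of f c] unfolding W_def by (simp add: mult.left_commute)
      qed
    have "\<exists>F. (\<forall>z\<in>R. F z \<in> W \<and> (\<forall>y\<in>L. F z (x * y) = z * F z y)) \<and> \<psi> = (\<Sum>z\<in>R. F z)"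
    proof (rule eigen_decomposition[OF R(1) x subW])
      show "W \<subseteq> additive" by (auto simp: W_def)
      show "(\<lambda>y. if y \<in> L then \<phi> (x * y) else 0) \<in> W" if "\<phi> \<in> W" for \<phi>
      proof -
        have \<phi>: "\<phi> \<in> additive" "\<And>x y. x \<in> set xs \<Longrightarrow> y \<in> L \<Longrightarrow> \<phi> (x * y) = m x * \<phi> y" using that by (auto simp: W_def)
        have "\<phi> (x * (x' * y)) = m x' * \<phi> (x * y)" if "x' \<in> set xs" "y \<in> L" for x' y
          using \<phi>(2)[of x' "x * y"] x that by (simp add: mult_in mult.left_commute)
        then show ?thesis using \<phi>(1) x xs unfolding W_def
          by (auto simp: additive_def distrib_left mult_in add_in)
      qed
      show "\<psi> \<in> W" using \<psi> m by (simp add: W_def eigs_def)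
      show "seq_eval (\<Prod>z\<in>R. [:-z, 1:]) (\<lambda>k. \<psi> (x ^ k * y)) = 0" if y: "y \<in> L" for y
      proof -
        have \<psi>': "\<psi> \<in> additive" using \<psi> by (simp add: eigs_def)
        have "seq_eval (\<Prod>z\<in>R. [:-z, 1:]) (\<lambda>k. \<psi> (x ^ k * y)) = (\<Sum>k\<le>degree p. of_rat (coeff p k) * \<psi> (x ^ k * y))"
          unfolding R(2)[symmetric] by (simp add: seq_eval_def)
        also have "\<dots> = \<psi> (\<Sum>k\<le>degree p. of_rat (coeff p k) * (x ^ k * y))"
          using x y \<psi>' by (subst additive_sum) (auto simp: additive_scale_rat mult_in power_in of_rat_in)
        also have "(\<Sum>k\<le>degree p. of_rat (coeff p k) * (x ^ k * y)) = poly (map_poly of_rat p) x * y"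
          by (simp add: poly_altdef sum_distrib_right mult.assoc)
        finally show ?thesis using R(3) \<psi>' by (simp add: additive_zero)
      qed
    qed
    then obtain F where F: "\<And>z. z \<in> R \<Longrightarrow> F z \<in> W" "\<And>z y. z \<in> R \<Longrightarrow> y \<in> L \<Longrightarrow> F z (x * y) = z * F z y" "\<psi> = (\<Sum>z\<in>R. F z)"
      by blast
    have "F z \<in> eigs (x # xs)" if "z \<in> R" for z
      using F(1)[OF that] F(2)[OF that] by (auto simp: eigs_def W_def)
    then show "\<psi> \<in> fvs.span (eigs (x # xs))"
      unfolding F(3) by (intro fvs.span_sum fvs.span_base)
  qed
  then have "fvs.span (eigs xs) \<subseteq> fvs.span (eigs (x # xs))"
    by (intro fvs.span_minimal fvs.subspace_span)
  then show ?case using Cons by auto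
qed

text \<open>By rational linearity, an eigenvector for multiplication by the basis elements is one
  for multiplication by all of \<open>L\<close>. Its eigenvalue c at x satisfies \<psi> x = c *
  \<psi> 1, so \<psi> 1 = 0 forces \<psi> = 0, and otherwise \<psi> / \<psi> 1 is
  multiplicative.\<close>

lemma additive_span_homs: "additive \<subseteq> fvs.span homs"
proof -
  define xs where "xs = map e [0..<d]"
  have xs: "set xs \<subseteq> L" using e_in by (auto simp: xs_def)
  have "eigs xs \<subseteq> fvs.span homs"
  proof
    fix \<psi> assume \<psi>: "\<psi> \<in> eigs xs"
    then have add: "\<psi> \<in> additive" by (simp add: eigs_def)
    have "\<forall>i\<in>{..<d}. \<exists>m. \<forall>y\<in>L. \<psi> (e i * y) = m * \<psi> y" using \<psi> by (auto simp: eigs_def xs_def)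
    then obtain m where m: "\<And>i y. i < d \<Longrightarrow> y \<in> L \<Longrightarrow> \<psi> (e i * y) = m i * \<psi> y"
      by (metis lessThan_iff)
    have ex: "\<exists>c. \<forall>y\<in>L. \<psi> (x * y) = c * \<psi> y" if x: "x \<in> L" for x
    proof -
      obtain q :: "nat \<Rightarrow> rat" where q: "x = (\<Sum>i<d. of_rat (q i) * e i)" using basis_span[OF x] by blast
      have "\<psi> (x * y) = (\<Sum>i<d. of_rat (q i) * m i) * \<psi> y" if y: "y \<in> L" for y
      proof -
        have "\<psi> (x * y) = \<psi> (\<Sum>i<d. of_rat (q i) * (e i * y))" by (simp add: q sum_distrib_right mult.assoc)
        also have "\<dots> = (\<Sum>i<d. of_rat (q i) * \<psi> (e i * y))"
          using add y by (subst additive_sum) (auto simp: additive_scale_rat mult_in e_in of_rat_in)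
        finally show ?thesis using m y by (simp add: sum_distrib_right mult.assoc)
      qed
      then show ?thesis by blast
    qed
    have prod: "\<psi> (x * y) * \<psi> 1 = \<psi> x * \<psi> y" if x: "x \<in> L" and y: "y \<in> L" for x y
    proof -
      obtain c where c: "\<And>y. y \<in> L \<Longrightarrow> \<psi> (x * y) = c * \<psi> y" using ex[OF x] by blast
      show ?thesis using c[OF y] c[OF one_in] by simp
    qed
    show "\<psi> \<in> fvs.span homs"
    proof (cases "\<psi> 1 = 0")
      case True
      have "\<psi> y = 0" for y
      proof (cases "y \<in> L")
        case y: True
        obtain c where "\<And>z. z \<in> L \<Longrightarrow> \<psi> (y * z) = c * \<psi> z" using ex[OF y] by blast
        from this[OF one_in] True show ?thesis by simp
      qed (simp add: additive_outside[OF add])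
      then have "\<psi> = 0" by (simp add: fun_eq_iff)
      then show ?thesis by (simp add: fvs.span_zero)
    next
      case False
      define \<sigma> where "\<sigma> = (\<lambda>y. inverse (\<psi> 1) * \<psi> y)"
      have "\<sigma> \<in> additive" unfolding \<sigma>_def using fvs.subspace_scale[OF subspace_additive add] .
      moreover have "\<sigma> (x * y) = \<sigma> x * \<sigma> y" if "x \<in> L" "y \<in> L" for x y
        using prod[OF that] False by (simp add: \<sigma>_def field_simps)
      ultimately have "\<sigma> \<in> homs" using False by (auto simp: homs_def \<sigma>_def)
      then have "(\<lambda>y. \<psi> 1 * \<sigma> y) \<in> fvs.span homs" by (intro fvs.span_scale fvs.span_base)
      moreover have "(\<lambda>y. \<psi> 1 * \<sigma> y) = \<psi>" using False by (simp add: \<sigma>_def)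
      ultimately show ?thesis by simp
    qed
  qed
  then have "fvs.span (eigs xs) \<subseteq> fvs.span homs" by (intro fvs.span_minimal fvs.subspace_span)
  then show ?thesis using additive_span_eigs[OF xs] by auto
qed

lemma sum_fun_apply: "sum f A y = (\<Sum>z\<in>A. f z y)" for f :: "'c \<Rightarrow> complex \<Rightarrow> complex"
  by (induction A rule: infinite_finite_induct) auto

text \<open>Dedekind's independence of characters, by induction on the number of terms in a linear
  relation.\<close>

lemma independent_homs: "fvs.independent homs"
proof -
  have "\<forall>\<sigma>\<in>S. u \<sigma> = 0" if "finite S" "S \<subseteq> homs" "(\<Sum>\<sigma>\<in>S. (\<lambda>x. u \<sigma> * \<sigma> x)) = 0" for S u
    using that
  proof (induction S arbitrary: u rule: finite_induct)
    case (insert \<sigma> S)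
    have \<sigma>: "\<sigma> \<in> homs" using insert.prems by auto
    have rel: "u \<sigma> * \<sigma> x + (\<Sum>\<tau>\<in>S. u \<tau> * \<tau> x) = 0" for x
      using fun_cong[OF insert.prems(2), of x] insert.hyps by (simp add: sum_fun_apply)
    have zero: "u \<tau>0 = 0" if \<tau>0: "\<tau>0 \<in> S" for \<tau>0
    proof -
      have "\<tau>0 \<noteq> \<sigma>" using \<tau>0 insert.hyps by auto
      then obtain a where a: "\<tau>0 a \<noteq> \<sigma> a" by auto
      have aL: "a \<in> L"
      proof (rule ccontr)
        assume "a \<notin> L"
        moreover have "\<tau>0 \<in> additive" "\<sigma> \<in> additive" using \<sigma> insert.prems(1) \<tau>0 by (auto simp: homs_def)
        ultimately show False using a by (simp add: additive_outside)
      qed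
      \<comment> \<open>The relation at \<open>a * x\<close> minus \<open>\<sigma> a\<close> times
        the relation at \<open>x\<close> no longer contains \<open>\<sigma>\<close>, and the
        coefficient of \<open>\<tau>0\<close> is multiplied by something nonzero.\<close>
      have "(\<Sum>\<tau>\<in>S. (u \<tau> * (\<tau> a - \<sigma> a)) * \<tau> x) = 0" for x
      proof (cases "x \<in> L")
        case True
        have mul: "\<tau> (a * x) = \<tau> a * \<tau> x" if "\<tau> \<in> insert \<sigma> S" for \<tau>
          using insert.prems(1) that aL True by (auto simp: homs_def)
        have "(\<Sum>\<tau>\<in>S. (u \<tau> * (\<tau> a - \<sigma> a)) * \<tau> x) = (\<Sum>\<tau>\<in>S. u \<tau> * \<tau> (a * x)) - \<sigma> a * (\<Sum>\<tau>\<in>S. u \<tau> * \<tau> x)"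
          by (simp add: sum_distrib_left sum_subtractf[symmetric] mul algebra_simps)
        also have "\<dots> = - (u \<sigma> * \<sigma> (a * x)) - \<sigma> a * (- (u \<sigma> * \<sigma> x))"
          using rel[of "a * x"] rel[of x] by (simp add: add_eq_0_iff)
        also have "\<dots> = 0" by (simp add: mul)
        finally show ?thesis .
      next
        case False
        then have "\<tau> x = 0" if "\<tau> \<in> S" for \<tau> using insert.prems(1) that by (auto simp: homs_def additive_def)
        then show ?thesis by (intro sum.neutral) auto
      qed
      then have "(\<Sum>\<tau>\<in>S. (\<lambda>x. (u \<tau> * (\<tau> a - \<sigma> a)) * \<tau> x)) = 0"
        by (simp add: fun_eq_iff sum_fun_apply)
      from insert.IH[OF _ this] insert.prems(1) \<tau>0 have "u \<tau>0 * (\<tau>0 a - \<sigma> a) = 0" by blast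
      then show ?thesis using a by simp
    qed
    then have "u \<sigma> = 0" using rel[of 1] \<sigma> by (simp add: homs_def)
    then show ?case using zero by auto
  qed simp
  then show ?thesis unfolding fvs.independent_explicit_finite_subsets by blast
qed

definition coord :: "complex \<Rightarrow> nat \<Rightarrow> rat" where
  "coord x = (SOME q. x = (\<Sum>i<d. of_rat (q i) * e i))"

lemma coord: "x \<in> L \<Longrightarrow> x = (\<Sum>i<d. of_rat (coord x i) * e i)"
  unfolding coord_def using someI_ex[OF basis_span] .

lemma coord_unique:
  assumes "x \<in> L" "x = (\<Sum>i<d. of_rat (q i) * e i)" "i < d"
  shows "coord x i = q i"
proof -
  have "(\<Sum>i<d. of_rat (coord x i - q i) * e i) = 0"
    using coord[OF assms(1)] assms(2) by (simp add: of_rat_diff left_diff_distrib sum_subtractf)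
  from basis_indep[OF this assms(3)] show ?thesis by simp
qed

text \<open>The d coordinate functionals \<open>s j\<close> form a second basis of
  \<open>additive\<close>; the exchange bound, applied in both directions, equates the two
  cardinalities.\<close>

theorem card_homs: "finite homs" "card homs = d"
proof -
  define s where "s j = (\<lambda>x. if x \<in> L then complex_of_rat (coord x j) else 0)" for j
  have s: "s j \<in> additive" if j: "j < d" for j
  proof -
    have "coord (x + y) j = coord x j + coord y j" if "x \<in> L" "y \<in> L" for x y
      by (rule coord_unique[OF add_in[OF that] _ j])
        (use coord[OF that(1)] coord[OF that(2)] in \<open>simp add: of_rat_add distrib_right sum.distrib\<close>)
    then show ?thesis by (auto simp: additive_def s_def add_in of_rat_add)
  qed
  have se: "s j (e i) = (if i = j then 1 else 0)" if "i < d" "j < d" for i j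
  proof -
    have "coord (e i) j = (if j = i then 1 else 0)"
      by (rule coord_unique[OF e_in[OF that(1)] _ that(2)])
        (use that in \<open>simp add: if_distrib if_distribR sum.delta cong: if_cong\<close>)
    then show ?thesis using that by (simp add: s_def e_in)
  qed
  have inj: "inj_on s {..<d}"
  proof (rule inj_onI)
    fix i j assume "i \<in> {..<d}" "j \<in> {..<d}" "s i = s j"
    then show "i = j" using se[of i j] se[of i i] by (auto split: if_splits)
  qed
  have sp: "additive \<subseteq> fvs.span (s ` {..<d})"
  proof
    fix \<phi> assume \<phi>: "\<phi> \<in> additive"
    have eq: "\<phi> x = (\<Sum>j<d. \<phi> (e j) * s j x)" for x
    proof (cases "x \<in> L")
      case True
      have "\<phi> x = (\<Sum>j<d. of_rat (coord x j) * \<phi> (e j))"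
        using additive_basis[OF \<phi>, of "coord x"] coord[OF True] by simp
      then show ?thesis using True by (simp add: s_def mult.commute)
    qed (simp add: s_def additive_outside[OF \<phi>])
    have "\<phi> = (\<Sum>j<d. (\<lambda>x. \<phi> (e j) * s j x))" by (rule ext, subst sum_fun_apply, rule eq)
    also have "\<dots> \<in> fvs.span (s ` {..<d})" by (intro fvs.span_sum fvs.span_scale fvs.span_base) auto
    finally show "\<phi> \<in> fvs.span (s ` {..<d})" .
  qed
  have ind: "fvs.independent (s ` {..<d})"
  proof (rule fvs.independent_if_scalars_zero)
    fix u f assume z: "(\<Sum>f\<in>s ` {..<d}. (\<lambda>x. u f * f x)) = 0" and "f \<in> s ` {..<d}"
    then obtain i where i: "i < d" "f = s i" by auto
    have "0 = (\<Sum>f\<in>s ` {..<d}. u f * f (e i))" using fun_cong[OF z, of "e i"] by (simp add: sum_fun_apply)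
    also have "\<dots> = (\<Sum>j<d. u (s j) * s j (e i))" by (simp add: sum.reindex[OF inj])
    also have "\<dots> = (\<Sum>j<d. if j = i then u (s i) else 0)" using i by (intro sum.cong) (auto simp: se)
    also have "\<dots> = u f" using i by simp
    finally show "u f = 0" ..
  qed simp
  have "homs \<subseteq> fvs.span (s ` {..<d})" using sp by (auto simp: homs_def)
  then have 1: "finite homs \<and> card homs \<le> card (s ` {..<d})"
    by (intro fvs.independent_span_bound independent_homs) auto
  have "s ` {..<d} \<subseteq> fvs.span homs" using s additive_span_homs by auto
  then have "finite (s ` {..<d}) \<and> card (s ` {..<d}) \<le> card homs"
    using 1 by (intro fvs.independent_span_bound ind) auto
  then show "finite homs" "card homs = d" using 1 by (auto simp: card_image[OF inj])
qed

end

section \<open>Integral bases\<close>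

text \<open>If p has degree n and leading coefficient a, then a^(n-1) * p(x) is a monic integer
  polynomial in a * x; this is the polynomial \<open>q\<close>.\<close>

lemma algebraic_int_multiple:
  assumes "algebraic (x :: complex)"
  obtains N :: int where "N \<noteq> 0" "algebraic_int (of_int N * x)"
proof -
  from assms obtain p where p: "\<forall>i. coeff p i \<in> \<int>" "p \<noteq> 0" "poly p x = 0" unfolding algebraic_def by blast
  have "\<forall>i. \<exists>k::int. coeff p i = of_int k" using p(1) by (metis Ints_cases)
  then obtain c :: "nat \<Rightarrow> int" where c: "\<And>i. coeff p i = of_int (c i)" by metis
  define n where "n = degree p"
  define a where "a = c n"
  have a0: "a \<noteq> 0" using p(2) c[of n] by (auto simp: a_def n_def)
  have n0: "n > 0"
  proof (rule ccontr)
    assume "\<not> n > 0"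
    then obtain b where "p = [:b:]" by (auto simp: n_def elim: degree_eq_zeroE)
    then show False using p(2,3) by simp
  qed
  define q :: "int poly" where "q = (\<Sum>k<n. monom (c k * a ^ (n - 1 - k)) k) + monom 1 n"
  have cq: "coeff q k = (if k < n then c k * a ^ (n - 1 - k) else if k = n then 1 else 0)" for k
    by (auto simp: q_def coeff_sum coeff_monom)
  have dq: "degree q = n"
    by (rule antisym[OF degree_le le_degree]) (auto simp: cq)
  have "(\<Sum>k\<le>n. of_int (c k) * x ^ k) = 0" using p(3) by (simp add: poly_altdef c n_def)
  then have rel: "(\<Sum>k<n. of_int (c k) * x ^ k) + of_int a * x ^ n = 0"
    by (simp add: lessThan_Suc_atMost[symmetric] a_def)
  have "poly (of_int_poly q) (of_int a * x) = (\<Sum>k\<le>n. of_int (coeff q k) * (of_int a * x) ^ k)"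
    by (simp add: poly_altdef dq)
  also have "\<dots> = (\<Sum>k<n. of_int (c k * a ^ (n - 1 - k)) * (of_int a * x) ^ k) + (of_int a * x) ^ n"
    by (simp add: lessThan_Suc_atMost[symmetric] cq)
  also have "(\<Sum>k<n. of_int (c k * a ^ (n - 1 - k)) * (of_int a * x) ^ k)
     = (\<Sum>k<n. of_int a ^ (n - 1) * (of_int (c k) * x ^ k))"
  proof (rule sum.cong[OF refl])
    fix k assume "k \<in> {..<n}"
    then have "n - 1 = (n - 1 - k) + k" by simp
    then have "(of_int a :: complex) ^ (n - 1) = of_int a ^ (n - 1 - k) * of_int a ^ k" by (metis power_add)
    then show "of_int (c k * a ^ (n - 1 - k)) * (of_int a * x) ^ k = of_int a ^ (n - 1) * (of_int (c k) * x ^ k)"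
      by (simp add: power_mult_distrib mult_ac)
  qed
  also have "(of_int a * x) ^ n = of_int a ^ (n - 1) * (of_int a * x ^ n)"
    using n0 by (cases n) (auto simp: power_mult_distrib mult_ac)
  also have "(\<Sum>k<n. of_int a ^ (n - 1) * (of_int (c k) * x ^ k)) + of_int a ^ (n - 1) * (of_int a * x ^ n)
     = of_int a ^ (n - 1) * ((\<Sum>k<n. of_int (c k) * x ^ k) + of_int a * x ^ n)"
    by (simp add: sum_distrib_left distrib_left)
  also have "\<dots> = 0" by (simp add: rel)
  finally have "algebraic_int (of_int a * x)" unfolding algebraic_int_altdef_ipoly
    using dq cq[of n] by (intro exI[of _ q]) simp
  then show ?thesis using that a0 by blast
qed

lemma det_in_Rats:
  fixes A :: "complex mat"
  assumes A: "A \<in> carrier_mat n n" "\<And>i j. i < n \<Longrightarrow> j < n \<Longrightarrow> A $$ (i,j) \<in> \<rat>"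
  shows "det A \<in> \<rat>"
proof -
  have "\<forall>i j. \<exists>q. i < n \<longrightarrow> j < n \<longrightarrow> A $$ (i,j) = of_rat q" using A(2) by (metis Rats_cases)
  then obtain q where q: "\<And>i j. i < n \<Longrightarrow> j < n \<Longrightarrow> A $$ (i,j) = of_rat (q i j)" by metis
  have "A = map_mat of_rat (mat n n (\<lambda>(i,j). q i j))"
    using A(1) q by (intro eq_matI) auto
  then have "det A = of_rat (det (mat n n (\<lambda>(i,j). q i j)))"
    by (simp add: of_rat_hom.hom_det)
  then show ?thesis by simp
qed

lemma algebraic_int_det:
  fixes A :: "complex mat"
  assumes A: "A \<in> carrier_mat n n" "\<And>i j. i < n \<Longrightarrow> j < n \<Longrightarrow> algebraic_int (A $$ (i,j))"
  shows "algebraic_int (det A)"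
  unfolding det_def'[OF A(1)]
proof (intro algebraic_int_sum algebraic_int_mult algebraic_int_prod A(2))
  fix p i assume "p \<in> {p. p permutes {0..<n}}" "i \<in> {0..<n}"
  then show "p i < n" "i < n" using permutes_in_image[of p "{0..<n}" i] by auto
qed (auto simp: sign_def)

context complex_number_field
begin

lemma d_pos: "d > 0"
proof (rule ccontr)
  assume "\<not> ?thesis"
  then show False using basis_span[OF one_in] by simp
qed

lemma hom_additive: "\<tau> \<in> homs \<Longrightarrow> \<tau> \<in> additive"
  by (simp add: homs_def)

lemma hom_mult: "\<tau> \<in> homs \<Longrightarrow> x \<in> L \<Longrightarrow> y \<in> L \<Longrightarrow> \<tau> (x * y) = \<tau> x * \<tau> y"
  by (simp add: homs_def)

lemma hom_one: "\<tau> \<in> homs \<Longrightarrow> \<tau> 1 = 1"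
  by (simp add: homs_def)

lemma hom_power: "\<tau> \<in> homs \<Longrightarrow> x \<in> L \<Longrightarrow> \<tau> (x ^ n) = \<tau> x ^ n"
  by (induction n) (auto simp: hom_one hom_mult power_in)

lemma hom_rat: "\<tau> \<in> homs \<Longrightarrow> \<tau> (of_rat q) = of_rat q"
  using additive_scale_rat[OF hom_additive one_in, of \<tau> q] by (simp add: hom_one)

lemma hom_int: "\<tau> \<in> homs \<Longrightarrow> \<tau> (of_int k) = of_int k"
  using additive_scale_int[OF hom_additive one_in, of \<tau> k] by (simp add: hom_one)

lemma hom_rat_comb:
  assumes \<tau>: "\<tau> \<in> homs" and w: "\<And>j. j < d \<Longrightarrow> w j \<in> L"
  shows "\<tau> (\<Sum>j<d. of_rat (q j) * w j) = (\<Sum>j<d. of_rat (q j) * \<tau> (w j))"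
  by (subst additive_sum[OF hom_additive[OF \<tau>]])
    (auto simp: additive_scale_rat[OF hom_additive[OF \<tau>]] mult_in of_rat_in w)

lemma hom_int_comb:
  assumes \<tau>: "\<tau> \<in> homs" and w: "\<And>j. j < d \<Longrightarrow> w j \<in> L"
  shows "\<tau> (\<Sum>j<d. of_int (c j) * w j) = (\<Sum>j<d. of_int (c j) * \<tau> (w j))"
  using hom_rat_comb[OF assms, where q = "\<lambda>j. of_int (c j)"] by simp

lemma hom_nonzero: "\<tau> \<in> homs \<Longrightarrow> x \<in> L \<Longrightarrow> x \<noteq> 0 \<Longrightarrow> \<tau> x \<noteq> 0"
  using hom_mult[of \<tau> x "inverse x"] inverse_in[of x] hom_one[of \<tau>] by auto

lemma hom_inj: "\<tau> \<in> homs \<Longrightarrow> x \<in> L \<Longrightarrow> y \<in> L \<Longrightarrow> \<tau> x = \<tau> y \<Longrightarrow> x = y"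
  using hom_nonzero[of \<tau> "x + (- y)"] additive_add[of \<tau> x "- y"] additive_minus[of \<tau> y]
    add_in[of x "- y"] minus_in[of y]
  by (auto simp: hom_additive)

lemma hom_poly_rat:
  assumes "\<tau> \<in> homs" "x \<in> L"
  shows "poly (map_poly of_rat p) x \<in> L" "\<tau> (poly (map_poly of_rat p) x) = poly (map_poly of_rat p) (\<tau> x)"
proof -
  show "poly (map_poly of_rat p) x \<in> L"
    unfolding poly_altdef using assms by (intro sum_in) (simp add: mult_in of_rat_in power_in)
  have "\<tau> (poly (map_poly of_rat p) x) = (\<Sum>i\<le>degree p. \<tau> (of_rat (coeff p i) * x ^ i))"
    unfolding poly_altdef using assms
    by (subst additive_sum) (auto simp: hom_additive mult_in of_rat_in power_in)
  also have "\<dots> = poly (map_poly of_rat p) (\<tau> x)"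
    using assms by (simp add: poly_altdef hom_mult hom_rat hom_power of_rat_in power_in)
  finally show "\<tau> (poly (map_poly of_rat p) x) = poly (map_poly of_rat p) (\<tau> x)" .
qed

lemma hom_poly_int:
  assumes "\<tau> \<in> homs" "x \<in> L"
  shows "\<tau> (poly (of_int_poly p) x) = poly (of_int_poly p) (\<tau> x)"
proof -
  have "map_poly (of_rat :: rat \<Rightarrow> complex) (of_int_poly p) = of_int_poly p"
    by (simp add: map_poly_map_poly o_def)
  then show ?thesis using hom_poly_rat(2)[OF assms, of "of_int_poly p"] by simp
qed

lemma hom_algebraic_int:
  assumes "\<tau> \<in> homs" "x \<in> L" "algebraic_int x"
  shows "algebraic_int (\<tau> x)"
proof -
  obtain p where "poly (of_int_poly p) x = 0" "lead_coeff p = 1"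
    using assms(3) unfolding algebraic_int_altdef_ipoly by blast
  then show ?thesis unfolding algebraic_int_altdef_ipoly
    using hom_poly_int[OF assms(1,2), of p] additive_zero[OF hom_additive[OF assms(1)]] by auto
qed

definition OL :: "complex set" where "OL = {x\<in>L. algebraic_int x}"

lemma OL_add: "x \<in> OL \<Longrightarrow> y \<in> OL \<Longrightarrow> x + y \<in> OL" by (simp add: OL_def add_in algebraic_int_add)
lemma OL_mult: "x \<in> OL \<Longrightarrow> y \<in> OL \<Longrightarrow> x * y \<in> OL" by (simp add: OL_def mult_in algebraic_int_mult)
lemma OL_int: "of_int k \<in> OL" by (simp add: OL_def of_int_in)
lemma OL_sum: "(\<And>i. i \<in> I \<Longrightarrow> f i \<in> OL) \<Longrightarrow> sum f I \<in> OL"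
  by (auto simp: OL_def intro: sum_in algebraic_int_sum)
lemma OL_in: "x \<in> OL \<Longrightarrow> x \<in> L" by (simp add: OL_def)

section \<open>The embedding matrix and the trace form\<close>

definition trace :: "complex \<Rightarrow> complex" where "trace x = (\<Sum>\<tau>\<in>homs. \<tau> x)"

text \<open>Gram matrix of the trace form. No enumeration of \<open>homs\<close> enters, so
  determinants expressed through it are independent of the order of the embeddings.\<close>

definition trace_mat :: "(nat \<Rightarrow> complex) \<Rightarrow> (nat \<Rightarrow> complex) \<Rightarrow> complex mat" where
  "trace_mat w w' = mat d d (\<lambda>(j,k). trace (w j * w' k))"

end

locale enumerated_number_field = complex_number_field +
  fixes \<sigma> :: "nat \<Rightarrow> complex \<Rightarrow> complex"
  assumes \<sigma>: "bij_betw \<sigma> {..<d} homs"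
begin

lemma \<sigma>_hom: "i < d \<Longrightarrow> \<sigma> i \<in> homs"
  using \<sigma> by (auto simp: bij_betw_def)

definition emb :: "(nat \<Rightarrow> complex) \<Rightarrow> complex mat" where
  "emb w = mat d d (\<lambda>(i,j). \<sigma> i (w j))"

lemma emb_carrier [simp]: "emb w \<in> carrier_mat d d" by (simp add: emb_def)

lemma emb_index: "i < d \<Longrightarrow> j < d \<Longrightarrow> emb w $$ (i,j) = \<sigma> i (w j)" by (simp add: emb_def)

lemma trace_enum: "trace x = (\<Sum>i<d. \<sigma> i x)"
  unfolding trace_def using sum.reindex_bij_betw[OF \<sigma>, of "\<lambda>\<tau>. \<tau> x"] by simp

lemma emb_mult_transpose:
  assumes "\<And>j. j < d \<Longrightarrow> w j \<in> L" "\<And>j. j < d \<Longrightarrow> w' j \<in> L"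
  shows "transpose_mat (emb w) * emb w' = trace_mat w w'"
proof (rule eq_matI)
  fix j k assume "j < dim_row (trace_mat w w')" "k < dim_col (trace_mat w w')"
  then have jk: "j < d" "k < d" by (auto simp: trace_mat_def)
  have "(transpose_mat (emb w) * emb w') $$ (j,k) = (\<Sum>i<d. transpose_mat (emb w) $$ (j,i) * emb w' $$ (i,k))"
    by (rule index_mult_mat_sum[of _ d d _ d]) (use jk in auto)
  also have "\<dots> = (\<Sum>i<d. \<sigma> i (w j) * \<sigma> i (w' k))"
    using jk by (intro sum.cong) (auto simp: emb_def)
  also have "\<dots> = trace (w j * w' k)"
    unfolding trace_enum using jk assms by (intro sum.cong) (auto simp: hom_mult \<sigma>_hom)
  finally show "(transpose_mat (emb w) * emb w') $$ (j,k) = trace_mat w w' $$ (j,k)"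
    using jk by (simp add: trace_mat_def)
qed (auto simp: trace_mat_def emb_def)

lemma det_emb_mult:
  assumes "\<And>j. j < d \<Longrightarrow> w j \<in> L" "\<And>j. j < d \<Longrightarrow> w' j \<in> L"
  shows "det (emb w) * det (emb w') = det (trace_mat w w')"
proof -
  have "det (transpose_mat (emb w) * emb w') = det (transpose_mat (emb w)) * det (emb w')"
    by (rule det_mult[of _ d]) auto
  then show ?thesis using emb_mult_transpose[OF assms] by (simp add: det_transpose[OF emb_carrier])
qed

text \<open>A kernel vector of the transpose is a linear relation between the embeddings that holds
  on the basis, hence on all of \<open>L\<close>, against their independence.\<close>

lemma det_emb_basis: "det (emb e) \<noteq> 0"
proof
  assume "det (emb e) = 0"
  then have "det (transpose_mat (emb e)) = 0" by (simp add: det_transpose[OF emb_carrier])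
  then obtain v where v: "v \<in> carrier_vec d" "v \<noteq> 0\<^sub>v d" "transpose_mat (emb e) *\<^sub>v v = 0\<^sub>v d"
    using det_0_iff_vec_prod_zero[of "transpose_mat (emb e)" d] by auto
  have rel: "(\<Sum>i<d. v $ i * \<sigma> i (e j)) = 0" if j: "j < d" for j
  proof -
    have "0 = (transpose_mat (emb e) *\<^sub>v v) $ j" using v(3) j by simp
    also have "\<dots> = (\<Sum>i<d. v $ i * \<sigma> i (e j))"
      using j v(1) by (auto simp: scalar_prod_def emb_def atLeast0LessThan mult.commute intro!: sum.cong)
    finally show ?thesis ..
  qed
  define \<phi> where "\<phi> = (\<Sum>i<d. (\<lambda>x. v $ i * \<sigma> i x))"
  have \<phi>: "\<phi> \<in> additive" unfolding \<phi>_def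
    by (intro fvs.subspace_sum[OF subspace_additive] fvs.subspace_scale[OF subspace_additive]) (auto simp: hom_additive \<sigma>_hom)
  have "\<phi> x = 0" for x
  proof (cases "x \<in> L")
    case True
    have "\<phi> x = (\<Sum>j<d. of_rat (coord x j) * \<phi> (e j))"
      using additive_basis[OF \<phi>, of "coord x"] coord[OF True] by simp
    also have "\<dots> = 0" using rel by (simp add: \<phi>_def sum_fun_apply)
    finally show ?thesis .
  qed (simp add: additive_outside[OF \<phi>])
  then have \<phi>0: "\<phi> = 0" by (simp add: fun_eq_iff)
  define u where "u \<tau> = v $ (the_inv_into {..<d} \<sigma> \<tau>)" for \<tau>
  have inj: "inj_on \<sigma> {..<d}" using \<sigma> by (simp add: bij_betw_def)
  have u: "u (\<sigma> i) = v $ i" if "i < d" for i using that by (simp add: u_def the_inv_into_f_f[OF inj])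
  have "(\<Sum>\<tau>\<in>homs. (\<lambda>x. u \<tau> * \<tau> x)) = (\<Sum>i<d. (\<lambda>x. u (\<sigma> i) * \<sigma> i x))"
    using sum.reindex_bij_betw[OF \<sigma>, of "\<lambda>\<tau>. (\<lambda>x. u \<tau> * \<tau> x)"] by simp
  also have "\<dots> = \<phi>" unfolding \<phi>_def by (intro sum.cong) (auto simp: u)
  finally have "(\<Sum>\<tau>\<in>homs. (\<lambda>x. u \<tau> * \<tau> x)) = 0" using \<phi>0 by simp
  then have "u (\<sigma> i) = 0" if "i < d" for i
    using fvs.independentD[OF independent_homs card_homs(1) subset_refl] \<sigma>_hom[OF that] by blast
  then have "v = 0\<^sub>v d" using v(1) by (intro eq_vecI) (auto simp: u)
  then show False using v(2) by simp
qed

text \<open>With S = \<open>emb e\<close> and M the rational matrix of multiplication by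
  \<open>x\<close>, diag(\<sigma> i x) * S = S * M. So the sum of the conjugates is the trace of
  M.\<close>

lemma trace_rat:
  assumes x: "x \<in> L"
  shows "trace x \<in> \<rat>"
proof -
  define S where "S = emb e"
  obtain T where T: "T \<in> carrier_mat d d" "T * S = 1\<^sub>m d" "S * T = 1\<^sub>m d"
    using det_non_zero_imp_unit[OF emb_carrier det_emb_basis, of "()"] by (auto simp: Units_def ring_mat_def S_def)
  have S: "S \<in> carrier_mat d d" by (simp add: S_def)
  define M where "M k j = coord (x * e j) k" for k j
  have act: "\<sigma> i x * S $$ (i,j) = (\<Sum>k<d. S $$ (i,k) * of_rat (M k j))" if "i < d" "j < d" for i j
  proof -
    have "\<sigma> i x * S $$ (i,j) = \<sigma> i (x * e j)" using that x by (simp add: S_def emb_def hom_mult \<sigma>_hom e_in)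
    also have "\<dots> = \<sigma> i (\<Sum>k<d. of_rat (M k j) * e k)"
      unfolding M_def using coord[OF mult_in[OF x e_in[OF that(2)]]] by simp
    also have "\<dots> = (\<Sum>k<d. of_rat (M k j) * \<sigma> i (e k))"
      by (rule additive_basis) (simp add: hom_additive \<sigma>_hom that)
    finally show ?thesis using that by (simp add: S_def emb_def mult.commute)
  qed
  have "trace x = (\<Sum>i<d. \<sigma> i x * (S * T) $$ (i,i))" by (simp add: T(3) trace_enum)
  also have "\<dots> = (\<Sum>i<d. \<Sum>j<d. (\<sigma> i x * S $$ (i,j)) * T $$ (j,i))"
    by (intro sum.cong refl) (simp add: index_mult_mat_sum[OF S T(1)] sum_distrib_left mult.assoc)
  also have "\<dots> = (\<Sum>i<d. \<Sum>j<d. \<Sum>k<d. of_rat (M k j) * (T $$ (j,i) * S $$ (i,k)))"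
    by (intro sum.cong refl) (simp add: act sum_distrib_right sum_distrib_left mult_ac)
  also have "\<dots> = (\<Sum>j<d. \<Sum>i<d. \<Sum>k<d. of_rat (M k j) * (T $$ (j,i) * S $$ (i,k)))"
    by (rule sum.swap)
  also have "\<dots> = (\<Sum>j<d. \<Sum>k<d. \<Sum>i<d. of_rat (M k j) * (T $$ (j,i) * S $$ (i,k)))"
    by (intro sum.cong refl sum.swap)
  also have "\<dots> = (\<Sum>j<d. \<Sum>k<d. of_rat (M k j) * (T * S) $$ (j,k))"
    by (intro sum.cong refl) (simp add: index_mult_mat_sum[OF T(1) S] sum_distrib_left)
  also have "\<dots> = (\<Sum>j<d. \<Sum>k<d. if k = j then of_rat (M j j) else 0)"
    unfolding T(2) by (intro sum.cong refl) auto
  also have "\<dots> = of_rat (\<Sum>j<d. M j j)" by (simp add: of_rat_sum)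
  finally show ?thesis by simp
qed

lemma det_emb_mult_rat:
  assumes "\<And>j. j < d \<Longrightarrow> w j \<in> L" "\<And>j. j < d \<Longrightarrow> w' j \<in> L"
  shows "det (emb w) * det (emb w') \<in> \<rat>"
proof -
  have "det (trace_mat w w') \<in> \<rat>"
    by (rule det_in_Rats[of _ d]) (auto simp: trace_mat_def intro!: trace_rat mult_in assms)
  then show ?thesis using det_emb_mult[OF assms] by simp
qed

lemma disc_int:
  assumes "\<And>j. j < d \<Longrightarrow> w j \<in> OL"
  shows "(det (emb w))\<^sup>2 \<in> \<int>"
proof (rule rational_algebraic_int_is_int)
  show "(det (emb w))\<^sup>2 \<in> \<rat>" unfolding power2_eq_square
    using assms by (intro det_emb_mult_rat) (auto simp: OL_def)
  have "algebraic_int (det (emb w))"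
  proof (rule algebraic_int_det[OF emb_carrier])
    fix i j assume ij: "i < d" "j < d"
    have "w j \<in> L" "algebraic_int (w j)" using assms[OF ij(2)] by (auto simp: OL_def)
    from hom_algebraic_int[OF \<sigma>_hom[OF ij(1)] this] show "algebraic_int (emb w $$ (i,j))"
      by (simp add: emb_index ij)
  qed
  then show "algebraic_int ((det (emb w))\<^sup>2)" by (simp add: power2_eq_square algebraic_int_mult)
qed

text \<open>Coordinates are found by solving the system of all conjugates of \<open>x\<close> with
  Cramer's rule. The second conclusion, how the determinant changes when \<open>x\<close> replaces
  \<open>w k\<close>, is kept because bases are compared through it.\<close>

lemma cramer_coords:
  assumes w: "\<And>j. j < d \<Longrightarrow> w j \<in> L" and det: "det (emb w) \<noteq> 0" and x: "x \<in> L"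
  obtains q :: "nat \<Rightarrow> rat" where "x = (\<Sum>j<d. of_rat (q j) * w j)"
    "\<And>k. k < d \<Longrightarrow> det (emb (w(k := x))) = of_rat (q k) * det (emb w)"
proof -
  define S where "S = emb w"
  have S: "S \<in> carrier_mat d d" by (simp add: S_def)
  obtain T where T: "T \<in> carrier_mat d d" "S * T = 1\<^sub>m d"
    using det_non_zero_imp_unit[OF emb_carrier det, of "()"] by (auto simp: Units_def ring_mat_def S_def)
  define b where "b = vec d (\<lambda>i. \<sigma> i x)"
  define v where "v = T *\<^sub>v b"
  have b: "b \<in> carrier_vec d" by (simp add: b_def)
  have v: "v \<in> carrier_vec d" unfolding v_def by (rule mult_mat_vec_carrier[OF T(1) b])
  have Sv: "S *\<^sub>v v = b" unfolding v_def using S T b by (metis assoc_mult_mat_vec one_mult_mat_vec)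
  have cr: "det (emb (w(k := x))) = v $ k * det (emb w)" if k: "k < d" for k
  proof -
    have "replace_col S (S *\<^sub>v v) k = emb (w(k := x))"
      unfolding Sv by (rule eq_matI) (auto simp: replace_col_def S_def emb_def b_def)
    then show ?thesis using cramer_lemma_mat[OF S v k] by (simp add: S_def)
  qed
  have "\<exists>q. v $ k = of_rat q" if k: "k < d" for k
  proof -
    \<comment> \<open>Expanding by \<open>det (emb w)\<close> turns numerator and denominator into
      products of two embedding determinants, which are rational by the trace form; a single one may
      be irrational.\<close>
    have "v $ k = (det (emb (w(k := x))) * det (emb w)) / (det (emb w) * det (emb w))"
      using cr[OF k] det by simp
    also have "\<dots> \<in> \<rat>" by (intro Rats_divide det_emb_mult_rat) (auto simp: w x)
    finally show ?thesis by (metis Rats_cases)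
  qed
  then obtain q where q: "\<And>k. k < d \<Longrightarrow> v $ k = of_rat (q k)" by metis
  define y where "y = (\<Sum>j<d. of_rat (q j) * w j)"
  have y: "y \<in> L" unfolding y_def by (intro sum_in) (auto simp: mult_in of_rat_in w)
  have h0: "\<sigma> 0 \<in> homs" by (rule \<sigma>_hom[OF d_pos])
  \<comment> \<open>One embedding is enough to identify \<open>x\<close> with the rational
    combination, because it is injective on \<open>L\<close>.\<close>
  have "\<sigma> 0 x = (S *\<^sub>v v) $ 0" using d_pos by (simp add: Sv b_def)
  also have "\<dots> = (\<Sum>j<d. of_rat (q j) * \<sigma> 0 (w j))"
    using d_pos v by (auto simp: S_def emb_def scalar_prod_def atLeast0LessThan q mult.commute intro!: sum.cong)
  also have "\<dots> = \<sigma> 0 y" unfolding y_def by (rule hom_rat_comb[OF h0 w, symmetric])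
  finally have "x = y" using hom_inj[OF h0 x y] by blast
  then show ?thesis using that[of q] cr q by (simp add: y_def)
qed

text \<open>Asks for existence of integer coordinates only; their uniqueness is obtained from
  \<open>det (emb w) \<noteq> 0\<close>, which is carried along as a separate hypothesis.\<close>

definition ibasis :: "(nat \<Rightarrow> complex) \<Rightarrow> bool" where
  "ibasis w \<longleftrightarrow> (\<forall>i<d. w i \<in> OL) \<and> (\<forall>x\<in>OL. \<exists>c::nat \<Rightarrow> int. x = (\<Sum>j<d. of_int (c j) * w j))"

lemma int_coords_unique:
  assumes w: "\<And>j. j < d \<Longrightarrow> w j \<in> L" and det: "det (emb w) \<noteq> 0"
    and eq: "(\<Sum>j<d. of_int (c j) * w j) = (\<Sum>j<d. of_int (c' j) * w j)" and j: "j < d"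
  shows "c j = (c' j :: int)"
proof (rule ccontr)
  assume ne: "c j \<noteq> c' j"
  define v where "v = vec d (\<lambda>j. complex_of_int (c j - c' j))"
  have z: "(\<Sum>j<d. of_int (c j - c' j) * w j) = 0"
    using eq by (simp add: left_diff_distrib sum_subtractf)
  have "emb w *\<^sub>v v = 0\<^sub>v d"
  proof (rule eq_vecI)
    fix i assume "i < dim_vec (0\<^sub>v d :: complex vec)"
    then have i: "i < d" by simp
    note h = \<sigma>_hom[OF i]
    have "(emb w *\<^sub>v v) $ i = (\<Sum>j<d. of_int (c j - c' j) * \<sigma> i (w j))"
      using i by (auto simp: emb_def v_def scalar_prod_def atLeast0LessThan mult.commute intro!: sum.cong)
    also have "\<dots> = \<sigma> i (\<Sum>j<d. of_int (c j - c' j) * w j)" by (rule hom_int_comb[OF h w, symmetric])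
    finally show "(emb w *\<^sub>v v) $ i = (0\<^sub>v d :: complex vec) $ i" using z additive_zero[OF hom_additive[OF h]] i by simp
  qed (simp add: emb_def)
  moreover have "v $ j \<noteq> 0" using ne j by (simp add: v_def)
  then have "v \<noteq> 0\<^sub>v d" using j by auto
  moreover have "v \<in> carrier_vec d" by (simp add: v_def)
  ultimately show False using det det_0_iff_vec_prod_zero[OF emb_carrier[of w]] by blast
qed

lemma det_emb_int_comb:
  assumes w: "\<And>j. j < d \<Longrightarrow> w j \<in> L"
    and c: "\<And>j. j < d \<Longrightarrow> w' j = (\<Sum>k<d. of_int (c k j) * w k)"
  shows "det (emb w') = det (emb w) * of_int (det (mat d d (\<lambda>(k,j). c k j)))"
proof -
  define C where "C = mat d d (\<lambda>(k,j). c k j)"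
  have C: "C \<in> carrier_mat d d" by (simp add: C_def)
  have "emb w' = emb w * map_mat of_int C"
  proof (rule eq_matI)
    fix i j assume "i < dim_row (emb w * map_mat of_int C)" "j < dim_col (emb w * map_mat of_int C)"
    then have ij: "i < d" "j < d" by (auto simp: emb_def C_def)
    note h = \<sigma>_hom[OF ij(1)]
    have "(emb w * map_mat of_int C) $$ (i,j) = (\<Sum>k<d. emb w $$ (i,k) * map_mat of_int C $$ (k,j))"
      by (rule index_mult_mat_sum[of _ d d _ d]) (use ij C in auto)
    also have "\<dots> = (\<Sum>k<d. of_int (c k j) * \<sigma> i (w k))"
      using ij by (intro sum.cong) (auto simp: emb_def C_def)
    also have "\<dots> = \<sigma> i (\<Sum>k<d. of_int (c k j) * w k)" by (rule hom_int_comb[OF h w, symmetric])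
    finally show "emb w' $$ (i,j) = (emb w * map_mat of_int C) $$ (i,j)"
      using ij c[OF ij(2)] by (simp add: emb_def)
  qed (auto simp: emb_def C_def)
  then show ?thesis using det_mult[OF emb_carrier, of "map_mat of_int C" w] C
    by (simp add: C_def[symmetric] of_int_hom.hom_det)
qed

text \<open>
  Among the families of algebraic integers with nonzero discriminant choose one of minimal absolute
  discriminant; a fractional coordinate of an algebraic integer would allow a smaller one.
\<close>

theorem integral_basis_exists:
  obtains w where "ibasis w" "det (emb w) \<noteq> 0"
proof -
  have "\<exists>N::int. N \<noteq> 0 \<and> algebraic_int (of_int N * e j)" if j: "j < d" for j
  proof -
    obtain p where "p \<noteq> 0" "poly (map_poly of_rat p) (e j) = 0" using algebraic[OF e_in[OF j]] .
    then have "Polynomial.algebraic (e j)"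
      unfolding algebraic_altdef by (intro exI[of _ "map_poly of_rat p"]) auto
    then show ?thesis using algebraic_int_multiple by blast
  qed
  then obtain N :: "nat \<Rightarrow> int" where N: "\<And>j. j < d \<Longrightarrow> N j \<noteq> 0 \<and> algebraic_int (of_int (N j) * e j)" by metis
  define M where "M = (\<Prod>j<d. N j)"
  define w0 where "w0 j = of_int M * e j" for j
  have "w0 j \<in> OL" if j: "j < d" for j
  proof -
    have "M = (\<Prod>k\<in>{..<d}-{j}. N k) * N j" unfolding M_def using j by (simp add: prod.remove[of _ j] mult.commute)
    then have "w0 j = of_int (\<Prod>k\<in>{..<d}-{j}. N k) * (of_int (N j) * e j)" by (simp add: w0_def mult.assoc)
    moreover have "of_int (N j) * e j \<in> OL" using N[OF j] j by (simp add: OL_def mult_in of_int_in e_in)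
    ultimately show ?thesis by (metis OL_mult OL_int)
  qed
  moreover have "det (emb w0) \<noteq> 0"
  proof -
    have "emb w0 = of_int M \<cdot>\<^sub>m emb e"
      by (rule eq_matI) (auto simp: emb_def w0_def hom_mult[OF \<sigma>_hom] hom_int[OF \<sigma>_hom] of_int_in e_in)
    then have "det (emb w0) = of_int M ^ d * det (emb e)" by (simp add: det_smult emb_def)
    moreover have "M \<noteq> 0" using N by (simp add: M_def)
    ultimately show ?thesis using det_emb_basis by simp
  qed
  ultimately have ex: "\<exists>w. (\<forall>j<d. w j \<in> OL) \<and> det (emb w) \<noteq> 0" by blast
  define P where "P w \<longleftrightarrow> (\<forall>j<d. w j \<in> OL) \<and> det (emb w) \<noteq> 0" for w
  \<comment> \<open>For families in \<open>P\<close> the squared determinant is an integer, so the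
    floor changes nothing and a minimum over natural numbers exists.\<close>
  define m where "m w = nat \<lfloor>cmod ((det (emb w))\<^sup>2)\<rfloor>" for w
  have m: "real (m w) = (cmod (det (emb w)))\<^sup>2" if "P w" for w
  proof -
    obtain k where k: "(det (emb w))\<^sup>2 = of_int k" using disc_int[of w] \<open>P w\<close> by (auto simp: P_def elim: Ints_cases)
    then have "cmod ((det (emb w))\<^sup>2) = real_of_int \<bar>k\<bar>" by (simp add: norm_of_int)
    then show ?thesis by (simp add: m_def norm_power)
  qed
  define w where "w = arg_min m P"
  have w: "P w" "\<And>w'. P w' \<Longrightarrow> m w \<le> m w'"
    using ex arg_min_nat_lemma[of P _ m] by (auto simp: w_def P_def)
  have wL: "w j \<in> L" if "j < d" for j using w(1) that by (simp add: P_def OL_def)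
  have det: "det (emb w) \<noteq> 0" using w(1) by (simp add: P_def)
  have "\<exists>c::nat \<Rightarrow> int. x = (\<Sum>j<d. of_int (c j) * w j)" if x: "x \<in> OL" for x
  proof -
    obtain q :: "nat \<Rightarrow> rat" where q: "x = (\<Sum>j<d. of_rat (q j) * w j)"
      "\<And>k. k < d \<Longrightarrow> det (emb (w(k := x))) = of_rat (q k) * det (emb w)"
      using cramer_coords[OF wL det OL_in[OF x]] by blast
    have "of_int \<lfloor>q k\<rfloor> = q k" if k: "k < d" for k
    proof (rule ccontr)
      assume ne: "of_int \<lfloor>q k\<rfloor> \<noteq> q k"
      define f where "f = q k - of_int \<lfloor>q k\<rfloor>"
      have f: "0 < f" "f < 1" using ne unfolding f_def by linarith+
      \<comment> \<open>Subtracting the integer part leaves \<open>f\<close>, strictly between 0 and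
        1, as k-th coordinate. Replacing \<open>w k\<close> by \<open>x'\<close> multiplies the
        determinant by \<open>f\<close>, against minimality.\<close>
      define x' where "x' = x + of_int (- \<lfloor>q k\<rfloor>) * w k"
      have x': "x' \<in> OL" unfolding x'_def using x w(1) k by (intro OL_add OL_mult OL_int) (auto simp: P_def)
      have repl: "replace_col (emb w) (col (emb (w(k := x'))) k) k = emb (w(k := x'))"
        by (rule eq_matI) (auto simp: replace_col_def emb_def)
      have "det (emb (w(k := x'))) = of_rat f * det (emb w)"
      proof -
        define v where "v = vec d (\<lambda>j. complex_of_rat (if j = k then f else q j))"
        have v: "v \<in> carrier_vec d" by (simp add: v_def)
        have x'q: "x' = (\<Sum>j<d. of_rat (if j = k then f else q j) * w j)"
        proof -
          have "(\<Sum>j<d. of_rat (if j = k then f else q j) * w j) = (\<Sum>j<d. of_rat (q j) * w j + (if j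
            = k then of_int (- \<lfloor>q k\<rfloor>) * w k else 0))"
            by (intro sum.cong) (auto simp: f_def of_rat_diff left_diff_distrib)
          then show ?thesis using k by (simp add: sum.distrib x'_def q(1)[symmetric])
        qed
        have "emb w *\<^sub>v v = col (emb (w(k := x'))) k"
        proof (rule eq_vecI)
          fix i assume "i < dim_vec (col (emb (w(k := x'))) k)"
          then have i: "i < d" by (simp add: emb_def)
          note h = \<sigma>_hom[OF i]
          have "(emb w *\<^sub>v v) $ i = (\<Sum>j<d. of_rat (if j = k then f else q j) * \<sigma> i (w j))"
            using i by (auto simp: emb_def v_def scalar_prod_def atLeast0LessThan mult.commute intro!: sum.cong)
          also have "\<dots> = \<sigma> i x'" unfolding x'q by (rule hom_rat_comb[OF h wL, symmetric])
          finally show "(emb w *\<^sub>v v) $ i = col (emb (w(k := x'))) k $ i" using i k by (simp add: emb_def)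
        qed (simp add: emb_def)
        then show ?thesis using cramer_lemma_mat[OF emb_carrier v k, of w] repl k by (simp add: v_def)
      qed
      note dx = this
      have "P (w(k := x'))" using w(1) x' dx f det by (simp add: P_def)
      from w(2)[OF this] have "real (m w) \<le> real (m (w(k := x')))" by simp
      also have "\<dots> = (cmod (of_rat f))\<^sup>2 * (cmod (det (emb w)))\<^sup>2"
        using m[OF \<open>P (w(k := x'))\<close>] by (simp add: dx norm_mult power_mult_distrib)
      finally have "1 * (cmod (det (emb w)))\<^sup>2 \<le> (cmod (of_rat f))\<^sup>2 * (cmod (det (emb w)))\<^sup>2"
        using m[OF w(1)] by simp
      then have "1 \<le> (cmod (of_rat f))\<^sup>2" using det by (simp only: mult_le_cancel_right) auto
      moreover have "cmod (of_rat f) = \<bar>real_of_rat f\<bar>"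
        by (cases f) (simp add: of_rat_rat norm_divide)
      moreover have "real_of_rat f * real_of_rat f < 1 * 1" using f by (intro mult_strict_mono) auto
      ultimately show False using f by (simp add: power2_eq_square)
    qed
    then have "x = (\<Sum>j<d. of_int \<lfloor>q j\<rfloor> * w j)"
      unfolding q(1) by (intro sum.cong refl) (metis lessThan_iff of_rat_of_int_eq)
    then show ?thesis by (intro exI[of _ "\<lambda>j. \<lfloor>q j\<rfloor>"])
  qed
  then have "ibasis w" using w(1) by (auto simp: ibasis_def P_def)
  then show ?thesis using det that by blast
qed

text \<open>Each determinant is an integer multiple of the other, so the factor is 1 or -1 and
  squaring removes it.\<close>

lemma ibasis_disc_unique:
  assumes "ibasis w" "det (emb w) \<noteq> 0" "ibasis w'"
  shows "(det (emb w'))\<^sup>2 = (det (emb w))\<^sup>2"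
proof -
  have comb: "\<exists>k::int. det (emb b) = det (emb a) * of_int k" if a: "ibasis a" and b: "ibasis b" for a b
  proof -
    have "\<forall>j. \<exists>c::nat \<Rightarrow> int. j < d \<longrightarrow> b j = (\<Sum>k<d. of_int (c k) * a k)" using a b unfolding ibasis_def by meson
    then obtain c :: "nat \<Rightarrow> nat \<Rightarrow> int" where c: "\<And>j. j < d \<Longrightarrow> b j = (\<Sum>k<d. of_int (c j k) * a k)" by metis
    show ?thesis using det_emb_int_comb[of a b "\<lambda>k j. c j k"] c a by (auto simp: ibasis_def OL_def)
  qed
  obtain k where k: "det (emb w') = det (emb w) * of_int k" using comb assms by blast
  obtain l where l: "det (emb w) = det (emb w') * of_int l" using comb assms by blast
  have "det (emb w) = (det (emb w) * of_int k) * of_int l"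
    by (subst k[symmetric]) (rule l)
  then have "det (emb w) * (of_int (k * l)) = det (emb w) * 1" by (simp add: mult.assoc)
  then have "of_int (k * l) = (1::complex)" by (rule iffD1[OF mult_left_cancel[OF assms(2)]])
  then have "k * l = 1" by (metis of_int_eq_1_iff)
  then have "\<bar>k\<bar> = 1" using abs_zmult_eq_1[of k l] by simp
  then have "k\<^sup>2 = 1" by (metis power2_abs one_power2)
  then have "(of_int k :: complex)\<^sup>2 = 1" by (metis of_int_1 of_int_power)
  then show ?thesis unfolding k power_mult_distrib by simp
qed

end

section \<open>Generators with small conjugates\<close>

text \<open>Taylor's formula. It makes a coefficient of the shifted polynomial, as a function of the
  shift, a derivative of \<open>p\<close> up to a factorial, so the bad shifts are roots that can be
  counted.\<close>

lemma coeff_shift: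
  fixes p :: "int poly"
  shows "fact k * coeff (p \<circ>\<^sub>p [:c, 1:]) k = poly ((pderiv ^^ k) p) c"
proof -
  have "(pderiv ^^ k) (p \<circ>\<^sub>p [:c, 1:]) = (pderiv ^^ k) p \<circ>\<^sub>p [:c, 1:]"
    by (induction k) (simp_all add: pderiv_pcompose pderiv_pCons)
  moreover have "coeff ((pderiv ^^ k) (p \<circ>\<^sub>p [:c, 1:])) 0 = fact k * coeff (p \<circ>\<^sub>p [:c, 1:]) k"
    by (simp add: coeff_higher_pderiv pochhammer_fact)
  ultimately show ?thesis by (metis poly_0_coeff_0 poly_pcompose poly_pCons mult_zero_left add.right_neutral)
qed

lemma shift_nonzero_coeffs:
  fixes f :: "int poly"
  assumes f: "lead_coeff f = 1" and m: "degree f * (degree f + 1) div 2 < 2 * m + 1"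
  shows "\<exists>n. \<bar>n\<bar> \<le> int m \<and> (\<forall>k\<le>degree f. coeff (f \<circ>\<^sub>p [:- n, 1:]) k \<noteq> 0)"
proof -
  define d where "d = degree f"
  define Z where "Z k = {c. poly ((pderiv ^^ k) f) c = 0}" for k
  have nz: "(pderiv ^^ k) f \<noteq> 0" if "k < d" for k
  proof -
    have "degree ((pderiv ^^ k) f) = d - k" by (simp add: degree_higher_pderiv d_def)
    then show ?thesis using that by (metis degree_0 zero_less_diff less_irrefl)
  qed
  have Z: "finite (Z k)" "card (Z k) \<le> d - k" if "k < d" for k
    using poly_roots_finite[OF nz[OF that]] poly_roots_degree[OF nz[OF that]]
    by (auto simp: Z_def degree_higher_pderiv d_def)
  have "card (\<Union>k<d. Z k) \<le> (\<Sum>k<d. card (Z k))" by (rule card_UN_le) simp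
  also have "\<dots> \<le> (\<Sum>k<d. d - k)" by (intro sum_mono Z) auto
  also have "\<dots> = (\<Sum>k=1..d. k)"
    by (rule sum.reindex_bij_witness[of _ "\<lambda>k. d - k" "\<lambda>k. d - k"]) auto
  also have "\<dots> = d * (d + 1) div 2" by (simp add: Sum_Icc_nat)
  also have "\<dots> < 2 * m + 1" using m by (simp add: d_def)
  also have "\<dots> = card {- int m..int m}" by simp
  finally have lt: "card (\<Union>k<d. Z k) < card {- int m..int m}" .
  have "\<not> {- int m..int m} \<subseteq> (\<Union>k<d. Z k)"
    using card_mono[of "\<Union>k<d. Z k" "{- int m..int m}"] lt Z by auto
  then obtain c where c: "c \<in> {- int m..int m}" "c \<notin> (\<Union>k<d. Z k)" by blast
  have "coeff (f \<circ>\<^sub>p [:c, 1:]) k \<noteq> 0" if "k \<le> d" for k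
  proof (cases "k = d")
    case True
    have "lead_coeff (f \<circ>\<^sub>p [:c, 1:]) = 1" using f by (subst lead_coeff_comp) auto
    then show ?thesis using True by (simp add: degree_pcompose d_def)
  next
    case False
    then have "poly ((pderiv ^^ k) f) c \<noteq> 0" using c(2) that by (auto simp: Z_def)
    then show ?thesis using coeff_shift[of k f c] by auto
  qed
  \<comment> \<open>The sign is chosen for use with f(X - n), whose roots are those of f increased
    by n.\<close>
  then show ?thesis using c(1) by (intro exI[of _ "- c"]) (auto simp: d_def)
qed

context enumerated_number_field
begin

text \<open>In the integral basis, multiplication by \<open>y\<close> has an integer matrix; the
  embedding matrix conjugates it to the diagonal matrix of the conjugates of
  \<open>y\<close>.\<close>

lemma char_poly_element:
  assumes w: "ibasis w" "det (emb w) \<noteq> 0" and y: "y \<in> OL"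
  obtains f :: "int poly" where "lead_coeff f = 1" "degree f = d"
    "of_int_poly f = (\<Prod>i<d. [:- \<sigma> i y, 1:])"
proof -
  define S where "S = emb w"
  have S: "S \<in> carrier_mat d d" by (simp add: S_def)
  obtain T where T: "T \<in> carrier_mat d d" "T * S = 1\<^sub>m d" "S * T = 1\<^sub>m d"
    using det_non_zero_imp_unit[OF emb_carrier w(2), of "()"] by (auto simp: Units_def ring_mat_def S_def)
  have wL: "w j \<in> L" if "j < d" for j using w(1) that by (simp add: ibasis_def OL_def)
  have "\<forall>j. \<exists>c::nat \<Rightarrow> int. j < d \<longrightarrow> y * w j = (\<Sum>k<d. of_int (c k) * w k)"
    using w(1) OL_mult[OF y] unfolding ibasis_def by meson
  then obtain c :: "nat \<Rightarrow> nat \<Rightarrow> int" where c: "\<And>j. j < d \<Longrightarrow> y * w j = (\<Sum>k<d. of_int (c j k) * w k)" by metis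
  define M where "M = mat d d (\<lambda>(k,j). c j k)"
  define M' where "M' = map_mat complex_of_int M"
  define D where "D = mat_diag d (\<lambda>i. \<sigma> i y)"
  have M: "M \<in> carrier_mat d d" "M' \<in> carrier_mat d d" by (auto simp: M_def M'_def)
  have D: "D \<in> carrier_mat d d" by (simp add: D_def)
  have eq: "D * S = S * M'"
  proof (rule eq_matI)
    fix i j assume "i < dim_row (S * M')" "j < dim_col (S * M')"
    then have ij: "i < d" "j < d" using S M by auto
    note h = \<sigma>_hom[OF ij(1)]
    have "(S * M') $$ (i,j) = (\<Sum>k<d. S $$ (i,k) * M' $$ (k,j))" by (rule index_mult_mat_sum[OF S M(2) ij])
    also have "\<dots> = (\<Sum>k<d. of_int (c j k) * \<sigma> i (w k))"
      using ij by (intro sum.cong) (auto simp: S_def emb_def M'_def M_def)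
    also have "\<dots> = \<sigma> i (y * w j)" unfolding c[OF ij(2)] by (rule hom_int_comb[OF h wL, symmetric])
    also have "\<dots> = \<sigma> i y * S $$ (i,j)" using ij by (simp add: hom_mult[OF h] OL_in[OF y] wL S_def emb_def)
    also have "\<dots> = (D * S) $$ (i,j)" using ij S by (simp add: D_def mat_diag_mult_left[of _ _ d])
    finally show "(D * S) $$ (i,j) = (S * M') $$ (i,j)" ..
  qed (use D S M in auto)
  have "M' = T * D * S"
  proof -
    have "T * D * S = T * (D * S)" by (rule assoc_mult_mat[OF T(1) D S])
    also have "\<dots> = (T * S) * M'" unfolding eq by (rule assoc_mult_mat[OF T(1) S M(2), symmetric])
    also have "\<dots> = M'" unfolding T(2) using M(2) by simp
    finally show ?thesis ..
  qed
  then have "similar_mat_wit M' D T S"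
    unfolding similar_mat_wit_def Let_def using M(2) D T S by auto
  then have "char_poly M' = char_poly D" by (intro char_poly_similar) (auto simp: similar_mat_def)
  also have "\<dots> = (\<Prod>a\<leftarrow>diag_mat D. [:- a, 1:])"
    by (rule char_poly_upper_triangular[OF D]) (auto simp: D_def mat_diag_def)
  also have "\<dots> = (\<Prod>a\<leftarrow>map (\<lambda>i. \<sigma> i y) [0..<d]. [:- a, 1:])"
    by (rule arg_cong[of _ _ "\<lambda>as. \<Prod>a\<leftarrow>as. [:- a, 1:]"]) (auto simp: diag_mat_def D_def mat_diag_def)
  also have "\<dots> = (\<Prod>i<d. [:- \<sigma> i y, 1:])"
    by (simp add: prod.list_conv_set_nth atLeast0LessThan)
  finally have "of_int_poly (char_poly M) = (\<Prod>i<d. [:- \<sigma> i y, 1:])"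
    by (simp add: M'_def of_int_hom.char_poly_hom[OF M(1)])
  then show ?thesis using that[of "char_poly M"] degree_monic_char_poly[OF M(1)] by auto
qed

text \<open>The norm is, up to sign, the constant coefficient of the integer characteristic
  polynomial.\<close>

lemma norm_ge_1:
  assumes w: "ibasis w" "det (emb w) \<noteq> 0" and y: "y \<in> OL" "y \<noteq> 0"
  shows "(\<Prod>i<d. cmod (\<sigma> i y)) \<ge> 1"
proof -
  obtain f where f: "of_int_poly f = (\<Prod>i<d. [:- \<sigma> i y, 1:])"
    using char_poly_element[OF w y(1)] by blast
  have e1: "(\<Prod>i<d. - \<sigma> i y) = of_int (coeff f 0)"
  proof -
    have "of_int (coeff f 0) = poly (of_int_poly f) 0" by (simp add: poly_0_coeff_0)
    also have "\<dots> = (\<Prod>i<d. poly [:- \<sigma> i y, 1:] 0)" unfolding f by (rule poly_prod)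
    finally show ?thesis by simp
  qed
  have "(\<Prod>i<d. - \<sigma> i y) \<noteq> 0" using hom_nonzero[OF \<sigma>_hom OL_in[OF y(1)] y(2)] by simp
  then have "coeff f 0 \<noteq> 0" unfolding e1 by auto
  have "(\<Prod>i<d. cmod (\<sigma> i y)) = cmod (\<Prod>i<d. - \<sigma> i y)" by (simp add: prod_norm[symmetric])
  also have "\<dots> = real_of_int \<bar>coeff f 0\<bar>" unfolding e1 by simp
  also have "\<dots> \<ge> 1" using \<open>coeff f 0 \<noteq> 0\<close> by linarith
  finally show ?thesis .
qed

text \<open>
  A simple root \<open>\<sigma> i0 y\<close> of the characteristic polynomial gives \<open>f'(y) \<noteq> 0\<close>, and then \<open>f'\<close> vanishes at
  no conjugate of \<open>y\<close>.
\<close>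

lemma all_distinct_if_one:
  assumes w: "ibasis w" "det (emb w) \<noteq> 0" and y: "y \<in> OL" and i0: "i0 < d"
    and sep: "\<And>j. j < d \<Longrightarrow> j \<noteq> i0 \<Longrightarrow> \<sigma> j y \<noteq> \<sigma> i0 y"
  shows "inj_on (\<lambda>i. \<sigma> i y) {..<d}"
proof -
  obtain f where f: "of_int_poly f = (\<Prod>i<d. [:- \<sigma> i y, 1:])"
    using char_poly_element[OF w y] by blast
  have yL: "y \<in> L" by (rule OL_in[OF y])
  define g where "g = pderiv f"
  have g: "of_int_poly g = pderiv (\<Prod>i<d. [:- \<sigma> i y, 1:])"
    unfolding g_def f[symmetric] by (rule of_int_hom.map_poly_pderiv)
  have split: "poly (of_int_poly g) (\<sigma> i y) = (\<Prod>j\<in>{..<d} - {i}. \<sigma> i y - \<sigma> j y)" if i: "i < d" for i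
  proof -
    have eq: "(\<Prod>i<d. [:- \<sigma> i y, 1:]) = [:- \<sigma> i y, 1:] * (\<Prod>j\<in>{..<d} - {i}. [:- \<sigma> j y, 1:])"
      using i by (subst prod.remove[of _ i]) auto
    show ?thesis unfolding g eq pderiv_mult poly_add poly_mult by (simp add: pderiv_pCons poly_prod)
  qed
  have "\<forall>j\<in>{..<d} - {i0}. \<sigma> i0 y - \<sigma> j y \<noteq> 0" using sep[THEN not_sym] by simp
  then have "poly (of_int_poly g) (\<sigma> i0 y) \<noteq> 0" unfolding split[OF i0] by (simp add: prod_zero_iff)
  then have "\<sigma> i0 (poly (of_int_poly g) y) \<noteq> 0"
    using hom_poly_int[OF \<sigma>_hom[OF i0] yL, of g] by simp
  then have ne: "poly (of_int_poly g) y \<noteq> 0"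
    using additive_zero[OF hom_additive[OF \<sigma>_hom[OF i0]]] by auto
  have "map_poly (of_rat :: rat \<Rightarrow> complex) (of_int_poly g) = of_int_poly g"
    by (simp add: map_poly_map_poly o_def)
  then have gL: "poly (of_int_poly g) y \<in> L"
    using hom_poly_rat(1)[OF \<sigma>_hom[OF i0] yL, of "of_int_poly g"] by simp
  show ?thesis
  proof (rule inj_onI, rule ccontr)
    fix i j assume ij: "i \<in> {..<d}" "j \<in> {..<d}" "\<sigma> i y = \<sigma> j y" "i \<noteq> j"
    then have "poly (of_int_poly g) (\<sigma> i y) = 0"
      using split[of i] by (auto intro!: prod_zero bexI[of _ j])
    then have "\<sigma> i (poly (of_int_poly g) y) = 0"
      using hom_poly_int[OF \<sigma>_hom yL, of i g] ij by simp
    then show False using hom_nonzero[OF \<sigma>_hom gL ne, of i] ij by simp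
  qed
qed

section \<open>Real linear forms attached to the embeddings\<close>

definition cnj_ix :: "nat \<Rightarrow> nat" where
  "cnj_ix i = the_inv_into {..<d} \<sigma> (\<lambda>x. cnj (\<sigma> i x))"

lemma cnj_ix: assumes "i < d" shows "cnj_ix i < d" "\<sigma> (cnj_ix i) x = cnj (\<sigma> i x)"
proof -
  have inj: "inj_on \<sigma> {..<d}" and im: "\<sigma> ` {..<d} = homs" using \<sigma> by (auto simp: bij_betw_def)
  have "(\<lambda>x. cnj (\<sigma> i x)) \<in> homs" using \<sigma>_hom[OF assms] by (auto simp: homs_def additive_def)
  then have *: "(\<lambda>x. cnj (\<sigma> i x)) \<in> \<sigma> ` {..<d}" by (simp add: im)
  show "cnj_ix i < d" using the_inv_into_into[OF inj * order_refl] by (simp add: cnj_ix_def)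
  show "\<sigma> (cnj_ix i) x = cnj (\<sigma> i x)" using f_the_inv_into_f[OF inj *] by (simp add: cnj_ix_def fun_eq_iff)
qed

lemma cnj_ix_cnj_ix: assumes "i < d" shows "cnj_ix (cnj_ix i) = i"
proof -
  have "\<sigma> (cnj_ix (cnj_ix i)) = \<sigma> i" by (rule ext) (simp add: cnj_ix assms)
  then show ?thesis using \<sigma> cnj_ix(1)[OF cnj_ix(1)[OF assms]] assms by (auto simp: bij_betw_def inj_on_def)
qed

text \<open>The factor \<open>sqrt 2\<close> makes the passage from a conjugate pair to its real and
  imaginary parts unitary, so determinants keep their modulus. Indices fixed by
  \<open>cnj_ix\<close> are the real embeddings; within a pair the smaller index carries the real
  part and the larger the imaginary part.\<close>

definition form :: "nat \<Rightarrow> complex \<Rightarrow> real" where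
  "form i x = (if cnj_ix i = i then Re (\<sigma> i x) else if i < cnj_ix i then sqrt 2 * Re (\<sigma> i x) else sqrt 2 * Im (\<sigma> i x))"

lemma form_real: assumes "i < d" "cnj_ix i = i" shows "\<sigma> i x = of_real (form i x)"
proof -
  have "cnj (\<sigma> i x) = \<sigma> i x" using cnj_ix(2)[OF assms(1), of x] assms(2) by simp
  then have "Im (\<sigma> i x) = 0" by (simp add: complex_eq_iff)
  then show ?thesis using assms by (simp add: form_def complex_eq_iff)
qed

text \<open>Which of the two indices carries the real part depends on their order; unordered pairs
  and sums over the pair hide this distinction.\<close>

lemma form_complex:
  assumes "i < d" "cnj_ix i \<noteq> i"
  shows "{\<bar>form i x\<bar>, \<bar>form (cnj_ix i) x\<bar>} = {sqrt 2 * \<bar>Re (\<sigma> i x)\<bar>, sqrt 2 * \<bar>Im (\<sigma> i x)\<bar>}"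
    "form i x * form i z + form (cnj_ix i) x * form (cnj_ix i) z
      = 2 * (Re (\<sigma> i x) * Re (\<sigma> i z) + Im (\<sigma> i x) * Im (\<sigma> i z))"
proof -
  have bb: "cnj_ix (cnj_ix i) = i" by (rule cnj_ix_cnj_ix[OF assms(1)])
  have s: "sqrt 2 * a * (sqrt 2 * b) = 2 * (a * b)" for a b :: real
    by (simp add: algebra_simps)
  consider "i < cnj_ix i" | "cnj_ix i < i" using assms(2) by linarith
  then have "{\<bar>form i x\<bar>, \<bar>form (cnj_ix i) x\<bar>} = {sqrt 2 * \<bar>Re (\<sigma> i x)\<bar>, sqrt 2 * \<bar>Im (\<sigma> i x)\<bar>} \<and>
    form i x * form i z + form (cnj_ix i) x * form (cnj_ix i) z = 2 * (Re (\<sigma> i x) * Re (\<sigma> i z) + Im (\<sigma> i x) * Im (\<sigma> i z))"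
  proof cases
    case 1
    then have "form i w = sqrt 2 * Re (\<sigma> i w)" "form (cnj_ix i) w = - (sqrt 2 * Im (\<sigma> i w))" for w
      using assms bb by (auto simp: form_def cnj_ix(2))
    then show ?thesis by (simp add: s abs_mult)
  next
    case 2
    then have "form i w = sqrt 2 * Im (\<sigma> i w)" "form (cnj_ix i) w = sqrt 2 * Re (\<sigma> i w)" for w
      using assms bb by (auto simp: form_def cnj_ix(2))
    then show ?thesis by (simp add: s abs_mult insert_commute)
  qed
  then show "{\<bar>form i x\<bar>, \<bar>form (cnj_ix i) x\<bar>} = {sqrt 2 * \<bar>Re (\<sigma> i x)\<bar>, sqrt 2 * \<bar>Im (\<sigma> i x)\<bar>}"
    "form i x * form i z + form (cnj_ix i) x * form (cnj_ix i) z
      = 2 * (Re (\<sigma> i x) * Re (\<sigma> i z) + Im (\<sigma> i x) * Im (\<sigma> i z))"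
    by auto
qed

definition form_mat :: "(nat \<Rightarrow> complex) \<Rightarrow> real mat" where
  "form_mat w = mat d d (\<lambda>(i,j). form i (w j))"

lemma bij_cnj_ix: "bij_betw cnj_ix {..<d} {..<d}"
  by (rule bij_betw_byWitness[of _ cnj_ix]) (auto simp: cnj_ix cnj_ix_cnj_ix)

text \<open>The two sums agree only after adding the terms of i and of its conjugate. Since
  \<open>cnj_ix\<close> permutes the indices, twice each sum is a sum over such pairs, and the
  indices need not be split into real and complex ones.\<close>

lemma sum_form_mult:
  "of_real (\<Sum>i<d. form i x * form i z) = (\<Sum>i<d. \<sigma> i x * cnj (\<sigma> i z))"
proof -
  define g where "g i = complex_of_real (form i x * form i z)" for i
  define h where "h i = \<sigma> i x * cnj (\<sigma> i z)" for i
  have gh: "g i + g (cnj_ix i) = h i + h (cnj_ix i)" if i: "i < d" for i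
  proof (cases "cnj_ix i = i")
    case True
    have "cnj (\<sigma> i z) = \<sigma> i z" using cnj_ix(2)[OF i, of z] True by simp
    then have "h i = g i" using form_real[OF i True] by (simp add: g_def h_def)
    then show ?thesis using True by simp
  next
    case False
    have "g i + g (cnj_ix i) = of_real (form i x * form i z + form (cnj_ix i) x * form (cnj_ix i) z)"
      by (simp add: g_def)
    also have "\<dots> = h i + h (cnj_ix i)" unfolding form_complex(2)[OF i False]
      by (simp add: h_def cnj_ix(2)[OF i] complex_eq_iff algebra_simps)
    finally show ?thesis .
  qed
  have "(\<Sum>i<d. g i) + (\<Sum>i<d. g (cnj_ix i)) = (\<Sum>i<d. h i) + (\<Sum>i<d. h (cnj_ix i))"
    unfolding sum.distrib[symmetric] by (intro sum.cong) (auto simp: gh)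
  then have "(\<Sum>i<d. g i) + (\<Sum>i<d. g i) = (\<Sum>i<d. h i) + (\<Sum>i<d. h i)"
    using sum.reindex_bij_betw[OF bij_cnj_ix, of g] sum.reindex_bij_betw[OF bij_cnj_ix, of h] by simp
  then have "(\<Sum>i<d. g i) = (\<Sum>i<d. h i)" by simp
  then show ?thesis by (simp add: g_def h_def)
qed

text \<open>Writing A for the real matrix and S for the embedding matrix, the two Gram matrices A^T
  A and S^T cnj(S) coincide, so (det A)^2 is the squared modulus of det S.\<close>

lemma det_form_mat: "\<bar>det (form_mat w)\<bar> = cmod (det (emb w))"
proof -
  define A where "A = map_mat complex_of_real (form_mat w)"
  define C where "C = map_mat cnj (emb w)"
  have A: "A \<in> carrier_mat d d" and C: "C \<in> carrier_mat d d" and r: "form_mat w \<in> carrier_mat d d"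
    by (auto simp: A_def C_def form_mat_def)
  have "transpose_mat A * A = transpose_mat (emb w) * C"
  proof (rule eq_matI)
    fix j k assume "j < dim_row (transpose_mat (emb w) * C)" "k < dim_col (transpose_mat (emb w) * C)"
    then have jk: "j < d" "k < d" using C by (auto simp: emb_def)
    have "(transpose_mat A * A) $$ (j,k) = (\<Sum>i<d. transpose_mat A $$ (j,i) * A $$ (i,k))"
      by (rule index_mult_mat_sum[of _ d d _ d]) (use jk A in auto)
    also have "\<dots> = of_real (\<Sum>i<d. form i (w j) * form i (w k))"
      using jk by (auto simp: A_def form_mat_def intro!: sum.cong)
    also have "\<dots> = (\<Sum>i<d. \<sigma> i (w j) * cnj (\<sigma> i (w k)))" by (rule sum_form_mult)
    also have "\<dots> = (\<Sum>i<d. transpose_mat (emb w) $$ (j,i) * C $$ (i,k))"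
      using jk by (auto simp: C_def emb_def intro!: sum.cong)
    also have "\<dots> = (transpose_mat (emb w) * C) $$ (j,k)"
      by (rule index_mult_mat_sum[of _ d d _ d, symmetric]) (use jk C in auto)
    finally show "(transpose_mat A * A) $$ (j,k) = (transpose_mat (emb w) * C) $$ (j,k)" .
  qed (use A C in \<open>auto simp: emb_def\<close>)
  then have "det (transpose_mat A * A) = det (transpose_mat (emb w) * C)" by simp
  then have eq: "det A * det A = det (emb w) * det C"
    using A C by (simp add: det_mult[of _ d] det_transpose[of _ d])
  have dA: "det A = of_real (det (form_mat w))" by (simp add: A_def of_real_hom.hom_det)
  have dC: "det C = cnj (det (emb w))"
  proof -
    have "det C = (\<Sum>p | p permutes {0..<d}. of_int (sign p) * (\<Prod>i = 0..<d. cnj (emb w $$ (i, p i))))"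
      unfolding det_def'[OF C]
    proof (intro sum.cong refl arg_cong2[of _ _ _ _ "(*)"] prod.cong)
      fix p i assume "p \<in> {p. p permutes {0..<d}}" "i \<in> {0..<d}"
      then have "p i < d" "i < d" using permutes_in_image[of p "{0..<d}" i] by auto
      then show "C $$ (i, p i) = cnj (emb w $$ (i, p i))" by (simp add: C_def emb_def)
    qed
    then show ?thesis unfolding det_def'[OF emb_carrier[of w]] by simp
  qed
  have "complex_of_real ((det (form_mat w))\<^sup>2) = complex_of_real ((cmod (det (emb w)))\<^sup>2)"
    using eq unfolding dA dC by (simp add: power2_eq_square complex_norm_square[symmetric, unfolded power2_eq_square])
  then have "(det (form_mat w))\<^sup>2 = (cmod (det (emb w)))\<^sup>2" by (simp only: of_real_eq_iff)
  then have "\<bar>det (form_mat w)\<bar>\<^sup>2 = (cmod (det (emb w)))\<^sup>2" by simp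
  then show ?thesis by (rule power2_eq_imp_eq) auto
qed

lemma form_linear:
  assumes "i < d" and w: "\<And>j. j < d \<Longrightarrow> w j \<in> L"
  shows "form i (\<Sum>j<d. of_int (c j) * w j) = (\<Sum>j<d. form_mat w $$ (i,j) * of_int (c j))"
proof -
  have eq: "\<sigma> i (\<Sum>j<d. of_int (c j) * w j) = (\<Sum>j<d. of_int (c j) * \<sigma> i (w j))"
    by (rule hom_int_comb[OF \<sigma>_hom[OF assms(1)] w])
  have rm: "form_mat w $$ (i,j) = form i (w j)" if "j < d" for j using assms(1) that by (simp add: form_mat_def)
  show ?thesis
    unfolding form_def[of i "\<Sum>j<d. of_int (c j) * w j"] eq
    using rm by (auto simp: form_def sum_distrib_left mult_ac intro!: sum.cong)
qed


lemma disc_ge_1: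
  assumes w: "ibasis w" "det (emb w) \<noteq> 0"
  shows "cmod (det (emb w)) \<ge> 1"
proof -
  obtain k where k: "(det (emb w))\<^sup>2 = of_int k"
    using disc_int[of w] w(1) by (auto simp: ibasis_def elim: Ints_cases)
  then have "k \<noteq> 0" using w(2) by auto
  have "(cmod (det (emb w)))\<^sup>2 = real_of_int \<bar>k\<bar>"
    unfolding norm_power[symmetric] k by simp
  also have "\<dots> \<ge> 1\<^sup>2" unfolding power_one using \<open>k \<noteq> 0\<close> by linarith
  finally show ?thesis by (rule power2_le_imp_le) simp
qed

theorem small_generator:
  assumes w: "ibasis w" "det (emb w) \<noteq> 0"
  defines "D \<equiv> cmod (det (emb w))"
  shows "\<exists>y\<in>OL. inj_on (\<lambda>i. \<sigma> i y) {..<d} \<and> (\<forall>i<d. cmod (\<sigma> i y) \<le> 2 * D)"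
proof -
  have D1: "D \<ge> 1" unfolding D_def by (rule disc_ge_1[OF w])
  have wO: "w j \<in> OL" if "j < d" for j using w(1) that by (simp add: ibasis_def)
  have wL: "w j \<in> L" if "j < d" for j using OL_in[OF wO[OF that]] .
  \<comment> \<open>The larger index of a conjugate pair, or a real one: at a complex place the long
    side of the box then belongs to the imaginary part.\<close>
  obtain i0 where i0: "i0 < d" "cnj_ix i0 \<le> i0"
    by (metis cnj_ix(1) cnj_ix_cnj_ix d_pos nat_le_linear)
  define t where "t = 1 - 1 / (2 * real d)"
  have t: "1 / 2 \<le> t" "t < 1" "0 < t" using d_pos by (auto simp: t_def field_simps)
  \<comment> \<open>Bernoulli's inequality bounds the power below by 1 - (d-1)/(2d), which exceeds
    1/2.\<close>
  have tp: "t ^ (d - 1) > 1 / 2"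
  proof -
    have "1 / 2 < 1 + real (d - 1) * (- (1 / (2 * real d)))" using d_pos by (simp add: field_simps of_nat_diff)
    also have "\<dots> \<le> (1 + (- (1 / (2 * real d)))) ^ (d - 1)"
      using d_pos by (intro Bernoulli_inequality) (simp add: field_simps)
    finally show ?thesis by (simp add: t_def)
  qed
  define c where "c i = (if i = i0 then 2 * D else t)" for i
  have "(\<Prod>i<d. c i) = 2 * D * (\<Prod>i\<in>{..<d} - {i0}. c i)" using i0 by (subst prod.remove[of _ i0]) (auto simp: c_def)
  also have "(\<Prod>i\<in>{..<d} - {i0}. c i) = (\<Prod>i\<in>{..<d} - {i0}. t)" by (intro prod.cong) (auto simp: c_def)
  also have "\<dots> = t ^ (d - 1)" using i0 by simp
  finally have "(\<Prod>i<d. c i) = 2 * D * t ^ (d - 1)" .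
  also have "\<dots> > D" using tp D1 mult_strict_left_mono[OF tp, of "2 * D"] by simp
  finally have cD: "(\<Prod>i<d. c i) > \<bar>det (form_mat w)\<bar>" by (simp add: det_form_mat D_def)
  have "det (form_mat w) \<noteq> 0" using det_form_mat[of w] w(2) by auto
  moreover have "c i > 0" for i using D1 t by (simp add: c_def)
  ultimately obtain x :: "nat \<Rightarrow> int" where x: "\<exists>i<d. x i \<noteq> 0"
    "\<And>i. i < d \<Longrightarrow> \<bar>\<Sum>j<d. form_mat w $$ (i,j) * of_int (x j)\<bar> \<le> c i"
    using minkowski_linear_forms[of "form_mat w" d c] cD by (auto simp: form_mat_def)
  define y where "y = (\<Sum>j<d. of_int (x j) * w j)"
  have y: "y \<in> OL" unfolding y_def by (intro OL_sum OL_mult OL_int wO) auto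
  have y0: "y \<noteq> 0"
  proof
    assume "y = 0"
    then have "(\<Sum>j<d. of_int (x j) * w j) = (\<Sum>j<d. of_int 0 * w j)" by (simp add: y_def)
    then have "\<forall>j<d. x j = 0" using int_coords_unique[OF wL w(2), where c = x and c' = "\<lambda>_. 0"] by auto
    then show False using x(1) by auto
  qed
  have rb: "\<bar>form i y\<bar> \<le> c i" if "i < d" for i
    using x(2)[OF that] form_linear[OF that wL, where c = x] by (simp add: y_def)
  \<comment> \<open>Both forms of the pair are scaled by \<open>sqrt 2\<close>, so bounding each by
    b bounds the modulus by b without a further factor.\<close>
  have sq: "cmod (\<sigma> i y) \<le> b" if i: "i < d" and b: "0 \<le> b"
      and "cnj_ix i \<noteq> i" "\<bar>form i y\<bar> \<le> b" "\<bar>form (cnj_ix i) y\<bar> \<le> b" for i b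
  proof -
    have "sqrt 2 * \<bar>Re (\<sigma> i y)\<bar> \<le> b" "sqrt 2 * \<bar>Im (\<sigma> i y)\<bar> \<le> b"
      using form_complex(1)[OF i that(3), of y] that(4,5) by (auto simp: doubleton_eq_iff)
    then have "(sqrt 2 * \<bar>Re (\<sigma> i y)\<bar>)\<^sup>2 \<le> b\<^sup>2" "(sqrt 2 * \<bar>Im (\<sigma> i y)\<bar>)\<^sup>2 \<le> b\<^sup>2"
      by (intro power_mono; simp)+
    then have "(cmod (\<sigma> i y))\<^sup>2 \<le> b\<^sup>2" by (simp add: cmod_power2 power_mult_distrib)
    then show ?thesis using b by (rule power2_le_imp_le)
  qed
  have cb: "c i \<le> 2 * D" for i using D1 t by (simp add: c_def)
  have bnd: "cmod (\<sigma> i y) \<le> 2 * D" if i: "i < d" for i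
  proof (cases "cnj_ix i = i")
    case True
    then show ?thesis using form_real[OF i True, of y] rb[OF i] cb[of i] by simp
  next
    case False
    show ?thesis using rb[OF i] rb[OF cnj_ix(1)[OF i]] cb[of i] cb[of "cnj_ix i"] D1
      by (intro sq[OF i _ False]) auto
  qed
  have small: "cmod (\<sigma> i y) < 1" if i: "i < d" and ne: "i \<noteq> i0" "i \<noteq> cnj_ix i0" for i
  proof -
    have ne': "cnj_ix i \<noteq> i0" using cnj_ix_cnj_ix[OF i] ne(2) by auto
    have "cmod (\<sigma> i y) \<le> t"
    proof (cases "cnj_ix i = i")
      case True
      then show ?thesis using form_real[OF i True, of y] rb[OF i] ne by (simp add: c_def)
    next
      case False
      show ?thesis using rb[OF i] rb[OF cnj_ix(1)[OF i]] ne ne' t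
        by (intro sq[OF i _ False]) (auto simp: c_def)
    qed
    then show ?thesis using t by simp
  qed
  have big: "cmod (\<sigma> i0 y) \<ge> 1"
  proof (rule ccontr)
    assume lt: "\<not> ?thesis"
    have lt1: "cmod (\<sigma> i y) < 1" if "i < d" for i
    proof (cases "i = i0 \<or> i = cnj_ix i0")
      case True
      then show ?thesis using lt cnj_ix(2)[OF i0(1), of y] by auto
    next
      case False
      then show ?thesis using small[OF that] by auto
    qed
    have "(\<Prod>i<d. cmod (\<sigma> i y)) < 1"
    proof -
      have "(\<Prod>i<d. cmod (\<sigma> i y)) = cmod (\<sigma> i0 y) * (\<Prod>i\<in>{..<d} - {i0}. cmod (\<sigma> i y))"
        using i0 by (subst prod.remove[of _ i0]) auto
      also have "\<dots> \<le> cmod (\<sigma> i0 y) * 1"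
        by (intro mult_left_mono prod_le_1) (auto intro: less_imp_le lt1)
      also have "\<dots> < 1" using lt1[OF i0(1)] by simp
      finally show ?thesis .
    qed
    then show False using norm_ge_1[OF w y y0] by simp
  qed
  have "\<sigma> j y \<noteq> \<sigma> i0 y" if j: "j < d" "j \<noteq> i0" for j
  proof (cases "j = cnj_ix i0")
    case True
    \<comment> \<open>Here the conjugate index has the short side \<open>t\<close> and carries the
      real part. Were \<open>\<sigma> i0 y\<close> real, its modulus would be at most t / sqrt 2,
      below 1, contradicting \<open>big\<close>.\<close>
    then have lt: "cnj_ix i0 < i0" using i0 j by simp
    show ?thesis
    proof
      assume eq: "\<sigma> j y = \<sigma> i0 y"
      then have "cnj (\<sigma> i0 y) = \<sigma> i0 y" using cnj_ix(2)[OF i0(1), of y] True by simp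
      then have im: "Im (\<sigma> i0 y) = 0" by (simp add: complex_eq_iff)
      have "form (cnj_ix i0) y = sqrt 2 * Re (\<sigma> i0 y)"
        using lt cnj_ix_cnj_ix[OF i0(1)] cnj_ix(2)[OF i0(1), of y] by (simp add: form_def)
      moreover have "\<bar>form (cnj_ix i0) y\<bar> \<le> t" using rb[OF cnj_ix(1)[OF i0(1)]] lt by (simp add: c_def)
      ultimately have "sqrt 2 * \<bar>Re (\<sigma> i0 y)\<bar> \<le> t" by (simp add: abs_mult)
      moreover have "\<bar>Re (\<sigma> i0 y)\<bar> = cmod (\<sigma> i0 y)" using im by (simp add: cmod_eq_Re)
      moreover have "1 * cmod (\<sigma> i0 y) \<le> sqrt 2 * cmod (\<sigma> i0 y)" by (intro mult_right_mono) auto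
      ultimately show False using big t by simp
    qed
  next
    case False
    then show ?thesis using small[OF j(1,2)] big by auto
  qed
  then have "inj_on (\<lambda>i. \<sigma> i y) {..<d}" by (rule all_distinct_if_one[OF w y i0(1)])
  then show ?thesis using y bnd by blast
qed

theorem small_generator_nonzero_coeffs:
  assumes w: "ibasis w" "det (emb w) \<noteq> 0"
  defines "B \<equiv> real d * (real d ^ 2 - real d + 2) / 2 * cmod (det (emb w))"
  shows "\<exists>y\<in>OL. \<exists>f::int poly. lead_coeff f = 1 \<and> degree f = d \<and>
    of_int_poly f = (\<Prod>i<d. [:- \<sigma> i y, 1:]) \<and>
    (\<forall>k\<le>degree f. coeff f k \<noteq> 0) \<and> inj_on (\<lambda>i. \<sigma> i y) {..<d} \<and> (\<forall>i<d. cmod (\<sigma> i y) \<le> B)"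
proof (cases "d = 1")
  case True
  \<comment> \<open>For d = 1 the bound is \<open>cmod (det (emb w))\<close> itself, which leaves no
    room for the factor 2 and a shift.\<close>
  have "B \<ge> 1" using disc_ge_1[OF w] True by (simp add: B_def)
  moreover have "1 \<in> OL" using OL_int[of 1] by simp
  moreover have "\<sigma> 0 1 = 1" using hom_one[OF \<sigma>_hom[of 0]] True by simp
  moreover have "coeff [:-1, 1::int:] k \<noteq> 0" if "k \<le> 1" for k
    using that by (cases k) auto
  ultimately show ?thesis using True
    by (intro bexI[of _ 1] exI[of _ "[:-1, 1:]"]) (auto simp: lessThan_Suc)
next
  case False
  then have d2: "d \<ge> 2" using d_pos by simp
  define D where "D = cmod (det (emb w))"
  have D1: "D \<ge> 1" unfolding D_def by (rule disc_ge_1[OF w])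
  obtain y where y: "y \<in> OL" "inj_on (\<lambda>i. \<sigma> i y) {..<d}" "\<And>i. i < d \<Longrightarrow> cmod (\<sigma> i y) \<le> 2 * D"
    using small_generator[OF w] by (auto simp: D_def)
  obtain f where f: "lead_coeff f = 1" "degree f = d" "of_int_poly f = (\<Prod>i<d. [:- \<sigma> i y, 1:])"
    using char_poly_element[OF w y(1)] by blast
  \<comment> \<open>This is d(d+1)/4 rounded up, so that the 2m + 1 shifts outnumber the d(d+1)/2
    bad ones.\<close>
  define m where "m = (d * (d + 1) div 2 + 1) div 2"
  have "degree f * (degree f + 1) div 2 < 2 * m + 1" unfolding f(2) m_def by linarith
  from shift_nonzero_coeffs[OF f(1) this] obtain n :: int where n: "\<bar>n\<bar> \<le> int m"
    "\<And>k. k \<le> d \<Longrightarrow> coeff (f \<circ>\<^sub>p [:- n, 1:]) k \<noteq> 0" by (auto simp: f(2))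
  define g where "g = f \<circ>\<^sub>p [:- n, 1:]"
  define z where "z = y + of_int n"
  have z: "z \<in> OL" unfolding z_def by (intro OL_add y(1) OL_int)
  have sz: "\<sigma> i z = \<sigma> i y + of_int n" if "i < d" for i
    unfolding z_def using additive_add[OF hom_additive[OF \<sigma>_hom[OF that]] OL_in[OF y(1)] of_int_in]
    by (simp add: hom_int[OF \<sigma>_hom[OF that]])
  have g1: "lead_coeff g = 1" unfolding g_def using f(1) by (subst lead_coeff_comp) auto
  have g2: "degree g = d" by (simp add: g_def f(2))
  have "of_int_poly g = of_int_poly f \<circ>\<^sub>p [:- complex_of_int n, 1:]"
    unfolding g_def by (simp add: of_int_hom.map_poly_pcompose)
  also have "\<dots> = (\<Prod>i<d. [:- \<sigma> i z, 1:])" unfolding f(3) pcompose_prod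
    by (intro prod.cong) (auto simp: sz pcompose_pCons)
  finally have g3: "of_int_poly g = (\<Prod>i<d. [:- \<sigma> i z, 1:])" .
  have inj: "inj_on (\<lambda>i. \<sigma> i z) {..<d}" using y(2) by (auto simp: inj_on_def sz)
  have "cmod (\<sigma> i z) \<le> B" if i: "i < d" for i
  proof -
    have "cmod (\<sigma> i z) \<le> cmod (\<sigma> i y) + cmod (of_int n)" unfolding sz[OF i] by (rule norm_triangle_ineq)
    also have "\<dots> \<le> 2 * D + real m" using y(3)[OF i] n(1) by simp
    also have "\<dots> \<le> 2 * D + real m * D" using D1 by (simp add: mult_left_le_one_le mult_le_cancel_left1)
    also have "\<dots> = (2 + real m) * D" by (simp add: algebra_simps)
    also have "\<dots> \<le> real d * (real d ^ 2 - real d + 2) / 2 * D"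
    proof (rule mult_right_mono)
      have "4 * m \<le> d * (d + 1) + 2" unfolding m_def by linarith
      then have "real (4 * m) \<le> real (d * (d + 1) + 2)" by (simp only: of_nat_le_iff)
      then have m4: "4 * real m \<le> real d * (real d + 1) + 2" by (simp add: algebra_simps)
      \<comment> \<open>In terms of u = d - 2 the difference of the two sides is a polynomial with
        nonnegative coefficients.\<close>
      define u where "u = real d - 2"
      have u: "u \<ge> 0" "real d = u + 2" using d2 by (auto simp: u_def)
      have "real d * (real d ^ 2 - real d + 2) / 2 - (2 + (real d * (real d + 1) + 2) / 4)
          = u * u * u / 2 + 9 * (u * u) / 4 + 15 * u / 4"
        unfolding u(2) by (simp add: power2_eq_square field_simps)
      moreover have "0 \<le> u * u * u / 2 + 9 * (u * u) / 4 + 15 * u / 4" using u(1) by (intro add_nonneg_nonneg) auto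
      ultimately have "2 + (real d * (real d + 1) + 2) / 4 \<le> real d * (real d ^ 2 - real d + 2) / 2"
        by (metis diff_ge_0_iff_ge)
      moreover have "2 + real m \<le> 2 + (real d * (real d + 1) + 2) / 4" using m4 by simp
      ultimately show "2 + real m \<le> real d * (real d ^ 2 - real d + 2) / 2" by (rule order_trans[rotated])
    qed (use D1 in simp)
    finally show ?thesis by (simp add: B_def D_def)
  qed
  then show ?thesis using z g1 g2 g3 n(2) inj unfolding g_def[symmetric]
    by (intro bexI[of _ z] exI[of _ g]) auto
qed

section \<open>Minimal polynomial and Mahler measure of a generator\<close>

lemma poly_zero_if_conjugate_roots:
  assumes inj: "inj_on (\<lambda>i. \<sigma> i y) {..<d}" and p: "degree p < d" "\<And>i. i < d \<Longrightarrow> poly p (\<sigma> i y) = 0"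
  shows "p = 0"
proof (rule ccontr)
  assume p0: "p \<noteq> 0"
  have "d = card ((\<lambda>i. \<sigma> i y) ` {..<d})" by (simp add: card_image[OF inj])
  also have "\<dots> \<le> card {x. poly p x = 0}" by (intro card_mono poly_roots_finite[OF p0]) (auto simp: p(2))
  also have "\<dots> \<le> degree p" by (rule poly_roots_degree[OF p0])
  finally show False using p(1) by simp
qed

text \<open>A rational polynomial vanishing at \<open>y\<close> vanishes at all d distinct
  conjugates, so it is zero or has degree at least d. Division with remainder gives the
  divisibility; in a factorisation of \<open>f\<close> one factor takes the full degree, and the
  other is a constant with leading coefficient 1 or -1.\<close>

lemma minimal_int_poly:
  assumes y: "y \<in> L" "inj_on (\<lambda>i. \<sigma> i y) {..<d}" and f: "of_int_poly f = (\<Prod>i<d. [:- \<sigma> i y, 1:])" "degree f = d"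
    "lead_coeff f = 1"
  shows "irreducible f"
    "\<And>g. poly (map_poly of_rat g) y = 0 \<longleftrightarrow> map_poly rat_of_int f dvd g"
proof -
  interpret of_rat_poly: map_poly_inj_idom_hom "of_rat :: rat \<Rightarrow> complex" ..
  have roots: "poly (map_poly complex_of_rat g) (\<sigma> i y) = 0" if "poly (map_poly of_rat g) y = 0" "i < d" for g i
    using hom_poly_rat(2)[OF \<sigma>_hom[OF that(2)] y(1), of g] that additive_zero[OF hom_additive[OF \<sigma>_hom[OF that(2)]]]
      by simp
  have small0: "g = 0" if g: "poly (map_poly of_rat g) y = 0" "degree g < d" for g :: "rat poly"
    using poly_zero_if_conjugate_roots[OF y(2), of "map_poly of_rat g"] roots[OF g(1)] g(2) by simp
  have rf: "map_poly complex_of_rat (map_poly rat_of_int f) = of_int_poly f" for f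
    by (simp add: map_poly_map_poly o_def)
  have fy: "poly (of_int_poly f) y = 0"
  proof -
    have "poly (of_int_poly f) (\<sigma> 0 y) = 0"
      unfolding f(1) poly_prod using d_pos by (auto intro!: prod_zero bexI[of _ 0])
    then have "\<sigma> 0 (poly (of_int_poly f) y) = 0" using hom_poly_int[OF \<sigma>_hom[OF d_pos] y(1)] by simp
    moreover have "poly (of_int_poly f) y \<in> L"
      using hom_poly_rat(1)[OF \<sigma>_hom[OF d_pos] y(1), of "map_poly rat_of_int f"] by (simp add: rf)
    ultimately show ?thesis using hom_nonzero[OF \<sigma>_hom[OF d_pos]] by blast
  qed
  define F where "F = map_poly rat_of_int f"
  have F: "degree F = d" "F \<noteq> 0" "poly (map_poly complex_of_rat F) y = 0" using f fy d_pos by (auto simp: F_def rf)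
  show dvd: "poly (map_poly of_rat g) y = 0 \<longleftrightarrow> map_poly rat_of_int f dvd g" for g
  proof
    assume g: "poly (map_poly of_rat g) y = 0"
    have "map_poly complex_of_rat g = map_poly of_rat (F * (g div F)) + map_poly of_rat (g mod F)"
      by (simp flip: of_rat_poly.hom_add)
    then have "poly (map_poly of_rat (g mod F)) y = 0" using g F(3) by (simp add: of_rat_poly.hom_mult)
    moreover have "degree (g mod F) < d" using degree_mod_less[OF F(2), of g] F(1) d_pos by auto
    ultimately have "g mod F = 0" by (rule small0)
    then show "map_poly rat_of_int f dvd g" by (auto simp: F_def[symmetric] mod_eq_0_iff_dvd)
  next
    assume "map_poly rat_of_int f dvd g"
    then obtain h where "g = F * h" by (auto simp: F_def)
    then show "poly (map_poly of_rat g) y = 0" using F(3) by (simp add: of_rat_poly.hom_mult)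
  qed
  show "irreducible f"
  proof (rule irreducibleI)
    show "f \<noteq> 0" using f(3) by auto
    show "\<not> f dvd 1" using f(2) d_pos by (auto simp: poly_dvd_1)
    fix a b assume ab: "f = a * b"
    have "lead_coeff a * lead_coeff b = 1" using f(3) unfolding ab lead_coeff_mult .
    then have lc: "\<bar>lead_coeff a\<bar> = 1" "\<bar>lead_coeff b\<bar> = 1"
      using abs_zmult_eq_1[of "lead_coeff a" "lead_coeff b"] abs_zmult_eq_1[of "lead_coeff b" "lead_coeff a"]
        by (auto simp: mult.commute)
    have nz: "a \<noteq> 0" "b \<noteq> 0" using lc by auto
    have deg: "degree a + degree b = d" using f(2) ab nz by (simp add: degree_mult_eq)
    have unit: "q dvd 1" if "\<bar>lead_coeff q\<bar> = 1" "degree q = 0" for q :: "int poly"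
    proof -
      obtain k where k: "q = [:k:]" using \<open>degree q = 0\<close> by (auto elim: degree_eq_zeroE)
      then have "k dvd 1" using that(1) by simp
      then show ?thesis unfolding k by (simp add: const_poly_dvd_1)
    qed
    have full: "degree q \<ge> d" if "poly (of_int_poly q) y = 0" "q \<noteq> 0" for q
      using small0[of "map_poly rat_of_int q"] that by (force simp: rf)
    have "poly (of_int_poly a) y * poly (of_int_poly b) y = 0"
      using fy unfolding ab by (simp add: of_int_poly_hom.hom_mult)
    then have "degree a \<ge> d \<or> degree b \<ge> d" using full nz by auto
    then show "a dvd 1 \<or> b dvd 1" using deg unit lc by auto
  qed
qed

text \<open>Vandermonde: a kernel vector of the embedding matrix of 1, y, ..., y^(d-1) is the
  coefficient vector of a polynomial of degree below d with d roots. Hence every element has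
  rational coordinates in the powers of \<open>y\<close>.\<close>

lemma generator_surj:
  assumes y: "y \<in> L" "inj_on (\<lambda>i. \<sigma> i y) {..<d}" and x: "x \<in> L"
  obtains g :: "rat poly" where "x = poly (map_poly of_rat g) y"
proof -
  have det: "det (emb (\<lambda>j. y ^ j)) \<noteq> 0"
  proof
    assume "det (emb (\<lambda>j. y ^ j)) = 0"
    then obtain v where v: "v \<in> carrier_vec d" "v \<noteq> 0\<^sub>v d" "emb (\<lambda>j. y ^ j) *\<^sub>v v = 0\<^sub>v d"
      using det_0_iff_vec_prod_zero[OF emb_carrier] by blast
    define p where "p = (\<Sum>j<d. monom (v $ j) j)"
    have cp: "coeff p j = (if j < d then v $ j else 0)" for j by (auto simp: p_def coeff_sum coeff_monom)
    have "degree p < d" by (rule degree_lessI) (use d_pos in \<open>auto simp: cp\<close>)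
    have r: "poly p (\<sigma> i y) = 0" if i: "i < d" for i
    proof -
      have "0 = (emb (\<lambda>j. y ^ j) *\<^sub>v v) $ i" using v(3) i by simp
      also have "\<dots> = (\<Sum>j<d. v $ j * \<sigma> i y ^ j)"
        using i v(1)
          by (auto simp: emb_def scalar_prod_def atLeast0LessThan hom_power[OF \<sigma>_hom[OF i] y(1)] mult.commute intro!: sum.cong)
      finally show ?thesis by (simp add: p_def poly_sum poly_monom)
    qed
    have "p = 0" by (rule poly_zero_if_conjugate_roots[OF y(2) \<open>degree p < d\<close> r])
    then have "v $ j = 0" if "j < d" for j using cp[of j] that by simp
    then have "v = 0\<^sub>v d" using v(1) by (intro eq_vecI) auto
    then show False using v(2) by simp
  qed
  obtain q :: "nat \<Rightarrow> rat" where q: "x = (\<Sum>j<d. of_rat (q j) * y ^ j)"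
    using cramer_coords[OF _ det x] power_in[OF y(1)] by blast
  define g where "g = (\<Sum>j<d. monom (q j) j)"
  interpret of_rat_poly: map_poly_inj_idom_hom "of_rat :: rat \<Rightarrow> complex" ..
  have "poly (map_poly of_rat g) y = x"
    by (simp add: g_def of_rat_poly.hom_sum poly_sum map_poly_monom poly_monom q)
  then show ?thesis using that by blast
qed

lemma mahler_le:
  assumes f: "of_int_poly f = (\<Prod>i<d. [:- \<sigma> i y, 1:])" "degree f = d" "lead_coeff f = 1"
    and B: "\<And>i. i < d \<Longrightarrow> cmod (\<sigma> i y) \<le> B" "B \<ge> 1"
  shows "mahler_measure_monic (of_int_poly f) \<le> B ^ d"
proof -
  define as where "as = complex_roots_complex (of_int_poly f)"
  have len: "length as = d" by (simp add: as_def f(2))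
  have eq: "(\<Prod>a\<leftarrow>as. [:- a, 1:]) = of_int_poly f"
    using complex_roots(1)[of "of_int_poly f"] f(3) by (simp add: as_def)
  have "cmod a \<le> B" if "a \<in> set as" for a
  proof -
    have "poly (\<Prod>a\<leftarrow>as. [:- a, 1:]) a = 0" using that by (auto simp: poly_prod_list prod_list_zero_iff)
    then have "(\<Prod>i<d. poly [:- \<sigma> i y, 1:] a) = 0" unfolding eq f(1) poly_prod .
    then obtain i where "i < d" "a = \<sigma> i y" by (auto simp: prod_zero_iff)
    then show ?thesis using B(1) by simp
  qed
  then have "(\<Prod>a\<leftarrow>as. max 1 (cmod a)) \<le> B ^ length as"
  proof (induction as)
    case (Cons a as)
    have "max 1 (cmod a) * (\<Prod>a\<leftarrow>as. max 1 (cmod a)) \<le> B * B ^ length as"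
      using Cons B(2) by (intro mult_mono) (auto intro!: prod_list_nonneg)
    then show ?case by simp
  qed simp
  then show ?thesis by (simp add: mahler_measure_monic_def as_def[symmetric] len)
qed

end

section \<open>Embedding an abstract number field into the complex numbers\<close>

lemma seq_eval_add: "seq_eval (p + q) a = seq_eval p a + seq_eval q a"
proof -
  define n where "n = max (degree p) (degree q) + 1"
  have "degree (p + q) < n" "degree p < n" "degree q < n"
    using degree_add_le_max[of p q] by (auto simp: n_def)
  then show ?thesis by (simp add: seq_eval_altdef[of _ n] sum.distrib distrib_right)
qed

lemma seq_eval_monom: "seq_eval (Polynomial.monom c n) a = c * a n"
  by (subst seq_eval_altdef[of _ "Suc n"])
    (auto simp: less_Suc_eq_le degree_monom_le coeff_monom)

locale char0_finite_field = Ring.field K for K (structure) +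
  fixes Vs :: "'a list"
  assumes char0: "\<And>n::nat. n > 0 \<Longrightarrow> [n] \<cdot> \<one> \<noteq> \<zero>"
    and indep: "independent (prime_subfield K) Vs"
    and span: "Span (prime_subfield K) Vs = carrier K"
begin

abbreviation F where "F \<equiv> prime_subfield K"

lemma F_subfield: "subfield F K"
  unfolding prime_subfield_def by (rule generate_field_is_subfield) simp

lemma F_carrier: "k \<in> F \<Longrightarrow> k \<in> carrier K"
  using subringE(1)[OF subfieldE(1)[OF F_subfield]] by auto

lemma Vs_carrier: "set Vs \<subseteq> carrier K"
  by (rule independent_in_carrier[OF indep])

section \<open>The prime subfield as a copy of the rationals\<close>

definition ofi :: "int \<Rightarrow> 'a" where "ofi n = [n] \<cdot> \<one>"

lemma ofi_closed [simp]: "ofi n \<in> carrier K"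
  unfolding ofi_def by (rule add.int_pow_closed) simp

lemma ofi_mult_eq: "x \<in> carrier K \<Longrightarrow> ofi n \<otimes> x = [n] \<cdot> x"
  unfolding ofi_def using add_pow_ldistr_int[of \<one> x n] by simp

lemma ofi_add: "ofi (a + b) = ofi a \<oplus> ofi b"
  unfolding ofi_def by (simp add: add.int_pow_mult)

lemma ofi_mult: "ofi (a * b) = ofi a \<otimes> ofi b"
proof -
  have "ofi a \<otimes> ofi b = [a] \<cdot> ([b] \<cdot> \<one>)" by (simp add: ofi_mult_eq) (simp add: ofi_def)
  also have "\<dots> = [(a * b)] \<cdot> \<one>" by (simp add: add.int_pow_pow mult.commute)
  finally show ?thesis by (simp add: ofi_def)
qed

lemma ofi_1 [simp]: "ofi 1 = \<one>"
  unfolding ofi_def by simp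

lemma ofi_0 [simp]: "ofi 0 = \<zero>"
  using add_pow_int_ge[of 0 K \<one>] by (simp add: ofi_def)

lemma ofi_minus: "ofi (- a) = \<ominus> ofi a"
  using ofi_add[of a "- a"] by (metis add.int_pow_neg ofi_def one_closed)

lemma ofi_nonzero: "n \<noteq> 0 \<Longrightarrow> ofi n \<noteq> \<zero>"
proof -
  assume n: "n \<noteq> 0"
  have pos: "ofi m \<noteq> \<zero>" if "m > 0" for m
    using char0[of "nat m"] that by (simp add: ofi_def add_pow_int_ge)
  show ?thesis
  proof (cases "n > 0")
    case False
    then have "ofi (- n) \<noteq> \<zero>" using n by (intro pos) simp
    then show ?thesis by (auto simp: ofi_minus)
  qed (use pos in simp)
qed

lemma ofi_in_F: "ofi n \<in> F"
proof -
  have nat: "ofi (int m) \<in> F" for m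
  proof (induction m)
    case 0
    then show ?case using subringE(2)[OF subfieldE(1)[OF F_subfield]] by simp
  next
    case (Suc m)
    then show ?case using subringE(3,7)[OF subfieldE(1)[OF F_subfield]] ofi_add[of 1 "int m"] by simp
  qed
  show ?thesis
  proof (cases "n \<ge> 0")
    case True
    then show ?thesis using nat[of "nat n"] by simp
  next
    case False
    then show ?thesis using nat[of "nat (- n)"] subringE(5)[OF subfieldE(1)[OF F_subfield]] ofi_minus[of "- n"]
      by fastforce
  qed
qed

text \<open>The isomorphism from the prime subfield to the rationals, as a relation in which
  denominators are cleared. This form passes directly through the inductive generation of the prime
  subfield.\<close>

definition ratval :: "'a \<Rightarrow> rat \<Rightarrow> bool" where
  "ratval k q \<longleftrightarrow> k \<in> carrier K \<and> (\<exists>a b. b \<noteq> 0 \<and> q = of_int a / of_int b \<and> ofi b \<otimes> k = ofi a)"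

lemma ratval_add: assumes "ratval k q" "ratval k' q'" shows "ratval (k \<oplus> k') (q + q')"
proof -
  obtain a b a' b' where *: "b \<noteq> 0" "q = of_int a / of_int b" "ofi b \<otimes> k = ofi a"
    "b' \<noteq> 0" "q' = of_int a' / of_int b'" "ofi b' \<otimes> k' = ofi a'" and [simp]: "k \<in> carrier K" "k' \<in> carrier K"
    using assms by (auto simp: ratval_def)
  have "ofi (b * b') \<otimes> (k \<oplus> k') = ofi b' \<otimes> (ofi b \<otimes> k) \<oplus> ofi b \<otimes> (ofi b' \<otimes> k')"
    by (simp add: ofi_mult r_distr m_ac)
  also have "\<dots> = ofi (b' * a + b * a')" by (simp add: * ofi_mult ofi_add)
  finally show ?thesis unfolding ratval_def using *
    by (intro conjI exI[of _ "b' * a + b * a'"] exI[of _ "b * b'"]) (auto simp: field_simps)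
qed

lemma ratval_mult: assumes "ratval k q" "ratval k' q'" shows "ratval (k \<otimes> k') (q * q')"
proof -
  obtain a b a' b' where *: "b \<noteq> 0" "q = of_int a / of_int b" "ofi b \<otimes> k = ofi a"
    "b' \<noteq> 0" "q' = of_int a' / of_int b'" "ofi b' \<otimes> k' = ofi a'" and [simp]: "k \<in> carrier K" "k' \<in> carrier K"
    using assms by (auto simp: ratval_def)
  have "ofi (b * b') \<otimes> (k \<otimes> k') = (ofi b \<otimes> k) \<otimes> (ofi b' \<otimes> k')"
    by (simp add: ofi_mult m_ac)
  also have "\<dots> = ofi (a * a')" by (simp add: * ofi_mult)
  finally show ?thesis unfolding ratval_def using *
    by (intro conjI exI[of _ "a * a'"] exI[of _ "b * b'"]) auto
qed

lemma ratval_ofi: "ratval (ofi n) (of_int n)"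
  unfolding ratval_def by (intro conjI exI[of _ n] exI[of _ 1]) auto

lemma ratval_inv: assumes "ratval k q" "k \<noteq> \<zero>" shows "ratval (inv k) (inverse q)"
proof -
  from assms obtain a b where *: "b \<noteq> 0" "q = of_int a / of_int b" "ofi b \<otimes> k = ofi a" and [simp]: "k \<in> carrier K"
    by (auto simp: ratval_def)
  have a0: "a \<noteq> 0" using * assms(2) ofi_nonzero[of b] integral[of "ofi b" k] by auto
  have iv: "inv k \<in> carrier K" "k \<otimes> inv k = \<one>" using assms(2) field_Units by auto
  have "ofi a \<otimes> inv k = ofi b \<otimes> (k \<otimes> inv k)" unfolding *(3)[symmetric] using iv(1) by (simp add: m_assoc)
  then have "ofi a \<otimes> inv k = ofi b" by (simp add: iv)
  then show ?thesis unfolding ratval_def using * a0 iv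
    by (intro conjI exI[of _ b] exI[of _ a]) auto
qed

lemma ratval_F: "k \<in> F \<Longrightarrow> \<exists>q. ratval k q"
  unfolding prime_subfield_def
proof (induction rule: generate_field.induct)
  case one
  then show ?case using ratval_ofi[of 1] by auto
next
  case (a_inv h)
  then obtain q where q: "ratval h q" by blast
  have "ratval (ofi (-1) \<otimes> h) (of_int (-1) * q)" by (rule ratval_mult[OF ratval_ofi q])
  moreover have "ofi (-1) \<otimes> h = \<ominus> h" using q by (simp add: ofi_minus l_minus ratval_def)
  ultimately show ?case by auto
qed (auto intro: ratval_inv ratval_add ratval_mult)

lemma ratval_unique: assumes "ratval k q" "ratval k q'" shows "q = q'"
proof -
  from assms obtain a b a' b' where *: "b \<noteq> 0" "q = of_int a / of_int b" "ofi b \<otimes> k = ofi a"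
    "b' \<noteq> 0" "q' = of_int a' / of_int b'" "ofi b' \<otimes> k = ofi a'" and [simp]: "k \<in> carrier K"
    by (auto simp: ratval_def)
  have "ofi (b' * a) = ofi (b * a')"
    unfolding ofi_mult *(3)[symmetric] *(6)[symmetric] by (simp add: m_ac)
  then have "ofi (b' * a + (- (b * a'))) = \<zero>" unfolding ofi_add ofi_minus by (simp add: r_neg)
  then have "b' * a = b * a'" using ofi_nonzero[of "b' * a - b * a'"] by auto
  then have "of_int b' * of_int a = (of_int b * of_int a' :: rat)" by (metis of_int_mult)
  then show ?thesis unfolding *(2,5) using *(1,4) by (simp add: frac_eq_eq mult.commute)
qed

definition rv :: "'a \<Rightarrow> rat" where "rv k = (THE q. ratval k q)"

lemma ratval_rv: "k \<in> F \<Longrightarrow> ratval k (rv k)"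
  unfolding rv_def using ratval_F ratval_unique by (metis theI')

lemma rv_eqI: "ratval k q \<Longrightarrow> rv k = q"
  unfolding rv_def using ratval_unique by blast

lemma rv_add: "k \<in> F \<Longrightarrow> k' \<in> F \<Longrightarrow> rv (k \<oplus> k') = rv k + rv k'"
  by (intro rv_eqI ratval_add ratval_rv)

lemma rv_nonzero: "k \<in> F \<Longrightarrow> k \<noteq> \<zero> \<Longrightarrow> rv k \<noteq> 0"
proof
  assume k: "k \<in> F" "k \<noteq> \<zero>" "rv k = 0"
  then obtain a b where "b \<noteq> 0" "0 = (of_int a / of_int b :: rat)" "ofi b \<otimes> k = ofi a"
    using ratval_rv[OF k(1)] by (auto simp: ratval_def)
  then have "ofi b \<otimes> k = \<zero>" "b \<noteq> 0" by auto
  then show False using integral[of "ofi b" k] ofi_nonzero[of b] k F_carrier by auto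
qed

section \<open>Additive maps into the complex numbers and their common eigenvectors\<close>

definition addK :: "('a \<Rightarrow> complex) set" where
  "addK = {\<phi>. (\<forall>x\<in>carrier K. \<forall>y\<in>carrier K. \<phi> (x \<oplus> y) = \<phi> x + \<phi> y)}"

lemma addK_zero: assumes "\<phi> \<in> addK" shows "\<phi> \<zero> = 0"
proof -
  have "\<phi> (\<zero> \<oplus> \<zero>) = \<phi> \<zero> + \<phi> \<zero>" using assms unfolding addK_def by blast
  then show ?thesis by simp
qed

lemma addK_ofi: assumes \<phi>: "\<phi> \<in> addK" and x: "x \<in> carrier K" shows "\<phi> (ofi n \<otimes> x) = of_int n * \<phi> x"
proof -
  have add: "\<phi> (a \<oplus> b) = \<phi> a + \<phi> b" if "a \<in> carrier K" "b \<in> carrier K" for a b using \<phi> that by (simp add: addK_def)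
  have nat: "\<phi> (ofi (int m) \<otimes> x) = of_nat m * \<phi> x" for m
  proof (induction m)
    case 0
    then show ?case using x by (simp add: addK_zero[OF \<phi>])
  next
    case (Suc m)
    have "ofi (int (Suc m)) \<otimes> x = x \<oplus> ofi (int m) \<otimes> x" using x ofi_add[of 1 "int m"] by (simp add: l_distr)
    then show ?case using Suc x by (simp add: add algebra_simps)
  qed
  show ?thesis
  proof (cases "n \<ge> 0")
    case True
    then show ?thesis using nat[of "nat n"] by simp
  next
    case False
    have "ofi n \<otimes> x \<oplus> ofi (- n) \<otimes> x = (ofi n \<oplus> ofi (- n)) \<otimes> x" using x by (simp add: l_distr)
    also have "ofi n \<oplus> ofi (- n) = \<zero>" using ofi_add[of n "- n"] by simp
    finally have "\<phi> (ofi n \<otimes> x \<oplus> ofi (- n) \<otimes> x) = 0" using x by (simp add: addK_zero[OF \<phi>])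
    then have "\<phi> (ofi n \<otimes> x) + \<phi> (ofi (- n) \<otimes> x) = 0" using x add[of "ofi n \<otimes> x" "ofi (- n) \<otimes> x"] by simp
    then show ?thesis using nat[of "nat (- n)"] False by simp
  qed
qed

lemma addK_F: assumes \<phi>: "\<phi> \<in> addK" and k: "k \<in> F" and x: "x \<in> carrier K"
  shows "\<phi> (k \<otimes> x) = of_rat (rv k) * \<phi> x"
proof -
  obtain a b where ab: "b \<noteq> 0" "rv k = of_int a / of_int b" "ofi b \<otimes> k = ofi a"
    using ratval_rv[OF k] by (auto simp: ratval_def)
  have kc: "k \<in> carrier K" by (rule F_carrier[OF k])
  have "of_int b * \<phi> (k \<otimes> x) = \<phi> (ofi b \<otimes> (k \<otimes> x))" using kc x by (simp add: addK_ofi[OF \<phi>])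
  also have "ofi b \<otimes> (k \<otimes> x) = ofi a \<otimes> x" unfolding ab(3)[symmetric] using kc x by (simp add: m_assoc)
  also have "\<phi> \<dots> = of_int a * \<phi> x" using x by (simp add: addK_ofi[OF \<phi>])
  finally show ?thesis using ab(1) by (simp add: ab(2) of_rat_divide field_simps)
qed

text \<open>Starting point for the eigenvector search: the first coordinate with respect to
  \<open>Vs\<close>, read as a rational number, takes the value 1 at the first basis vector.\<close>

lemma addK_nonzero: "\<exists>\<phi>\<in>addK. \<exists>x\<in>carrier K. \<phi> x \<noteq> 0"
proof -
  have "Vs \<noteq> []"
  proof
    assume "Vs = []"
    moreover have "\<one> \<in> Span F Vs" unfolding span by (rule one_closed)
    ultimately show False by simp
  qed
  then obtain v Ws where Vs: "Vs = v # Ws" by (cases Vs) auto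
  have car: "v \<in> carrier K" "set Ws \<subseteq> carrier K" using Vs_carrier Vs by auto
  define D where "D x Ks \<longleftrightarrow> set Ks \<subseteq> F \<and> length Ks = length Vs \<and> x = combine Ks Vs" for x Ks
  have D1: "\<exists>!Ks. D x Ks" if "x \<in> carrier K" for x
    unfolding D_def using unique_decomposition[OF F_subfield indep] span that by blast
  define \<phi> where "\<phi> x = complex_of_rat (rv (hd (THE Ks. D x Ks)))" for x
  have \<phi>: "\<phi> x = of_rat (rv (hd Ks))" if "D x Ks" "x \<in> carrier K" for x Ks
    unfolding \<phi>_def the1_equality[OF D1[OF that(2)] that(1)] ..
  have "\<phi> (x \<oplus> y) = \<phi> x + \<phi> y" if xy: "x \<in> carrier K" "y \<in> carrier K" for x y
  proof -
    obtain Ks where Ks: "D x Ks" using ex1_implies_ex[OF D1[OF xy(1)]] ..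
    obtain Ls where Ls: "D y Ls" using ex1_implies_ex[OF D1[OF xy(2)]] ..
    have KL: "set Ks \<subseteq> carrier K" "set Ls \<subseteq> carrier K" using Ks Ls F_carrier unfolding D_def by blast+
    have "D (x \<oplus> y) (map2 (\<oplus>) Ks Ls)"
      unfolding D_def
    proof (intro conjI)
      show "set (map2 (\<oplus>) Ks Ls) \<subseteq> F"
      proof
        fix z assume "z \<in> set (map2 (\<oplus>) Ks Ls)"
        then obtain a b where ab: "(a, b) \<in> set (zip Ks Ls)" "z = a \<oplus> b" by auto
        have "a \<in> F" "b \<in> F"
          using set_zip_leftD[OF ab(1)] set_zip_rightD[OF ab(1)] Ks Ls unfolding D_def by blast+
        then show "z \<in> F" unfolding ab(2) by (rule subringE(7)[OF subfieldE(1)[OF F_subfield]])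
      qed
      show "x \<oplus> y = combine (map2 (\<oplus>) Ks Ls) Vs"
        using combine_add[of Ks Vs Ls] Ks Ls KL Vs_carrier by (simp add: D_def)
    qed (use Ks Ls in \<open>auto simp: D_def\<close>)
    then have "\<phi> (x \<oplus> y) = of_rat (rv (hd (map2 (\<oplus>) Ks Ls)))" using xy by (intro \<phi>) auto
    moreover obtain k Ks' l Ls' where kl: "Ks = k # Ks'" "Ls = l # Ls'"
      using Ks Ls Vs by (cases Ks; cases Ls) (auto simp: D_def)
    moreover have "k \<in> F" "l \<in> F" using Ks Ls kl by (auto simp: D_def)
    ultimately show ?thesis using \<phi>[OF Ks xy(1)] \<phi>[OF Ls xy(2)] by (simp add: rv_add of_rat_add)
  qed
  then have "\<phi> \<in> addK" by (simp add: addK_def)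
  moreover have "D v (\<one> # replicate (length Ws) \<zero>)"
    using car subringE(2,3)[OF subfieldE(1)[OF F_subfield]] combine_replicate[OF car(2)] by (auto simp: D_def Vs)
  then have "\<phi> v = 1" using \<phi>[of v] car rv_eqI[OF ratval_ofi[of 1]] by simp
  ultimately show ?thesis using car by (intro bexI[of _ \<phi>] bexI[of _ v]) auto
qed

text \<open>Polynomials over \<open>K\<close> are lists with the leading coefficient first, hence
  the reversed exponent.\<close>

definition list_poly :: "'a list \<Rightarrow> complex poly" where
  "list_poly p = (\<Sum>i<length p. Polynomial.monom (of_rat (rv (p ! i))) (length p - 1 - i))"

lemma list_poly_Cons: "list_poly (k # p) = Polynomial.monom (of_rat (rv k)) (length p) + list_poly p"
  unfolding list_poly_def by (simp add: sum.lessThan_Suc_shift del: sum.lessThan_Suc)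

lemma addK_eval:
  assumes \<phi>: "\<phi> \<in> addK" and x: "x \<in> carrier K" and y: "y \<in> carrier K"
  shows "set p \<subseteq> F \<Longrightarrow> \<phi> (eval p x \<otimes> y) = seq_eval (list_poly p) (\<lambda>i. \<phi> (x [^] i \<otimes> y))"
proof (induction p)
  case Nil
  then show ?case using y by (simp add: list_poly_def seq_eval_def addK_zero[OF \<phi>])
next
  case (Cons k p)
  then have k: "k \<in> F" "k \<in> carrier K" and p: "set p \<subseteq> carrier K" using F_carrier by auto
  have ev: "eval p x \<in> carrier K" using eval_in_carrier[OF p x] .
  have "\<phi> (eval (k # p) x \<otimes> y) = \<phi> (k \<otimes> (x [^] length p \<otimes> y) \<oplus> eval p x \<otimes> y)"
    using k ev x y by (simp add: l_distr m_assoc)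
  also have "\<dots> = \<phi> (k \<otimes> (x [^] length p \<otimes> y)) + \<phi> (eval p x \<otimes> y)"
    using \<phi> k ev x y by (simp add: addK_def)
  also have "\<dots> = of_rat (rv k) * \<phi> (x [^] length p \<otimes> y) + seq_eval (list_poly p) (\<lambda>i. \<phi> (x [^] i \<otimes> y))"
    using Cons x y k by (simp add: addK_F[OF \<phi> k(1)])
  finally show ?case by (simp add: list_poly_Cons seq_eval_add seq_eval_monom)
qed

lemma list_poly_nonzero: assumes "p \<noteq> []" "set p \<subseteq> F" "hd p \<noteq> \<zero>" shows "list_poly p \<noteq> 0"
proof -
  obtain k p' where p: "p = k # p'" using assms(1) by (cases p) auto
  have "Polynomial.coeff (list_poly p') (length p') = 0"
    unfolding list_poly_def by (auto simp: coeff_sum coeff_monom intro!: sum.neutral)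
  then have "Polynomial.coeff (list_poly p) (length p') = of_rat (rv k)" by (simp add: p list_poly_Cons)
  moreover have "rv k \<noteq> 0" using assms p by (intro rv_nonzero) auto
  ultimately show ?thesis by auto
qed

text \<open>Induction on the degree of an annihilating polynomial. For a root m, either (T - m)
  \<phi> vanishes and \<phi> is an eigenvector, or it is a nonzero vector of \<open>W\<close>
  annihilated by the quotient. A nonzero constant annihilates no nonzero vector.\<close>

lemma eigenvector_exists:
  fixes W :: "('a \<Rightarrow> complex) set"
  assumes x: "x \<in> carrier K"
    and W: "\<And>\<phi> c. \<phi> \<in> W \<Longrightarrow> (\<lambda>y. \<phi> (x \<otimes> y) - c * \<phi> y) \<in> W"
  shows "q \<noteq> 0 \<Longrightarrow> \<phi> \<in> W \<Longrightarrow> \<exists>y\<in>carrier K. \<phi> y \<noteq> 0 \<Longrightarrow> (\<And>y. y \<in> carrier K \<Longrightarrow> seq_eval q (\<lambda>i. \<phi> (x [^] i \<otimes> y)) = 0)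
    \<Longrightarrow> \<exists>\<psi>\<in>W. (\<exists>y\<in>carrier K. \<psi> y \<noteq> 0) \<and> (\<exists>c. \<forall>y\<in>carrier K. \<psi> (x \<otimes> y) = c * \<psi> y)"
proof (induction "Polynomial.degree q" arbitrary: q \<phi>)
  case 0
  then obtain c where c: "q = [:c:]" "c \<noteq> 0" by (metis degree_eq_zeroE pCons_0_0)
  obtain y where y: "y \<in> carrier K" "\<phi> y \<noteq> 0" using 0(4) by blast
  have "c * \<phi> y = 0" using 0(5)[OF y(1)] y(1) by (simp add: c seq_eval_def)
  then show ?case using c y by simp
next
  case (Suc n)
  have "\<not> constant (poly q)" using Suc(2) by (simp add: constant_degree)
  then obtain m where m: "poly q m = 0" using fundamental_theorem_of_algebra by blast
  then obtain r where r: "q = [:-m, 1:] * r" by (metis poly_eq_0_iff_dvd dvdE)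
  have r0: "r \<noteq> 0" using r Suc(3) by auto
  have dr: "n = Polynomial.degree r" using Suc(2) r0 unfolding r by (subst (asm) degree_mult_eq) auto
  define \<psi> where "\<psi> = (\<lambda>y. \<phi> (x \<otimes> y) - m * \<phi> y)"
  have \<psi>W: "\<psi> \<in> W" unfolding \<psi>_def by (rule W[OF Suc(4)])
  show ?case
  proof (cases "\<exists>y\<in>carrier K. \<psi> y \<noteq> 0")
    case True
    have "seq_eval r (\<lambda>i. \<psi> (x [^] i \<otimes> y)) = 0" if y: "y \<in> carrier K" for y
    proof -
      have "(\<lambda>i. \<psi> (x [^] i \<otimes> y)) = (\<lambda>i. \<phi> (x [^] Suc i \<otimes> y) - m * \<phi> (x [^] i \<otimes> y))"
      proof
        fix i :: nat
        have "x \<otimes> (x [^] i \<otimes> y) = x [^] Suc i \<otimes> y" using x y by (simp add: m_ac)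
        then show "\<psi> (x [^] i \<otimes> y) = \<phi> (x [^] Suc i \<otimes> y) - m * \<phi> (x [^] i \<otimes> y)" by (simp add: \<psi>_def)
      qed
      then show ?thesis using Suc(6)[OF y] unfolding r seq_eval_mult_linear by simp
    qed
    then show ?thesis using Suc(1)[OF dr r0 \<psi>W True] by blast
  next
    case False
    then show ?thesis using Suc(4,5) by (intro bexI[of _ \<phi>] conjI exI[of _ m]) (auto simp: \<psi>_def)
  qed
qed

text \<open>The eigenvalues found so far cut out a joint eigenspace \<open>W\<close>, which
  multiplication by the next \<open>x\<close> preserves by commutativity. The annihilating
  polynomial comes from \<open>x\<close> being algebraic over the prime subfield.\<close>

lemma common_eigenvector:
  "set xs \<subseteq> carrier K \<Longrightarrow> \<exists>\<phi>\<in>addK. (\<exists>y\<in>carrier K. \<phi> y \<noteq> 0) \<and> (\<forall>x\<in>set xs. \<exists>c. \<forall>y\<in>carrier K. \<phi> (x \<otimes> y) = c * \<phi> y)"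
proof (induction xs)
  case Nil
  then show ?case using addK_nonzero by auto
next
  case (Cons x xs)
  then obtain \<phi> where \<phi>: "\<phi> \<in> addK" "\<exists>y\<in>carrier K. \<phi> y \<noteq> 0"
    "\<And>x. x \<in> set xs \<Longrightarrow> \<exists>c. \<forall>y\<in>carrier K. \<phi> (x \<otimes> y) = c * \<phi> y" by auto
  from \<phi>(3) obtain c where c: "\<And>x y. x \<in> set xs \<Longrightarrow> y \<in> carrier K \<Longrightarrow> \<phi> (x \<otimes> y) = c x * \<phi> y" by metis
  define W where "W = {\<psi>\<in>addK. \<forall>x\<in>set xs. \<forall>y\<in>carrier K. \<psi> (x \<otimes> y) = c x * \<psi> y}"
  have x: "x \<in> carrier K" and xs: "set xs \<subseteq> carrier K" using Cons.prems by auto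
  have "(algebraic over F) x"
  proof (rule finite_dimension_imp_algebraic[OF F_subfield])
    show "finite_dimension F (carrier K)" using Span_finite_dimension[OF F_subfield Vs_carrier] span by simp
  qed (use x carrier_is_subring in auto)
  then obtain p where p: "p \<in> carrier (F[X]\<^bsub>K\<^esub>)" "p \<noteq> []" "eval p x = \<zero>"
    using algebraicE[OF subfieldE(1)[OF F_subfield] x] by blast
  then have p': "set p \<subseteq> F" "hd p \<noteq> \<zero>" unfolding univ_poly_carrier[symmetric] polynomial_def by auto
  have "\<exists>\<psi>\<in>W. (\<exists>y\<in>carrier K. \<psi> y \<noteq> 0) \<and> (\<exists>c. \<forall>y\<in>carrier K. \<psi> (x \<otimes> y) = c * \<psi> y)"
  proof (rule eigenvector_exists[OF x _ list_poly_nonzero[OF p(2) p'] _ \<phi>(2)])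
    show "\<phi> \<in> W" using \<phi>(1) c by (simp add: W_def)
    show "seq_eval (list_poly p) (\<lambda>i. \<phi> (x [^] i \<otimes> y)) = 0" if "y \<in> carrier K" for y
      using addK_eval[OF \<phi>(1) x that p'(1)] p(3) that by (simp add: addK_zero[OF \<phi>(1)])
    fix \<psi> m assume "\<psi> \<in> W"
    then have \<psi>: "\<psi> \<in> addK" "\<And>x y. x \<in> set xs \<Longrightarrow> y \<in> carrier K \<Longrightarrow> \<psi> (x \<otimes> y) = c x * \<psi> y" by (auto simp: W_def)
    show "(\<lambda>y. \<psi> (x \<otimes> y) - m * \<psi> y) \<in> W"
      unfolding W_def
    proof (intro CollectI conjI ballI)
      show "(\<lambda>y. \<psi> (x \<otimes> y) - m * \<psi> y) \<in> addK"
        using \<psi>(1) x by (simp add: addK_def r_distr algebra_simps)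
      fix x' y assume xy: "x' \<in> set xs" "y \<in> carrier K"
      then have x': "x' \<in> carrier K" using xs by auto
      have "\<psi> (x \<otimes> (x' \<otimes> y)) = \<psi> (x' \<otimes> (x \<otimes> y))" using x x' xy by (simp add: m_lcomm)
      also have "\<dots> = c x' * \<psi> (x \<otimes> y)" using x xy by (intro \<psi>(2)) auto
      finally show "\<psi> (x \<otimes> (x' \<otimes> y)) - m * \<psi> (x' \<otimes> y) = c x' * (\<psi> (x \<otimes> y) - m * \<psi> y)"
        using \<psi>(2)[OF xy] by (simp add: algebra_simps)
    qed
  qed
  then obtain \<psi> b where \<psi>: "\<psi> \<in> W" "\<exists>y\<in>carrier K. \<psi> y \<noteq> 0" "\<forall>y\<in>carrier K. \<psi> (x \<otimes> y) = b * \<psi> y"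
    by blast
  have "\<exists>c. \<forall>y\<in>carrier K. \<psi> (x' \<otimes> y) = c * \<psi> y" if "x' \<in> set (x # xs)" for x'
  proof (cases "x' = x")
    case True
    then show ?thesis using \<psi>(3) by blast
  next
    case False
    then have "x' \<in> set xs" using that by simp
    then show ?thesis using \<psi>(1) unfolding W_def by blast
  qed
  moreover have "\<psi> \<in> addK" using \<psi>(1) by (simp add: W_def)
  ultimately show ?case using \<psi>(2) by blast
qed

text \<open>
  The operators \<open>\<phi> \<mapsto> \<phi> (x \<otimes> _)\<close> on additive maps \<open>K \<rightarrow> \<complex>\<close> commute and are algebraic, so they have
  a common eigenvector \<open>\<phi>\<close>, and \<open>\<phi> / \<phi> \<one>\<close> is multiplicative.
\<close>

theorem embedding_exists:
  "\<exists>\<chi> :: 'a \<Rightarrow> complex. (\<forall>x\<in>carrier K. \<forall>y\<in>carrier K. \<chi> (x \<oplus> y) = \<chi> x + \<chi> y \<and> \<chi> (x \<otimes> y) = \<chi> x * \<chi> y) \<and> \<chi> \<one> = 1"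
proof -
  obtain \<phi> where \<phi>: "\<phi> \<in> addK" "\<exists>y\<in>carrier K. \<phi> y \<noteq> 0"
    "\<And>x. x \<in> set Vs \<Longrightarrow> \<exists>c. \<forall>y\<in>carrier K. \<phi> (x \<otimes> y) = c * \<phi> y"
    using common_eigenvector[OF Vs_carrier] by blast
  have add: "\<phi> (a \<oplus> b) = \<phi> a + \<phi> b" if "a \<in> carrier K" "b \<in> carrier K" for a b using \<phi>(1) that by (simp add: addK_def)
  \<comment> \<open>Additive maps are linear over the prime subfield, so the eigenvector property
    passes from \<open>Vs\<close> to its whole span.\<close>
  have comb: "\<exists>c. \<forall>y\<in>carrier K. \<phi> (combine Ks Us \<otimes> y) = c * \<phi> y" if "set Ks \<subseteq> F" "set Us \<subseteq> set Vs" for Ks Us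
    using that
  proof (induction Ks Us rule: combine.induct)
    case (1 k Ks u Us)
    then obtain c1 c2 where c: "\<And>y. y \<in> carrier K \<Longrightarrow> \<phi> (u \<otimes> y) = c1 * \<phi> y"
      "\<And>y. y \<in> carrier K \<Longrightarrow> \<phi> (combine Ks Us \<otimes> y) = c2 * \<phi> y" using \<phi>(3)[of u] by auto
    have car: "k \<in> F" "k \<in> carrier K" "u \<in> carrier K" "combine Ks Us \<in> carrier K"
      using 1 F_carrier Vs_carrier by (auto intro!: combine_in_carrier)
    have "\<phi> (combine (k # Ks) (u # Us) \<otimes> y) = (of_rat (rv k) * c1 + c2) * \<phi> y" if "y \<in> carrier K" for y
      using car that c by (simp add: l_distr m_assoc add addK_F[OF \<phi>(1)] algebra_simps)
    then show ?case by blast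
  qed (auto intro!: exI[of _ 0] simp: addK_zero[OF \<phi>(1)])
  have all: "\<exists>c. \<forall>y\<in>carrier K. \<phi> (x \<otimes> y) = c * \<phi> y" if "x \<in> carrier K" for x
  proof -
    have "x \<in> Span F Vs" using span that by simp
    then obtain Ks where "set Ks \<subseteq> F" "x = combine Ks Vs" using Span_mem_iff_length_version[OF F_subfield Vs_carrier]
      by blast
    then show ?thesis using comb by blast
  qed
  have prod: "\<phi> (x \<otimes> y) * \<phi> \<one> = \<phi> x * \<phi> y" if xy: "x \<in> carrier K" "y \<in> carrier K" for x y
  proof -
    obtain c where c: "\<And>y. y \<in> carrier K \<Longrightarrow> \<phi> (x \<otimes> y) = c * \<phi> y" using all[OF xy(1)] by blast
    show ?thesis using c[OF xy(2)] c[OF one_closed] xy by simp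
  qed
  have n1: "\<phi> \<one> \<noteq> 0"
  proof
    assume "\<phi> \<one> = 0"
    obtain y where y: "y \<in> carrier K" "\<phi> y \<noteq> 0" using \<phi>(2) by blast
    show False using prod[OF y(1) y(1)] y \<open>\<phi> \<one> = 0\<close> by simp
  qed
  show ?thesis
    by (rule exI[of _ "\<lambda>x. \<phi> x / \<phi> \<one>"]) (use n1 prod add in \<open>auto simp: field_simps\<close>)
qed

end

section \<open>Transfer to the abstract number field\<close>

locale embedded_field = char0_finite_field K Vs for K (structure) and Vs +
  fixes \<chi> :: "'a \<Rightarrow> complex"
  assumes \<chi>_add: "x \<in> carrier K \<Longrightarrow> y \<in> carrier K \<Longrightarrow> \<chi> (x \<oplus> y) = \<chi> x + \<chi> y"
    and \<chi>_mult: "x \<in> carrier K \<Longrightarrow> y \<in> carrier K \<Longrightarrow> \<chi> (x \<otimes> y) = \<chi> x * \<chi> y"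
    and \<chi>_one: "\<chi> \<one> = 1"
begin

abbreviation d where "d \<equiv> length Vs"

lemma \<chi>_addK: "\<chi> \<in> addK"
  by (simp add: addK_def \<chi>_add)

lemma \<chi>_zero: "\<chi> \<zero> = 0"
  by (rule addK_zero[OF \<chi>_addK])

lemma \<chi>_minus: "x \<in> carrier K \<Longrightarrow> \<chi> (\<ominus> x) = - \<chi> x"
  using \<chi>_add[of x "\<ominus> x"] by (simp add: r_neg \<chi>_zero add_eq_0_iff)

lemma \<chi>_inv: assumes "x \<in> carrier K" "x \<noteq> \<zero>" shows "inv x \<in> carrier K" "\<chi> (inv x) = inverse (\<chi> x)"
proof -
  have u: "x \<in> Units K" using assms field_Units by simp
  then show "inv x \<in> carrier K" by simp
  then have "\<chi> x * \<chi> (inv x) = 1" using \<chi>_mult[of x "inv x"] u assms by (simp add: \<chi>_one)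
  then show "\<chi> (inv x) = inverse (\<chi> x)" by (metis inverse_unique)
qed

lemma \<chi>_nonzero: "x \<in> carrier K \<Longrightarrow> x \<noteq> \<zero> \<Longrightarrow> \<chi> x \<noteq> 0"
proof
  assume x: "x \<in> carrier K" "x \<noteq> \<zero>" "\<chi> x = 0"
  have "x \<otimes> inv x = \<one>" using x(1,2) field_Units by (intro Units_r_inv) simp
  then show False using \<chi>_mult[OF x(1) \<chi>_inv(1)[OF x(1,2)]] x(3) \<chi>_one by simp
qed

lemma \<chi>_inj: "inj_on \<chi> (carrier K)"
proof (rule inj_onI, rule ccontr)
  fix x y assume xy: "x \<in> carrier K" "y \<in> carrier K" "\<chi> x = \<chi> y" "x \<noteq> y"
  then have "x \<oplus> \<ominus> y \<noteq> \<zero>" using r_right_minus_eq[of x y] by (simp add: a_minus_def)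
  then show False using \<chi>_nonzero[of "x \<oplus> \<ominus> y"] xy by (simp add: \<chi>_add \<chi>_minus)
qed

lemma \<chi>_int: "x \<in> carrier K \<Longrightarrow> \<chi> ([(n::int)] \<cdot> x) = of_int n * \<chi> x"
  using addK_ofi[OF \<chi>_addK, of x n] by (simp add: ofi_mult_eq)

lemma \<chi>_ofi: "\<chi> (ofi n) = of_int n"
  using addK_ofi[OF \<chi>_addK one_closed, of n] by (simp add: \<chi>_one)

lemma \<chi>_F: "k \<in> F \<Longrightarrow> \<chi> k = of_rat (rv k)"
  using addK_F[OF \<chi>_addK _ one_closed, of k] F_carrier[of k] by (simp add: \<chi>_one)

lemma F_surj: "\<exists>k\<in>F. \<chi> k = of_rat q"
proof (cases q)
  case (Fract a b)
  have b: "ofi b \<noteq> \<zero>" using Fract by (intro ofi_nonzero) simp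
  have "ofi a \<otimes> inv (ofi b) \<in> F"
    by (intro subringE(6)[OF subfieldE(1)[OF F_subfield]] ofi_in_F)
      (use subfield_m_inv(1)[OF F_subfield] ofi_in_F b in auto)
  moreover have "\<chi> (ofi a \<otimes> inv (ofi b)) = of_rat q"
    using \<chi>_inv[OF ofi_closed b] Fract by (simp add: \<chi>_mult \<chi>_ofi of_rat_rat field_simps)
  ultimately show ?thesis by blast
qed

lemma \<chi>_combine:
  "length Ks = length Us \<Longrightarrow> set Ks \<subseteq> carrier K \<Longrightarrow> set Us \<subseteq> carrier K \<Longrightarrow>
   \<chi> (combine Ks Us) = (\<Sum>i<length Us. \<chi> (Ks ! i) * \<chi> (Us ! i))"
proof (induction Ks Us rule: list_induct2)
  case (Cons k Ks u Us)
  then have "combine Ks Us \<in> carrier K" by (auto intro!: combine_in_carrier)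
  then show ?case using Cons by (simp add: \<chi>_add \<chi>_mult sum.lessThan_Suc_shift del: sum.lessThan_Suc)
qed (simp add: \<chi>_zero)

lemma \<chi>_pow: "x \<in> carrier K \<Longrightarrow> \<chi> (x [^] (n::nat)) = \<chi> x ^ n"
  by (induction n) (auto simp: \<chi>_one \<chi>_mult)

lemma \<chi>_finsum: "finite A \<Longrightarrow> f \<in> A \<rightarrow> carrier K \<Longrightarrow> \<chi> (\<Oplus>i\<in>A. f i) = (\<Sum>i\<in>A. \<chi> (f i))"
  by (induction A rule: finite_induct) (auto simp: \<chi>_zero \<chi>_add finsum_insert Pi_iff)

sublocale cf: complex_number_field "\<chi> ` carrier K" "\<lambda>j. \<chi> (Vs ! j)" "length Vs"
proof
  show "1 \<in> \<chi> ` carrier K" using \<chi>_one by (metis image_eqI one_closed)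
  show "x + y \<in> \<chi> ` carrier K" if "x \<in> \<chi> ` carrier K" "y \<in> \<chi> ` carrier K" for x y
    using that by (auto simp flip: \<chi>_add)
  show "x * y \<in> \<chi> ` carrier K" if "x \<in> \<chi> ` carrier K" "y \<in> \<chi> ` carrier K" for x y
    using that by (auto simp flip: \<chi>_mult)
  show "- x \<in> \<chi> ` carrier K" if "x \<in> \<chi> ` carrier K" for x
    using that by (auto simp flip: \<chi>_minus)
  show "inverse x \<in> \<chi> ` carrier K" if "x \<in> \<chi> ` carrier K" for x
  proof -
    from that obtain y where y: "y \<in> carrier K" "x = \<chi> y" by blast
    show ?thesis
    proof (cases "y = \<zero>")
      case True
      then have "inverse x = \<chi> \<zero>" using y by (simp add: \<chi>_zero)
      then show ?thesis by simp
    next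
      case False
      then show ?thesis using \<chi>_inv[OF y(1) False] y(2) by (metis image_eqI)
    qed
  qed
  show "\<chi> (Vs ! i) \<in> \<chi> ` carrier K" if "i < length Vs" for i using nth_mem[OF that] Vs_carrier by blast
  show "\<exists>q::nat \<Rightarrow> rat. x = (\<Sum>i<length Vs. of_rat (q i) * \<chi> (Vs ! i))" if "x \<in> \<chi> ` carrier K" for x
  proof -
    from that obtain y where y: "y \<in> carrier K" "x = \<chi> y" by blast
    then have "y \<in> Span F Vs" using span by simp
    then obtain Ks where Ks: "set Ks \<subseteq> F" "length Ks = length Vs" "y = combine Ks Vs"
      using Span_mem_iff_length_version[OF F_subfield Vs_carrier] by blast
    have "set Ks \<subseteq> carrier K" using Ks(1) F_carrier by blast
    then have "x = (\<Sum>i<length Vs. \<chi> (Ks ! i) * \<chi> (Vs ! i))" using \<chi>_combine[OF Ks(2) _ Vs_carrier] y Ks by simp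
    also have "\<dots> = (\<Sum>i<length Vs. of_rat (rv (Ks ! i)) * \<chi> (Vs ! i))"
    proof (intro sum.cong refl)
      fix i assume "i \<in> {..<length Vs}"
      then have "Ks ! i \<in> F" using Ks(1,2) by (metis lessThan_iff nth_mem subsetD)
      then show "\<chi> (Ks ! i) * \<chi> (Vs ! i) = of_rat (rv (Ks ! i)) * \<chi> (Vs ! i)" by (simp add: \<chi>_F)
    qed
    finally show ?thesis by (rule exI[of _ "\<lambda>i. rv (Ks ! i)"])
  qed
  show "q i = 0" if z: "(\<Sum>i<length Vs. of_rat (q i) * \<chi> (Vs ! i)) = 0" and i: "i < length Vs" for q i
  proof -
    have "\<forall>i. \<exists>k\<in>F. \<chi> k = of_rat (q i)" using F_surj by blast
    then obtain k where k: "\<And>i. k i \<in> F" "\<And>i. \<chi> (k i) = of_rat (q i)" by metis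
    define Ks where "Ks = map k [0..<length Vs]"
    have Ks: "set Ks \<subseteq> F" "length Ks = length Vs" "set Ks \<subseteq> carrier K" using k(1) F_carrier by (auto simp: Ks_def)
    have "\<chi> (combine Ks Vs) = (\<Sum>i<length Vs. of_rat (q i) * \<chi> (Vs ! i))"
      unfolding \<chi>_combine[OF Ks(2,3) Vs_carrier] by (intro sum.cong) (auto simp: Ks_def k)
    then have "combine Ks Vs = \<zero>" using z \<chi>_nonzero[of "combine Ks Vs"] combine_in_carrier[OF Ks(3) Vs_carrier] by auto
    then have "set (take (length Vs) Ks) \<subseteq> {\<zero>}" by (rule independent_imp_trivial_combine[OF F_subfield indep Ks(1)])
    moreover have "k i \<in> set Ks" using i by (simp add: Ks_def)
    ultimately have "k i = \<zero>" using Ks(2) by auto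
    then show ?thesis using k(2)[of i] \<chi>_zero by simp
  qed
qed

section \<open>Embeddings, integers and integral bases of the abstract field\<close>

definition lift :: "complex \<Rightarrow> 'a" where "lift = inv_into (carrier K) \<chi>"

lemma lift: "z \<in> \<chi> ` carrier K \<Longrightarrow> lift z \<in> carrier K" "z \<in> \<chi> ` carrier K \<Longrightarrow> \<chi> (lift z) = z"
  "x \<in> carrier K \<Longrightarrow> lift (\<chi> x) = x"
  unfolding lift_def by (auto simp: inv_into_into f_inv_into_f inv_into_f_f[OF \<chi>_inj])

lemma field_degree: "field_degree K = d"
proof -
  have "dimension d F (carrier K)" using dimension_independent[OF indep] span by simp
  then show ?thesis using dimI[OF F_subfield] by (simp add: field_degree_def over_def)
qed

text \<open>Also changes the default value: embeddings of \<open>K\<close> are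
  \<open>undefined\<close> outside the carrier, whereas members of \<open>cf.homs\<close> are 0
  outside the image.\<close>

definition down :: "('a \<Rightarrow> complex) \<Rightarrow> complex \<Rightarrow> complex" where
  "down s = (\<lambda>z. if z \<in> \<chi> ` carrier K then s (lift z) else 0)"

lemma embedding_iff: "s \<in> complex_embeddings K \<longleftrightarrow> s \<in> extensional (carrier K) \<and>
  (\<forall>x\<in>carrier K. \<forall>y\<in>carrier K. s (x \<oplus> y) = s x + s y \<and> s (x \<otimes> y) = s x * s y) \<and> s \<one> = 1"
  unfolding complex_embeddings_def Ring.ring_hom_def ring_of_type_algebra_def by auto

lemma down_\<chi>: "x \<in> carrier K \<Longrightarrow> down s (\<chi> x) = s x"
  by (simp add: down_def lift)

lemma bij_down: "bij_betw down (complex_embeddings K) cf.homs"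
proof (rule bij_betw_byWitness[of _ "\<lambda>\<tau>. restrict (\<lambda>x. \<tau> (\<chi> x)) (carrier K)"])
  show "\<forall>s\<in>complex_embeddings K. restrict (\<lambda>x. down s (\<chi> x)) (carrier K) = s"
    by (auto simp: embedding_iff down_\<chi> extensional_def restrict_def fun_eq_iff)
  show "\<forall>\<tau>\<in>cf.homs. down (restrict (\<lambda>x. \<tau> (\<chi> x)) (carrier K)) = \<tau>"
    by (auto simp: fun_eq_iff down_def lift cf.homs_def cf.additive_def)
  show "down ` complex_embeddings K \<subseteq> cf.homs"
  proof (clarify)
    fix s assume "s \<in> complex_embeddings K"
    then have s: "\<And>x y. x \<in> carrier K \<Longrightarrow> y \<in> carrier K \<Longrightarrow> s (x \<oplus> y) = s x + s y"
      "\<And>x y. x \<in> carrier K \<Longrightarrow> y \<in> carrier K \<Longrightarrow> s (x \<otimes> y) = s x * s y" "s \<one> = 1" by (auto simp: embedding_iff)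
    have "down s (\<chi> x + \<chi> y) = down s (\<chi> x) + down s (\<chi> y)" "down s (\<chi> x * \<chi> y) = down s (\<chi> x) * down s (\<chi> y)"
      if "x \<in> carrier K" "y \<in> carrier K" for x y
      using that s by (simp_all add: \<chi>_add[symmetric] \<chi>_mult[symmetric] down_\<chi>)
    moreover have "down s 1 = 1" using down_\<chi>[OF one_closed, of s] s(3) by (simp add: \<chi>_one)
    moreover have "down s z = 0" if "z \<notin> \<chi> ` carrier K" for z using that by (simp add: down_def)
    ultimately show "down s \<in> cf.homs" unfolding cf.homs_def cf.additive_def by blast
  qed
  show "(\<lambda>\<tau>. restrict (\<lambda>x. \<tau> (\<chi> x)) (carrier K)) ` cf.homs \<subseteq> complex_embeddings K"
    by (auto simp: embedding_iff cf.homs_def cf.additive_def \<chi>_add \<chi>_mult \<chi>_one)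
qed

lemma ring_of_integers_iff: "x \<in> ring_of_integers K \<longleftrightarrow> x \<in> carrier K \<and> \<chi> x \<in> cf.OL"
proof -
  have "(\<Oplus>i\<in>{..Polynomial.degree p}. [Polynomial.coeff p i] \<cdot> (x [^] i)) = \<zero> \<longleftrightarrow> poly (of_int_poly p) (\<chi> x) = 0"
    if x: "x \<in> carrier K" for p :: "int poly"
  proof -
    have cl: "[Polynomial.coeff p i] \<cdot> (x [^] i) \<in> carrier K" for i :: nat using x by (intro add.int_pow_closed) simp
    have "\<chi> (\<Oplus>i\<in>{..Polynomial.degree p}. [Polynomial.coeff p i] \<cdot> (x [^] i)) = poly (of_int_poly p) (\<chi> x)"
      using x cl by (subst \<chi>_finsum) (auto simp: \<chi>_int \<chi>_pow poly_altdef)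
    moreover have "(\<Oplus>i\<in>{..Polynomial.degree p}. [Polynomial.coeff p i] \<cdot> (x [^] i)) \<in> carrier K"
      using cl by (intro finsum_closed) auto
    ultimately show ?thesis using \<chi>_nonzero \<chi>_zero by metis
  qed
  then show ?thesis unfolding ring_of_integers_def cf.OL_def algebraic_int_altdef_ipoly by auto
qed

lemma \<chi>_int_comb:
  assumes "\<And>i. i < d \<Longrightarrow> \<omega> i \<in> carrier K"
  shows "(\<Oplus>i\<in>{..<d}. [(c i :: int)] \<cdot> \<omega> i) \<in> carrier K"
    "\<chi> (\<Oplus>i\<in>{..<d}. [c i] \<cdot> \<omega> i) = (\<Sum>i<d. of_int (c i) * \<chi> (\<omega> i))"
proof -
  have cl: "[c i] \<cdot> \<omega> i \<in> carrier K" if "i < d" for i using assms[OF that] by (rule add.int_pow_closed)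
  show "(\<Oplus>i\<in>{..<d}. [c i] \<cdot> \<omega> i) \<in> carrier K" using cl by (intro finsum_closed) auto
  show "\<chi> (\<Oplus>i\<in>{..<d}. [c i] \<cdot> \<omega> i) = (\<Sum>i<d. of_int (c i) * \<chi> (\<omega> i))"
    using cl assms by (subst \<chi>_finsum) (auto simp: \<chi>_int)
qed

end

locale enumerated_embedded_field = embedded_field K Vs \<chi> for K (structure) and Vs \<chi> +
  fixes \<sigma>
  assumes enum: "bij_betw \<sigma> {..<length Vs} cf.homs"
begin

sublocale ef: enumerated_number_field "\<chi> ` carrier K" "\<lambda>j. \<chi> (Vs ! j)" "length Vs" \<sigma>
  by unfold_locales (rule enum)

lemma integral_basis_imp:
  assumes "integral_basis K \<omega>"
  shows "ef.ibasis (\<lambda>i. \<chi> (\<omega> i))"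
proof -
  have w: "\<omega> i \<in> carrier K" "\<chi> (\<omega> i) \<in> cf.OL" if "i < d" for i
    using assms that by (auto simp: integral_basis_def field_degree ring_of_integers_iff)
  have "\<exists>c::nat \<Rightarrow> int. z = (\<Sum>j<d. of_int (c j) * \<chi> (\<omega> j))" if z: "z \<in> cf.OL" for z
  proof -
    obtain x where x: "x \<in> carrier K" "z = \<chi> x" using cf.OL_in[OF z] by blast
    then have xO: "x \<in> ring_of_integers K" using z by (simp add: ring_of_integers_iff)
    have "\<forall>x\<in>ring_of_integers K. \<exists>!c::nat \<Rightarrow> int. c \<in> extensional {..<d} \<and> x = (\<Oplus>i\<in>{..<d}. [c i] \<cdot> \<omega> i)"
      using assms unfolding integral_basis_def field_degree by (rule conjunct2)
    from ex1_implies_ex[OF bspec[OF this xO]]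
    obtain c :: "nat \<Rightarrow> int" where c: "x = (\<Oplus>i\<in>{..<d}. [c i] \<cdot> \<omega> i)" by (elim exE conjE)
    have "z = (\<Sum>i<d. of_int (c i) * \<chi> (\<omega> i))" unfolding x(2) c by (rule \<chi>_int_comb(2)[OF w(1)])
    then show ?thesis by (rule exI[of _ c])
  qed
  then show ?thesis using w by (simp add: ef.ibasis_def)
qed

text \<open>The nonzero determinant supplies the uniqueness that \<open>integral_basis\<close>
  demands; restricting coefficients to the index range makes them extensional.\<close>

lemma integral_basis_back:
  assumes \<omega>: "ef.ibasis \<omega>" "det (ef.emb \<omega>) \<noteq> 0"
  shows "integral_basis K (\<lambda>i. lift (\<omega> i))"
proof -
  have wO: "\<omega> i \<in> cf.OL" if "i < d" for i using \<omega>(1) that by (simp add: ef.ibasis_def)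
  have wL: "\<omega> i \<in> \<chi> ` carrier K" if "i < d" for i by (rule cf.OL_in[OF wO[OF that]])
  have bw: "lift (\<omega> i) \<in> carrier K" "\<chi> (lift (\<omega> i)) = \<omega> i" if "i < d" for i using lift wL[OF that] by auto
  have comb: "\<chi> (\<Oplus>i\<in>{..<d}. [c i] \<cdot> lift (\<omega> i)) = (\<Sum>i<d. of_int (c i) * \<omega> i)" for c :: "nat \<Rightarrow> int"
    by (subst \<chi>_int_comb(2)[of "\<lambda>i. lift (\<omega> i)"]) (auto simp: bw intro!: sum.cong)
  show ?thesis
    unfolding integral_basis_def field_degree
  proof (intro conjI allI impI ballI)
    show "lift (\<omega> i) \<in> ring_of_integers K" if "i < d" for i using bw[OF that] wO[OF that]
      by (simp add: ring_of_integers_iff)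
    fix x assume "x \<in> ring_of_integers K"
    then have x: "x \<in> carrier K" "\<chi> x \<in> cf.OL" by (auto simp: ring_of_integers_iff)
    obtain c :: "nat \<Rightarrow> int" where c: "\<chi> x = (\<Sum>j<d. of_int (c j) * \<omega> j)"
      using bspec[OF conjunct2[OF \<omega>(1)[unfolded ef.ibasis_def]] x(2)] by (elim exE)
    have iff: "x = (\<Oplus>i\<in>{..<d}. [c' i] \<cdot> lift (\<omega> i)) \<longleftrightarrow> \<chi> x = (\<Sum>j<d. of_int (c' j) * \<omega> j)" for c' :: "nat \<Rightarrow> int"
      unfolding comb[symmetric] by (rule inj_on_eq_iff[OF \<chi>_inj x(1) \<chi>_int_comb(1)[of
        "\<lambda>i. lift (\<omega> i)", OF bw(1)], symmetric])
    show "\<exists>!c::nat \<Rightarrow> int. c \<in> extensional {..<d} \<and> x = (\<Oplus>i\<in>{..<d}. [c i] \<cdot> lift (\<omega> i))"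
    proof (rule ex1I[of _ "restrict c {..<d}"])
      show "restrict c {..<d} \<in> extensional {..<d} \<and> x = (\<Oplus>i\<in>{..<d}. [restrict c {..<d} i] \<cdot> lift (\<omega> i))"
        unfolding iff using c by simp
      fix c' :: "nat \<Rightarrow> int" assume "c' \<in> extensional {..<d} \<and> x = (\<Oplus>i\<in>{..<d}. [c' i] \<cdot> lift (\<omega> i))"
      then have c': "c' \<in> extensional {..<d}" "\<chi> x = (\<Sum>j<d. of_int (c' j) * \<omega> j)" unfolding iff by auto
      have eq: "(\<Sum>j<d. of_int (c' j) * \<omega> j) = (\<Sum>j<d. of_int (c j) * \<omega> j)" using c c'(2) by simp
      have "c' j = c j" if j: "j < d" for j
        using ef.int_coords_unique[of \<omega> c' c j] wL \<omega>(2) eq j by blast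
      then show "c' = restrict c {..<d}" using c'(1) by (auto simp: extensional_def fun_eq_iff)
    qed
  qed
qed

text \<open>The definite description needs independence of two choices: the trace matrix removes the
  enumeration of the embeddings, and comparison of integral bases removes the basis.\<close>

lemma discriminant_eq:
  assumes \<omega>: "ef.ibasis \<omega>" "det (ef.emb \<omega>) \<noteq> 0" and D: "complex_of_int D = (det (ef.emb \<omega>))\<^sup>2"
  shows "discriminant K = D"
  unfolding discriminant_def field_degree
proof (rule the_equality)
  define s where "s i = the_inv_into (complex_embeddings K) down (\<sigma> i)" for i
  have inj: "inj_on down (complex_embeddings K)" and im: "down ` complex_embeddings K = cf.homs"
    using bij_down by (auto simp: bij_betw_def)
  have bij: "bij_betw s {..<d} (complex_embeddings K)"
    using bij_betw_trans[OF enum bij_betw_the_inv_into[OF bij_down]] by (simp add: s_def o_def cong: bij_betw_cong)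
  have ds: "down (s i) = \<sigma> i" if "i < d" for i
    unfolding s_def by (rule f_the_inv_into_f[OF inj]) (use ef.\<sigma>_hom[OF that] im in auto)
  have wL: "\<omega> i \<in> \<chi> ` carrier K" if "i < d" for i using \<omega>(1) that by (simp add: ef.ibasis_def cf.OL_def)
  have "mat d d (\<lambda>(i, j). s i (lift (\<omega> j))) = ef.emb \<omega>"
  proof (rule eq_matI)
    fix i j assume "i < dim_row (ef.emb \<omega>)" "j < dim_col (ef.emb \<omega>)"
    then have ij: "i < d" "j < d" by (auto simp: ef.emb_def)
    have "s i (lift (\<omega> j)) = down (s i) (\<omega> j)" using wL[OF ij(2)] by (simp add: down_def)
    then show "mat d d (\<lambda>(i, j). s i (lift (\<omega> j))) $$ (i,j) = ef.emb \<omega> $$ (i,j)"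
      using ij by (simp add: ef.emb_def ds)
  qed (auto simp: ef.emb_def)
  then show "\<exists>\<omega> \<sigma>. integral_basis K \<omega> \<and> bij_betw \<sigma> {..<d} (complex_embeddings K) \<and>
     complex_of_int D = (det (mat d d (\<lambda>(i, j). \<sigma> i (\<omega> j))))\<^sup>2"
    using integral_basis_back[OF \<omega>] bij D by (intro exI[of _ "\<lambda>i. lift (\<omega> i)"] exI[of _ s]) simp
next
  fix D' assume "\<exists>\<omega> \<sigma>. integral_basis K \<omega> \<and> bij_betw \<sigma> {..<d} (complex_embeddings K) \<and>
     complex_of_int D' = (det (mat d d (\<lambda>(i, j). \<sigma> i (\<omega> j))))\<^sup>2"
  then obtain w s where w: "integral_basis K w" and s: "bij_betw s {..<d} (complex_embeddings K)"
    and D': "complex_of_int D' = (det (mat d d (\<lambda>(i, j). s i (w j))))\<^sup>2" by blast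
  define s' where "s' = (\<lambda>i. down (s i))"
  \<comment> \<open>The competing enumeration gives a second instance over the same field; both
    instances share \<open>cf.trace_mat\<close>, through which their determinants are
    compared.\<close>
  interpret ef': enumerated_number_field "\<chi> ` carrier K" "\<lambda>j. \<chi> (Vs ! j)" "length Vs" s'
    by unfold_locales (use bij_betw_trans[OF s bij_down] in \<open>simp add: s'_def o_def\<close>)
  define w' where "w' = (\<lambda>i. \<chi> (w i))"
  have ib: "ef.ibasis w'" unfolding w'_def by (rule integral_basis_imp[OF w])
  have wc: "w j \<in> carrier K" if "j < d" for j using w that
    by (simp add: integral_basis_def field_degree ring_of_integers_iff)
  have w'L: "w' j \<in> \<chi> ` carrier K" if "j < d" for j using wc[OF that] by (simp add: w'_def)
  have "mat d d (\<lambda>(i, j). s i (w j)) = ef'.emb w'"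
    unfolding ef'.emb_def by (rule eq_matI) (auto simp: s'_def w'_def down_\<chi> wc)
  then have "complex_of_int D' = (det (ef'.emb w'))\<^sup>2" using D' by simp
  also have "\<dots> = det (cf.trace_mat w' w')" unfolding power2_eq_square using w'L by (intro ef'.det_emb_mult)
  also have "\<dots> = (det (ef.emb w'))\<^sup>2" unfolding power2_eq_square using w'L by (intro ef.det_emb_mult[symmetric])
  also have "\<dots> = (det (ef.emb \<omega>))\<^sup>2" by (rule ef.ibasis_disc_unique[OF \<omega> ib])
  finally have "complex_of_int D' = complex_of_int D" using D by simp
  then show "D' = D" by simp
qed

text \<open>First isomorphism theorem for evaluation at \<open>y\<close>: the map is onto because
  \<open>y\<close> generates the field, and its kernel consists of the multiples of \<open>f\<close>
  by minimality.\<close>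

lemma iso_quotient:
  assumes y: "y \<in> \<chi> ` carrier K" "inj_on (\<lambda>i. \<sigma> i y) {..<d}"
    and f: "of_int_poly f = (\<Prod>i<d. [:- \<sigma> i y, 1:])" "Polynomial.degree f = d" "Polynomial.lead_coeff f = 1"
  shows "K \<simeq> rat_poly_quotient (map_poly rat_of_int f)"
proof -
  interpret of_rat_poly: map_poly_inj_idom_hom "of_rat :: rat \<Rightarrow> complex" ..
  define R where "R = (ring_of_type_algebra :: rat poly ring)"
  have R: "cring R" unfolding R_def by (rule cring_from_type_algebra)
  define ev where "ev g = poly (map_poly of_rat g) y" for g :: "rat poly"
  define h where "h g = lift (ev g)" for g
  have evL: "ev g \<in> \<chi> ` carrier K" for g
    unfolding ev_def by (rule cf.hom_poly_rat(1)[OF ef.\<sigma>_hom[OF cf.d_pos] y(1)])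
  have hc: "h g \<in> carrier K" "\<chi> (h g) = ev g" for g using lift evL by (auto simp: h_def)
  have "h \<in> Ring.ring_hom R K"
  proof (rule ring_hom_memI)
    fix a b
    have "\<chi> (h (a * b)) = \<chi> (h a \<otimes> h b)" using hc by (simp add: \<chi>_mult ev_def of_rat_poly.hom_mult)
    then show "h (a \<otimes>\<^bsub>R\<^esub> b) = h a \<otimes> h b"
      using inj_onD[OF \<chi>_inj] hc by (simp add: R_def ring_of_type_algebra_def)
    have "\<chi> (h (a + b)) = \<chi> (h a \<oplus> h b)" using hc by (simp add: \<chi>_add ev_def of_rat_poly.hom_add)
    then show "h (a \<oplus>\<^bsub>R\<^esub> b) = h a \<oplus> h b"
      using inj_onD[OF \<chi>_inj] hc by (simp add: R_def ring_of_type_algebra_def)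
    show "h a \<in> carrier K" by (rule hc)
    have "\<chi> (h 1) = \<chi> \<one>" using hc by (simp add: ev_def \<chi>_one)
    then show "h \<one>\<^bsub>R\<^esub> = \<one>" using inj_onD[OF \<chi>_inj] hc by (simp add: R_def ring_of_type_algebra_def)
  qed
  then interpret hh: ring_hom_ring R K h
    using R cring_def ring_axioms by (intro ring_hom_ringI2) auto
  have "h ` carrier R = carrier K"
  proof
    show "h ` carrier R \<subseteq> carrier K" using hc by auto
    show "carrier K \<subseteq> h ` carrier R"
    proof
      fix x assume x: "x \<in> carrier K"
      then obtain g :: "rat poly" where g: "\<chi> x = poly (map_poly of_rat g) y"
        using ef.generator_surj[OF y, of "\<chi> x"] by blast
      then have "h g = x" using inj_onD[OF \<chi>_inj _ hc(1) x, of g] hc(2)[of g] by (simp add: ev_def)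
      then show "x \<in> h ` carrier R" by (auto simp: R_def ring_of_type_algebra_def)
    qed
  qed
  then have "R Quot (a_kernel R K h) \<simeq> K" by (rule hh.FactRing_iso)
  moreover have "a_kernel R K h = PIdl\<^bsub>R\<^esub> (map_poly rat_of_int f)"
  proof -
    have "h g = \<zero> \<longleftrightarrow> ev g = 0" for g using hc[of g] \<chi>_nonzero[of "h g"] \<chi>_zero by auto
    then have "h g = \<zero> \<longleftrightarrow> map_poly rat_of_int f dvd g" for g
      using ef.minimal_int_poly(2)[OF y f, of g] by (simp add: ev_def)
    then show ?thesis
      unfolding a_kernel_def' cgenideal_def R_def ring_of_type_algebra_def by (auto simp: dvd_def mult.commute)
  qed
  moreover have "ring (R Quot (a_kernel R K h))"
    by (rule ideal.quotient_is_ring[OF hh.kernel_is_ideal])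
  ultimately show ?thesis unfolding rat_poly_quotient_def R_def[symmetric] using ring_iso_sym by metis
qed

end

theorem theorem7p1:
  fixes K :: "('a, 'b) ring_scheme" and d r2 :: nat
  assumes "number_field K"
    and "field_degree K = d"
    and "num_complex_pairs K = r2"
  shows "\<exists>f :: int poly.
    Polynomial.lead_coeff f = 1 \<and>
    Factorial_Ring.irreducible f \<and>
    (\<forall>i\<le>Polynomial.degree f. Polynomial.coeff f i \<noteq> 0) \<and>
    K \<simeq> rat_poly_quotient (map_poly rat_of_int f) \<and>
    mahler_measure_monic (map_poly complex_of_int f) \<le>
      ((4 / pi) ^ r2 * (real d * (real d ^ 2 - real d + 2) / 2)
         * \<bar>real_of_int (discriminant K)\<bar> powr (1 / 2)) ^ d"
proof -
  interpret K: Ring.field K using assms(1) by (simp add: number_field_def)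
  have sf: "subfield (prime_subfield K) K"
    unfolding prime_subfield_def by (rule K.generate_field_is_subfield) simp
  obtain n where "K.dimension n (prime_subfield K) (carrier K)"
    using assms(1) by (auto simp: number_field_def K.finite_dimension_def)
  then obtain Vs where Vs: "K.independent (prime_subfield K) Vs" "K.Span (prime_subfield K) Vs = carrier K"
    using K.exists_base[OF sf] by blast
  interpret char0_finite_field K Vs
    by unfold_locales (use assms(1) Vs in \<open>auto simp: number_field_def\<close>)
  obtain \<chi> :: "'a \<Rightarrow> complex" where \<chi>: "\<And>x y. x \<in> carrier K \<Longrightarrow> y \<in> carrier K \<Longrightarrow> \<chi> (x \<oplus>\<^bsub>K\<^esub> y) = \<chi> x + \<chi> y"
    "\<And>x y. x \<in> carrier K \<Longrightarrow> y \<in> carrier K \<Longrightarrow> \<chi> (x \<otimes>\<^bsub>K\<^esub> y) = \<chi> x * \<chi> y" "\<chi> \<one>\<^bsub>K\<^esub> = 1"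
    using embedding_exists by blast
  interpret embedded_field K Vs \<chi> by unfold_locales (use \<chi> in auto)
  have d: "length Vs = d" using field_degree assms(2) by simp
  obtain \<sigma> where \<sigma>: "bij_betw \<sigma> {..<length Vs} cf.homs"
    using ex_bij_betw_nat_finite[OF cf.card_homs(1)] by (auto simp: cf.card_homs(2) atLeast0LessThan)
  interpret enumerated_embedded_field K Vs \<chi> \<sigma> by unfold_locales (rule \<sigma>)
  obtain \<omega> where \<omega>: "ef.ibasis \<omega>" "det (ef.emb \<omega>) \<noteq> 0" using ef.integral_basis_exists .
  obtain D where D: "(det (ef.emb \<omega>))\<^sup>2 = complex_of_int D"
    using ef.disc_int[of \<omega>] \<omega>(1) by (auto simp: ef.ibasis_def elim: Ints_cases)
  have disc: "discriminant K = D" by (rule discriminant_eq[OF \<omega> D[symmetric]])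
  define B where "B = real d * (real d ^ 2 - real d + 2) / 2 * cmod (det (ef.emb \<omega>))"
  have "(cmod (det (ef.emb \<omega>)))\<^sup>2 = \<bar>real_of_int D\<bar>"
    unfolding norm_power[symmetric] D by simp
  from real_sqrt_unique[OF this norm_ge_zero]
  have sq: "\<bar>real_of_int (discriminant K)\<bar> powr (1 / 2) = cmod (det (ef.emb \<omega>))"
    by (simp add: disc powr_half_sqrt)
  obtain y f where y: "y \<in> cf.OL" "inj_on (\<lambda>i. \<sigma> i y) {..<length Vs}" "\<And>i. i < length Vs \<Longrightarrow> cmod (\<sigma> i y) \<le> B"
    and f: "of_int_poly f = (\<Prod>i<length Vs. [:- \<sigma> i y, 1:])" "Polynomial.degree f = length Vs"
      "Polynomial.lead_coeff f = 1"
      "\<And>k. k \<le> Polynomial.degree f \<Longrightarrow> Polynomial.coeff f k \<noteq> 0"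
    using ef.small_generator_nonzero_coeffs[OF \<omega>] unfolding B_def d[symmetric] by blast
  have yL: "y \<in> \<chi> ` carrier K" by (rule cf.OL_in[OF y(1)])
  define C where
    "C = (4 / pi) ^ r2 * (real d * (real d ^ 2 - real d + 2) / 2) * \<bar>real_of_int (discriminant K)\<bar> powr (1 / 2)"
  have d0: "d > 0" using cf.d_pos d by simp
  \<comment> \<open>The Mahler measure replaces small roots by 1, so a bound on the roots transfers
    to it only if the bound is at least 1.\<close>
  have B1: "B \<ge> 1"
  proof -
    have q1: "real d * (real d ^ 2 - real d + 2) / 2 \<ge> 1"
    proof -
      have "real d * 1 \<le> real d * real d" using d0 by (intro mult_left_mono) auto
      then have "real d ^ 2 - real d + 2 \<ge> 2" by (simp add: power2_eq_square)
      then have "1 * 2 \<le> real d * (real d ^ 2 - real d + 2)" using d0 by (intro mult_mono) auto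
      then show ?thesis by simp
    qed
    have "1 * 1 \<le> B" unfolding B_def by (rule mult_mono[OF q1 ef.disc_ge_1[OF \<omega>]]) (use q1 in linarith)+
    then show ?thesis by simp
  qed
  have "B \<le> C"
  proof -
    \<comment> \<open>Here \<open>pi < 4\<close> enters: each complex pair contributes a factor
      above 1.\<close>
    have "(4 / pi) ^ r2 \<ge> 1" using pi_less_4 pi_gt_zero by (intro one_le_power) simp
    then have "1 * B \<le> (4 / pi) ^ r2 * B" using B1 by (intro mult_right_mono) auto
    then show ?thesis by (simp add: C_def B_def sq mult.assoc)
  qed
  have "mahler_measure_monic (of_int_poly f) \<le> B ^ length Vs"
    by (rule ef.mahler_le[OF f(1-3) y(3) B1])
  also have "\<dots> \<le> C ^ length Vs" using \<open>B \<le> C\<close> B1 by (intro power_mono) auto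
  finally have M: "mahler_measure_monic (of_int_poly f) \<le> C ^ d" by (simp add: d)
  show ?thesis
    using f(3,4) ef.minimal_int_poly(1)[OF yL y(2) f(1-3)] iso_quotient[OF yL y(2) f(1-3)] M
    by (intro exI[of _ f]) (auto simp: C_def)
qed

end
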